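(* If $F:X\to Y$ is a branched function and $U\subseteq X$, $V\subseteq Y$ are open sets such that $F(U)\subseteq V$, then $F:U\to V$ is branched and the inclusion maps induce a morphism of correspondences $$(i_U,i_U,i_V):{}_{C_{0}(U)}(E_{F,U},\alpha_{U})_{C_{0}(V)}\to {}_{C_{0}(X)}(E_{F,X}, \alpha_{X})_{C_{0}(Y)},$$ where $i_U:C_0(U)\to C_0(X)$ and $i_V:C_0(V)\to C_0(Y)$ are the inclusions (extension by zero).
   Context: All $C^*$-algebras and Hilbert modules are assumed separable. Let $X,Y$ be locally compact Hausdorff spaces. A continuous $F:X\to Y$ is a branched function if there is a function $\mathrm{ind}_F:X\to\mathbb N=\{1,2,\dots\}$ (the index function, part of the data) such that for every $x\in X$ there are a neighbourhood $U$ of $x$, a neighbourhood $V$ of $F(x)$ and functions $\{F_i^{-1}:V\to U\}_{i=1}^{\mathrm{ind}_F(x)}$ with: (1) $F\circ F_i^{-1}=\mathrm{id}_V$ for all $i$; (2) $F_i^{-1}(F(x))=x$ and $F_i^{-1}$ is continuous at $F(x)$ for all $i$; (3) $U=\bigcup_iF_i^{-1}(V)$; (4) for all $u\in U$, $\mathrm{ind}_F(u)=|\{i\le\mathrm{ind}_F(x):u\in F_i^{-1}(V)\}|$. The restriction $F:U\to V$ to open sets carries the restricted index function. For $f\in C_0(X)$ put $\Phi(f)(y)=\sum_{x\in F^{-1}(y)}\mathrm{ind}_F(x)f(x)$. The $C_0(X)$-$C_0(Y)$ correspondence $(E_{F,X},\alpha_X)$ of a branched function $F:X\to Y$ is $E_{F,X}=\{\psi\in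 C_0(X):\Phi(|\psi|^2)\in C_0(Y)\}$ (the completion of $C_c(X)$ for the inner product below) with right action $(\psi\cdot g)(x)=\psi(x)g(F(x))$, inner product $\langle\psi,\varphi\rangle=\Phi(\overline\psi\varphi)$ and left action $\alpha_X(f)\psi=f\psi$. For a correspondence ${}_{A_1}(E,\alpha)_{A_2}$, $J_{(E,\alpha)}=\alpha^{-1}(\mathcal K(E))$, where $\mathcal K(E)$ is the closed span of $\theta_{e,f}:g\mapsto e\langle f,g\rangle$. A morphism ${}_{A_1}(E,\alpha)_{A_2}\to{}_{B_1}(F,\beta)_{B_2}$ is a triple $(\varphi_1,S,\varphi_2)$ with $\varphi_1:A_1\to B_1$, $\varphi_2:A_2\to B_2$ $*$-homomorphisms and $S:E\to F$ linear such that: (1) $\langle S(e_1),S(e_2)\rangle=\varphi_2(\langle e_1,e_2\rangle)$; (2) $S(a\cdot e)=\varphi_1(a)\cdot S(e)$; (3) $\varphi_1(J_{(E,\alpha)})\subseteq J_{(F,\beta)}$; (4) $\hat S(\alpha(a))=\beta(\varphi_1(a))$ for all $a\in J_{(E,\alpha)}$, where $\hat S(\theta_{e,f})=\theta_{S(e),S(f)}$ determines the $*$-homomorphism $\hat S:\mathcal K(E)\to\mathcal K(F)$. The middle map $i_U$ in the claim is the restriction of $i_U$ to $E_{F,U}\subseteq C_0(U)$ with values in $E_{F,X}$. *)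

theory Defs
  imports "HOL-Analysis.Analysis"
begin

record 'v cvs =
  carrier :: "'v set"
  zero :: "'v" (\<open>\<zero>\<index>\<close>)
  add :: "'v \<Rightarrow> 'v \<Rightarrow> 'v" (infixl \<open>\<oplus>\<index>\<close> 65)
  scale :: "complex \<Rightarrow> 'v \<Rightarrow> 'v" (infixr \<open>\<odot>\<index>\<close> 75)

definition diff :: "('v, 'm) cvs_scheme \<Rightarrow> 'v \<Rightarrow> 'v \<Rightarrow> 'v" (infixl \<open>\<ominus>\<index>\<close> 65)
  where "x \<ominus>\<^bsub>V\<^esub> y = x \<oplus>\<^bsub>V\<^esub> (- 1) \<odot>\<^bsub>V\<^esub> y"

locale complex_vector_space =
  fixes V :: "('v, 'm) cvs_scheme" (structure)
  assumes zero_closed: "\<zero> \<in> carrier V"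
    and add_closed: "\<lbrakk>x \<in> carrier V; y \<in> carrier V\<rbrakk> \<Longrightarrow> x \<oplus> y \<in> carrier V"
    and scale_closed: "x \<in> carrier V \<Longrightarrow> c \<odot> x \<in> carrier V"
    and add_assoc: "\<lbrakk>x \<in> carrier V; y \<in> carrier V; z \<in> carrier V\<rbrakk>
      \<Longrightarrow> (x \<oplus> y) \<oplus> z = x \<oplus> (y \<oplus> z)"
    and add_commute: "\<lbrakk>x \<in> carrier V; y \<in> carrier V\<rbrakk> \<Longrightarrow> x \<oplus> y = y \<oplus> x"
    and add_zero: "x \<in> carrier V \<Longrightarrow> x \<oplus> \<zero> = x"
    and add_inverse: "x \<in> carrier V \<Longrightarrow> x \<ominus> x = \<zero>"
    and scale_add_right: "\<lbrakk>x \<in> carrier V; y \<in> carrier V\<rbrakk> \<Longrightarrow> c \<odot> (x \<oplus> y) = c \<odot> x \<oplus> c \<odot> y"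
    and scale_add_left: "x \<in> carrier V \<Longrightarrow> (c + d) \<odot> x = c \<odot> x \<oplus> d \<odot> x"
    and scale_scale: "x \<in> carrier V \<Longrightarrow> c \<odot> (d \<odot> x) = (c * d) \<odot> x"
    and scale_one: "x \<in> carrier V \<Longrightarrow> 1 \<odot> x = x"

definition complex_linear ::
    "('v, 'm) cvs_scheme \<Rightarrow> ('w, 'n) cvs_scheme \<Rightarrow> ('v \<Rightarrow> 'w) \<Rightarrow> bool"
  where "complex_linear V W f \<longleftrightarrow>
    f \<in> carrier V \<rightarrow> carrier W \<and>
    (\<forall>x\<in>carrier V. \<forall>y\<in>carrier V. f (x \<oplus>\<^bsub>V\<^esub> y) = f x \<oplus>\<^bsub>W\<^esub> f y) \<and>
    (\<forall>c. \<forall>x\<in>carrier V. f (c \<odot>\<^bsub>V\<^esub> x) = c \<odot>\<^bsub>W\<^esub> f x)"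

inductive_set linear_span :: "('v, 'm) cvs_scheme \<Rightarrow> 'v set \<Rightarrow> 'v set"
  for V :: "('v, 'm) cvs_scheme" and S :: "'v set" where
  zero: "\<zero>\<^bsub>V\<^esub> \<in> linear_span V S"
| step: "\<lbrakk>x \<in> linear_span V S; s \<in> S\<rbrakk> \<Longrightarrow> x \<oplus>\<^bsub>V\<^esub> c \<odot>\<^bsub>V\<^esub> s \<in> linear_span V S"

definition complete_wrt :: "('v, 'm) cvs_scheme \<Rightarrow> ('v \<Rightarrow> real) \<Rightarrow> bool"
  where "complete_wrt V N \<longleftrightarrow>
    (\<forall>s :: nat \<Rightarrow> 'v. range s \<subseteq> carrier V \<and>
      (\<forall>\<epsilon>>0. \<exists>n0. \<forall>m\<ge>n0. \<forall>n\<ge>n0. N (s m \<ominus>\<^bsub>V\<^esub> s n) < \<epsilon>)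
      \<longrightarrow> (\<exists>l\<in>carrier V. (\<lambda>n. N (s n \<ominus>\<^bsub>V\<^esub> l)) \<longlonglongrightarrow> 0))"

record 'a calg = "'a cvs" +
  mult :: "'a \<Rightarrow> 'a \<Rightarrow> 'a" (infixl \<open>\<otimes>\<index>\<close> 70)
  star :: "'a \<Rightarrow> 'a"
  nrm :: "'a \<Rightarrow> real"

locale cstar_algebra = complex_vector_space A
  for A :: "('a, 'm) calg_scheme" (structure) +
  assumes mult_closed: "\<lbrakk>x \<in> carrier A; y \<in> carrier A\<rbrakk> \<Longrightarrow> x \<otimes> y \<in> carrier A"
    and mult_assoc: "\<lbrakk>x \<in> carrier A; y \<in> carrier A; z \<in> carrier A\<rbrakk>
      \<Longrightarrow> (x \<otimes> y) \<otimes> z = x \<otimes> (y \<otimes> z)"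
    and distrib_left: "\<lbrakk>x \<in> carrier A; y \<in> carrier A; z \<in> carrier A\<rbrakk>
      \<Longrightarrow> x \<otimes> (y \<oplus> z) = x \<otimes> y \<oplus> x \<otimes> z"
    and distrib_right: "\<lbrakk>x \<in> carrier A; y \<in> carrier A; z \<in> carrier A\<rbrakk>
      \<Longrightarrow> (x \<oplus> y) \<otimes> z = x \<otimes> z \<oplus> y \<otimes> z"
    and mult_scale_left: "\<lbrakk>x \<in> carrier A; y \<in> carrier A\<rbrakk> \<Longrightarrow> (c \<odot> x) \<otimes> y = c \<odot> (x \<otimes> y)"
    and mult_scale_right: "\<lbrakk>x \<in> carrier A; y \<in> carrier A\<rbrakk> \<Longrightarrow> x \<otimes> (c \<odot> y) = c \<odot> (x \<otimes> y)"
    and star_closed: "x \<in> carrier A \<Longrightarrow> star A x \<in> carrier A"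
    and star_star: "x \<in> carrier A \<Longrightarrow> star A (star A x) = x"
    and star_add: "\<lbrakk>x \<in> carrier A; y \<in> carrier A\<rbrakk> \<Longrightarrow> star A (x \<oplus> y) = star A x \<oplus> star A y"
    and star_scale: "x \<in> carrier A \<Longrightarrow> star A (c \<odot> x) = cnj c \<odot> star A x"
    and star_mult: "\<lbrakk>x \<in> carrier A; y \<in> carrier A\<rbrakk> \<Longrightarrow> star A (x \<otimes> y) = star A y \<otimes> star A x"
    and nrm_eq_zero: "x \<in> carrier A \<Longrightarrow> nrm A x = 0 \<longleftrightarrow> x = \<zero>"
    and nrm_triangle: "\<lbrakk>x \<in> carrier A; y \<in> carrier A\<rbrakk> \<Longrightarrow> nrm A (x \<oplus> y) \<le> nrm A x + nrm A y"
    and nrm_scale: "x \<in> carrier A \<Longrightarrow> nrm A (c \<odot> x) = cmod c * nrm A x"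
    and nrm_mult: "\<lbrakk>x \<in> carrier A; y \<in> carrier A\<rbrakk> \<Longrightarrow> nrm A (x \<otimes> y) \<le> nrm A x * nrm A y"
    and nrm_star_mult: "x \<in> carrier A \<Longrightarrow> nrm A (star A x \<otimes> x) = (nrm A x)\<^sup>2"
    and complete: "complete_wrt A (nrm A)"

definition separable_calg :: "('a, 'm) calg_scheme \<Rightarrow> bool"
  where "separable_calg A \<longleftrightarrow>
    (\<exists>D\<subseteq>carrier A. countable D \<and> (\<forall>x\<in>carrier A. \<forall>\<epsilon>>0. \<exists>d\<in>D. nrm A (x \<ominus>\<^bsub>A\<^esub> d) < \<epsilon>))"

definition star_hom :: "('a, 'm) calg_scheme \<Rightarrow> ('b, 'n) calg_scheme \<Rightarrow> ('a \<Rightarrow> 'b) \<Rightarrow> bool"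
  where "star_hom A B \<phi> \<longleftrightarrow>
    complex_linear A B \<phi> \<and>
    (\<forall>x\<in>carrier A. \<forall>y\<in>carrier A. \<phi> (x \<otimes>\<^bsub>A\<^esub> y) = \<phi> x \<otimes>\<^bsub>B\<^esub> \<phi> y) \<and>
    (\<forall>x\<in>carrier A. \<phi> (star A x) = star B (\<phi> x))"

definition closed_span :: "('a, 'm) calg_scheme \<Rightarrow> 'a set \<Rightarrow> 'a set"
  where "closed_span A S =
    {x \<in> carrier A. \<forall>\<epsilon>>0. \<exists>y\<in>linear_span A S. nrm A (x \<ominus>\<^bsub>A\<^esub> y) < \<epsilon>}"

record ('e, 'b) hmod = "'e cvs" +
  coeff :: "'b calg"
  ract :: "'e \<Rightarrow> 'b \<Rightarrow> 'e"
  ip :: "'e \<Rightarrow> 'e \<Rightarrow> 'b"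

definition hnorm :: "('e, 'b, 'm) hmod_scheme \<Rightarrow> 'e \<Rightarrow> real"
  where "hnorm E e = sqrt (nrm (coeff E) (ip E e e))"

locale hilbert_module = complex_vector_space E + B: cstar_algebra "coeff E"
  for E :: "('e, 'b, 'm) hmod_scheme" (structure) +
  assumes ract_closed: "\<lbrakk>e \<in> carrier E; b \<in> carrier (coeff E)\<rbrakk> \<Longrightarrow> ract E e b \<in> carrier E"
    and ract_add_left: "\<lbrakk>e \<in> carrier E; f \<in> carrier E; b \<in> carrier (coeff E)\<rbrakk>
      \<Longrightarrow> ract E (e \<oplus> f) b = ract E e b \<oplus> ract E f b"
    and ract_add_right: "\<lbrakk>e \<in> carrier E; b \<in> carrier (coeff E); c \<in> carrier (coeff E)\<rbrakk>
      \<Longrightarrow> ract E e (b \<oplus>\<^bsub>coeff E\<^esub> c) = ract E e b \<oplus> ract E e c"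
    and ract_scale_left: "\<lbrakk>e \<in> carrier E; b \<in> carrier (coeff E)\<rbrakk>
      \<Longrightarrow> ract E (z \<odot> e) b = z \<odot> ract E e b"
    and ract_scale_right: "\<lbrakk>e \<in> carrier E; b \<in> carrier (coeff E)\<rbrakk>
      \<Longrightarrow> ract E e (z \<odot>\<^bsub>coeff E\<^esub> b) = z \<odot> ract E e b"
    and ract_mult: "\<lbrakk>e \<in> carrier E; b \<in> carrier (coeff E); c \<in> carrier (coeff E)\<rbrakk>
      \<Longrightarrow> ract E e (b \<otimes>\<^bsub>coeff E\<^esub> c) = ract E (ract E e b) c"
    and ip_closed: "\<lbrakk>e \<in> carrier E; f \<in> carrier E\<rbrakk> \<Longrightarrow> ip E e f \<in> carrier (coeff E)"
    and ip_add: "\<lbrakk>e \<in> carrier E; f \<in> carrier E; g \<in> carrier E\<rbrakk>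
      \<Longrightarrow> ip E e (f \<oplus> g) = ip E e f \<oplus>\<^bsub>coeff E\<^esub> ip E e g"
    and ip_scale: "\<lbrakk>e \<in> carrier E; f \<in> carrier E\<rbrakk> \<Longrightarrow> ip E e (z \<odot> f) = z \<odot>\<^bsub>coeff E\<^esub> ip E e f"
    and ip_ract: "\<lbrakk>e \<in> carrier E; f \<in> carrier E; b \<in> carrier (coeff E)\<rbrakk>
      \<Longrightarrow> ip E e (ract E f b) = ip E e f \<otimes>\<^bsub>coeff E\<^esub> b"
    and ip_star: "\<lbrakk>e \<in> carrier E; f \<in> carrier E\<rbrakk> \<Longrightarrow> star (coeff E) (ip E e f) = ip E f e"
    and ip_positive: "e \<in> carrier E
      \<Longrightarrow> \<exists>b\<in>carrier (coeff E). ip E e e = star (coeff E) b \<otimes>\<^bsub>coeff E\<^esub> b"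
    and ip_definite: "e \<in> carrier E \<Longrightarrow> ip E e e = \<zero>\<^bsub>coeff E\<^esub> \<Longrightarrow> e = \<zero>"
    and hcomplete: "complete_wrt E (hnorm E)"

text \<open>Operators on \<open>E\<close> are functions that are \<^const>\<open>undefined\<close> off the carrier, so that
  equality of HOL functions is equality of operators.\<close>

definition adjoint_pair :: "('e, 'b, 'm) hmod_scheme \<Rightarrow> ('e \<Rightarrow> 'e) \<Rightarrow> ('e \<Rightarrow> 'e) \<Rightarrow> bool"
  where "adjoint_pair E T T' \<longleftrightarrow>
    T \<in> carrier E \<rightarrow>\<^sub>E carrier E \<and> T' \<in> carrier E \<rightarrow>\<^sub>E carrier E \<and>
    (\<forall>e\<in>carrier E. \<forall>f\<in>carrier E. ip E (T e) f = ip E e (T' f))"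

text \<open>Adjointable operators are automatically bounded (Banach--Steinhaus); the bound is listed
  so that the supremum defining the operator norm is visibly that of a bounded set.\<close>

definition adjointables :: "('e, 'b, 'm) hmod_scheme \<Rightarrow> ('e \<Rightarrow> 'e) calg"
  where "adjointables E =
    \<lparr>carrier = {T. (\<exists>T'. adjoint_pair E T T') \<and>
                   (\<exists>c. \<forall>e\<in>carrier E. hnorm E (T e) \<le> c * hnorm E e)},
     zero = (\<lambda>e\<in>carrier E. \<zero>\<^bsub>E\<^esub>),
     add = (\<lambda>S T. \<lambda>e\<in>carrier E. S e \<oplus>\<^bsub>E\<^esub> T e),
     scale = (\<lambda>c T. \<lambda>e\<in>carrier E. c \<odot>\<^bsub>E\<^esub> T e),
     mult = (\<lambda>S T. compose (carrier E) S T),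
     star = (\<lambda>T. THE T'. adjoint_pair E T T'),
     nrm = (\<lambda>T. SUP e\<in>{e\<in>carrier E. hnorm E e \<le> 1}. hnorm E (T e))\<rparr>"

definition theta :: "('e, 'b, 'm) hmod_scheme \<Rightarrow> 'e \<Rightarrow> 'e \<Rightarrow> 'e \<Rightarrow> 'e"
  where "theta E e f = (\<lambda>g\<in>carrier E. ract E e (ip E f g))"

definition compacts :: "('e, 'b, 'm) hmod_scheme \<Rightarrow> ('e \<Rightarrow> 'e) calg"
  where "compacts E = (adjointables E)
    \<lparr>carrier := closed_span (adjointables E)
       {theta E e f | e f. e \<in> carrier E \<and> f \<in> carrier E}\<rparr>"

record ('a, 'e, 'b) corr = "('e, 'b) hmod" +
  left_alg :: "'a calg"
  lact :: "'a \<Rightarrow> 'e \<Rightarrow> 'e"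

locale correspondence = hilbert_module E + A: cstar_algebra "left_alg E"
  for E :: "('a, 'e, 'b, 'm) corr_scheme" (structure) +
  assumes lact_hom: "star_hom (left_alg E) (adjointables E) (lact E)"

definition J_ideal :: "('a, 'e, 'b, 'm) corr_scheme \<Rightarrow> 'a set"
  where "J_ideal E = {a \<in> carrier (left_alg E). lact E a \<in> carrier (compacts E)}"

text \<open>The *-homomorphism between the algebras of compact operators induced by \<open>S\<close>.  A
  *-homomorphism of \<open>C*\<close>-algebras is automatically contractive, so the norm condition excludes
  nothing; with it, uniqueness is immediate by density of the span of the \<^const>\<open>theta\<close>s.\<close>

definition hat ::
    "('e, 'b, 'm) hmod_scheme \<Rightarrow> ('f, 'd, 'n) hmod_scheme \<Rightarrow> ('e \<Rightarrow> 'f) \<Rightarrow> ('e \<Rightarrow> 'e) \<Rightarrow> ('f \<Rightarrow> 'f)"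
  where "hat E F S = (THE h.
    h \<in> extensional (carrier (compacts E)) \<and>
    star_hom (compacts E) (compacts F) h \<and>
    (\<forall>T\<in>carrier (compacts E). nrm (compacts F) (h T) \<le> nrm (compacts E) T) \<and>
    (\<forall>e\<in>carrier E. \<forall>f\<in>carrier E. h (theta E e f) = theta F (S e) (S f)))"

definition corr_morphism ::
    "('a, 'e, 'b, 'm) corr_scheme \<Rightarrow> ('c, 'f, 'd, 'n) corr_scheme
      \<Rightarrow> ('a \<Rightarrow> 'c) \<Rightarrow> ('e \<Rightarrow> 'f) \<Rightarrow> ('b \<Rightarrow> 'd) \<Rightarrow> bool"
  where "corr_morphism E F \<phi>1 S \<phi>2 \<longleftrightarrow>
    correspondence E \<and> correspondence F \<and>
    star_hom (left_alg E) (left_alg F) \<phi>1 \<and>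
    star_hom (coeff E) (coeff F) \<phi>2 \<and>
    complex_linear E F S \<and>
    (\<forall>e\<in>carrier E. \<forall>f\<in>carrier E. ip F (S e) (S f) = \<phi>2 (ip E e f)) \<and>
    (\<forall>a\<in>carrier (left_alg E). \<forall>e\<in>carrier E. S (lact E a e) = lact F (\<phi>1 a) (S e)) \<and>
    \<phi>1 ` J_ideal E \<subseteq> J_ideal F \<and>
    (\<forall>a\<in>J_ideal E. hat E F S (lact E a) = lact F (\<phi>1 a))"

definition nhd :: "'a topology \<Rightarrow> 'a \<Rightarrow> 'a set \<Rightarrow> bool"
  where "nhd X x N \<longleftrightarrow> N \<subseteq> topspace X \<and> (\<exists>W. openin X W \<and> x \<in> W \<and> W \<subseteq> N)"

text \<open>Only the values of \<open>F\<close> and \<open>ind\<close> on the space \<open>X\<close> matter, so a restriction to an open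
  subspace is expressed by keeping both functions and passing to \<^const>\<open>subtopology\<close>.\<close>

definition branched :: "'a topology \<Rightarrow> 'b topology \<Rightarrow> ('a \<Rightarrow> 'b) \<Rightarrow> ('a \<Rightarrow> nat) \<Rightarrow> bool"
  where "branched X Y F ind \<longleftrightarrow>
    continuous_map X Y F \<and> (\<forall>x\<in>topspace X. ind x \<ge> 1) \<and>
    (\<forall>x\<in>topspace X. \<exists>U V. nhd X x U \<and> nhd Y (F x) V \<and>
      (\<exists>G :: nat \<Rightarrow> 'b \<Rightarrow> 'a.
        (\<forall>i\<in>{1..ind x}. \<forall>v\<in>V. G i v \<in> U \<and> F (G i v) = v) \<and>
        (\<forall>i\<in>{1..ind x}. G i (F x) = x \<and>
           topcontinuous_at (subtopology Y V) (subtopology X U) (G i) (F x)) \<and>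
        U = (\<Union>i\<in>{1..ind x}. G i ` V) \<and>
        (\<forall>u\<in>U. ind u = card {i\<in>{1..ind x}. u \<in> G i ` V})))"

text \<open>Elements of \<open>C\<^sub>0(X)\<close> are represented by functions that are \<open>0\<close> off the space \<open>X\<close>; in
  particular the supremum of \<open>|f|\<close> over the whole type is the one over \<open>X\<close>, also for empty \<open>X\<close>.\<close>

definition C0 :: "'a topology \<Rightarrow> ('a \<Rightarrow> complex) calg"
  where "C0 X =
    \<lparr>carrier = {f. continuous_map X euclidean f \<and> (\<forall>x. x \<notin> topspace X \<longrightarrow> f x = 0) \<and>
                   (\<forall>\<epsilon>>0. \<exists>K. compactin X K \<and> (\<forall>x\<in>topspace X - K. cmod (f x) < \<epsilon>))},
     zero = (\<lambda>x. 0),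
     add = (\<lambda>f g x. f x + g x),
     scale = (\<lambda>c f x. c * f x),
     mult = (\<lambda>f g x. f x * g x),
     star = (\<lambda>f x. cnj (f x)),
     nrm = (\<lambda>f. SUP x. cmod (f x))\<rparr>"

definition fibre :: "'a topology \<Rightarrow> ('a \<Rightarrow> 'b) \<Rightarrow> 'b \<Rightarrow> 'a set"
  where "fibre X F y = {x \<in> topspace X. F x = y}"

definition Phi :: "'a topology \<Rightarrow> 'b topology \<Rightarrow> ('a \<Rightarrow> 'b) \<Rightarrow> ('a \<Rightarrow> nat)
      \<Rightarrow> ('a \<Rightarrow> complex) \<Rightarrow> 'b \<Rightarrow> complex"
  where "Phi X Y F ind f y =
    (if y \<in> topspace Y then \<Sum>\<^sub>\<infinity>x\<in>fibre X F y. of_nat (ind x) * f x else 0)"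

text \<open>Fibres may be infinite.  Since \<^const>\<open>infsum\<close> is \<open>0\<close> on families that are not summable,
  convergence of the sums defining \<open>\<Phi>(|\<psi>|\<^sup>2)\<close> is required separately.\<close>

definition branched_module_carrier ::
    "'a topology \<Rightarrow> 'b topology \<Rightarrow> ('a \<Rightarrow> 'b) \<Rightarrow> ('a \<Rightarrow> nat) \<Rightarrow> ('a \<Rightarrow> complex) set"
  where "branched_module_carrier X Y F ind =
    {\<psi> \<in> carrier (C0 X).
       (\<forall>y\<in>topspace Y. (\<lambda>x. real (ind x) * (cmod (\<psi> x))\<^sup>2) summable_on fibre X F y) \<and>
       Phi X Y F ind (\<lambda>x. complex_of_real ((cmod (\<psi> x))\<^sup>2)) \<in> carrier (C0 Y)}"

definition branched_corr ::
    "'a topology \<Rightarrow> 'b topology \<Rightarrow> ('a \<Rightarrow> 'b) \<Rightarrow> ('a \<Rightarrow> nat)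
      \<Rightarrow> ('a \<Rightarrow> complex, 'a \<Rightarrow> complex, 'b \<Rightarrow> complex) corr"
  where "branched_corr X Y F ind =
    \<lparr>carrier = branched_module_carrier X Y F ind,
     zero = (\<lambda>x. 0),
     add = (\<lambda>\<psi> \<phi> x. \<psi> x + \<phi> x),
     scale = (\<lambda>c \<psi> x. c * \<psi> x),
     coeff = C0 Y,
     ract = (\<lambda>\<psi> g x. \<psi> x * g (F x)),
     ip = (\<lambda>\<psi> \<phi>. Phi X Y F ind (\<lambda>x. cnj (\<psi> x) * \<phi> x)),
     left_alg = C0 X,
     lact = (\<lambda>f. \<lambda>\<psi>\<in>branched_module_carrier X Y F ind. \<lambda>x. f x * \<psi> x)\<rparr>"

definition ext_zero :: "'a set \<Rightarrow> ('a \<Rightarrow> complex) \<Rightarrow> 'a \<Rightarrow> complex"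
  where "ext_zero U f = (\<lambda>x. if x \<in> U then f x else 0)"

end

theory Submission
  imports Defs
begin

text \<open>Since \<open>U\<close> is open and \<open>X\<close> is Hausdorff, \<open>C\<^sub>0(U)\<close> consists of the functions in
  \<open>C\<^sub>0(X)\<close> vanishing off \<open>U\<close>, and likewise \<open>E\<^bsub>F,U\<^esub>\<close> inside \<open>E\<^bsub>F,X\<^esub>\<close>; extension by zero is
  the inclusion.  That these modules are correspondences rests on dominated convergence along
  fibres: if \<open>f\<close> is continuous, \<open>\<bar>f\<bar> \<le> h\<close> and \<open>\<Phi>(h) \<in> C\<^sub>0(Y)\<close>, then \<open>\<Phi>(f) \<in> C\<^sub>0(Y)\<close>.

  For the compact operators, let \<open>t\<close> be a combination of \<open>\<theta>\<^bsub>e,f\<^esub>\<close> with \<open>e, f \<in> E\<^bsub>F,U\<^esub>\<close> and of left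
  multiplications by elements of \<open>C\<^sub>0(U)\<close>, and let \<open>r\<close> be the same expression on \<open>E\<^bsub>F,X\<^esub>\<close>.  For
  \<open>g \<in> E\<^bsub>F,X\<^esub>\<close> and a cutoff function \<open>\<eta> \<in> C\<^sub>0(U)\<close>, \<open>\<bar>\<eta>\<bar> \<le> 1\<close>, the product \<open>\<eta> g\<close> lies in
  \<open>E\<^bsub>F,U\<^esub>\<close>, so \<open>r(\<eta> g) = t(\<eta> g)\<close> has norm at most \<open>\<parallel>t\<parallel> \<parallel>g\<parallel>\<close>.  As \<open>\<eta>\<close> tends to 1 on finite subsets
  of \<open>U\<close>, \<open>r(\<eta> g)\<close> tends to \<open>r g\<close> pointwise, and Fatou's lemma on the fibres gives
  \<open>\<parallel>r\<parallel> \<le> \<parallel>t\<parallel>\<close>.  Hence \<open>\<theta>\<^bsub>e,f\<^esub> \<mapsto> \<theta>\<^bsub>e,f\<^esub>\<close> extends to the compact operators, and the same estimate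
  applied to \<open>\<alpha>\<^sub>U(a) - t\<close> shows that the extension maps \<open>\<alpha>\<^sub>U(a)\<close> to \<open>\<alpha>\<^sub>X(a)\<close>.\<close>

subsection \<open>Vector spaces, norms and convergence\<close>

text \<open>An operator has many expansions into rank-one operators, so a rule prescribed on
  \<open>theta E e f\<close> does not visibly define a map on their span. The proof therefore works
  with the set of pairs (t, r) formed by one expression read in both modules. This set is closed
  under the algebra operations, and the norm inequality alone makes its closure the graph of a map:
  a pair (0, r) forces r = 0, and Cauchy sequences go to Cauchy sequences. The inclusion of the
  ideals comes from the same closure, whose second coordinates are limits of finite-rank operators.
  The restriction of r to the smaller module says nothing by itself about r on functions that live
  partly off \<open>U\<close>; the comparison needs the special form of r, with its vectors
  supported in \<open>U\<close>. Hence the inequality is proved for a class of pairs singled out by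
  a limit condition, not for arbitrary extensions of operators. Fibres may be infinite, so norms are
  reached through finite partial sums over fibres, inside which pointwise limits are harmless;
  completeness and the comparison of norms both rest on this.\<close>

context complex_vector_space
begin

lemma diff_closed: "\<lbrakk>x \<in> carrier V; y \<in> carrier V\<rbrakk> \<Longrightarrow> x \<ominus> y \<in> carrier V"
  by (simp add: diff_def add_closed scale_closed)

lemma zero_add: "x \<in> carrier V \<Longrightarrow> \<zero> \<oplus> x = x"
  using add_commute add_zero zero_closed by metis

lemma add_left_commute:
  "\<lbrakk>x \<in> carrier V; y \<in> carrier V; z \<in> carrier V\<rbrakk> \<Longrightarrow> x \<oplus> (y \<oplus> z) = y \<oplus> (x \<oplus> z)"
  using add_assoc add_commute by metis

lemma add_neg: "x \<in> carrier V \<Longrightarrow> x \<oplus> (- 1) \<odot> x = \<zero>"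
  using add_inverse by (simp add: diff_def)

lemma add_neg_cancel: "\<lbrakk>x \<in> carrier V; y \<in> carrier V\<rbrakk> \<Longrightarrow> x \<oplus> ((- 1) \<odot> x \<oplus> y) = y"
  by (metis add_assoc add_neg scale_closed zero_add)

lemma neg_add_cancel: "\<lbrakk>x \<in> carrier V; y \<in> carrier V\<rbrakk> \<Longrightarrow> (- 1) \<odot> x \<oplus> (x \<oplus> y) = y"
  by (simp add: add_left_commute scale_closed add_neg_cancel)

lemma scale_zero_left: "x \<in> carrier V \<Longrightarrow> 0 \<odot> x = \<zero>"
  using scale_add_left[of x 1 "- 1"] add_neg by (simp add: scale_one)

lemma scale_zero_right: "c \<odot> \<zero> = \<zero>"
  by (metis mult_zero_right scale_scale scale_zero_left zero_closed)

lemma diff_zero: "x \<in> carrier V \<Longrightarrow> x \<ominus> \<zero> = x"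
  by (simp add: diff_def scale_zero_right add_zero)

lemmas vs_closed = zero_closed add_closed scale_closed diff_closed

lemma diff_eq_zero_iff:
  assumes "x \<in> carrier V" "y \<in> carrier V"
  shows "x \<ominus> y = \<zero> \<longleftrightarrow> x = y"
proof
  assume "x \<ominus> y = \<zero>"
  then have "y \<oplus> (x \<ominus> y) = y" using assms by (simp add: add_zero)
  moreover have "y \<oplus> (x \<ominus> y) = x"
    using assms by (simp add: diff_def add_left_commute[of y] add_neg add_zero vs_closed)
  ultimately show "x = y" by simp
qed (use assms add_inverse in simp)

lemma diff_trans:
  assumes "x \<in> carrier V" "y \<in> carrier V" "z \<in> carrier V"
  shows "x \<ominus> z = (x \<ominus> y) \<oplus> (y \<ominus> z)"
  using assms by (simp add: diff_def add_assoc neg_add_cancel vs_closed)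

lemma diff_commute:
  assumes "x \<in> carrier V" "y \<in> carrier V"
  shows "y \<ominus> x = (- 1) \<odot> (x \<ominus> y)"
  using assms by (simp add: diff_def scale_add_right scale_scale scale_one add_commute vs_closed)

lemma add_diff_add:
  assumes "x \<in> carrier V" "y \<in> carrier V" "x' \<in> carrier V" "y' \<in> carrier V"
  shows "(x \<oplus> y) \<ominus> (x' \<oplus> y') = (x \<ominus> x') \<oplus> (y \<ominus> y')"
  using assms by (simp add: diff_def scale_add_right add_assoc add_left_commute vs_closed)

lemma scale_diff:
  assumes "x \<in> carrier V" "y \<in> carrier V"
  shows "c \<odot> (x \<ominus> y) = c \<odot> x \<ominus> c \<odot> y"
  using assms by (simp add: diff_def scale_add_right scale_scale vs_closed)

lemma linear_span_closed:
  assumes "x \<in> linear_span V S" "S \<subseteq> carrier V"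
  shows "x \<in> carrier V"
  using assms by induction (auto intro: vs_closed)

end

lemma complex_linear_add:
  "\<lbrakk>complex_linear V W f; x \<in> carrier V; y \<in> carrier V\<rbrakk> \<Longrightarrow> f (x \<oplus>\<^bsub>V\<^esub> y) = f x \<oplus>\<^bsub>W\<^esub> f y"
  and complex_linear_scale:
  "\<lbrakk>complex_linear V W f; x \<in> carrier V\<rbrakk> \<Longrightarrow> f (c \<odot>\<^bsub>V\<^esub> x) = c \<odot>\<^bsub>W\<^esub> f x"
  and complex_linear_closed: "\<lbrakk>complex_linear V W f; x \<in> carrier V\<rbrakk> \<Longrightarrow> f x \<in> carrier W"
  by (auto simp: complex_linear_def)

text \<open>The norm is a parameter and not a record field because the same lemmas serve the norm
  \<open>nrm A\<close> of an algebra and the derived norm \<open>hnorm E\<close> of a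
  module.\<close>

locale normed_cvs = complex_vector_space V
  for V :: "('v, 'm) cvs_scheme" (structure) and N :: "'v \<Rightarrow> real" +
  assumes N_eq_zero: "x \<in> carrier V \<Longrightarrow> N x = 0 \<longleftrightarrow> x = \<zero>"
    and N_triangle: "\<lbrakk>x \<in> carrier V; y \<in> carrier V\<rbrakk> \<Longrightarrow> N (x \<oplus> y) \<le> N x + N y"
    and N_scale: "x \<in> carrier V \<Longrightarrow> N (c \<odot> x) = cmod c * N x"
begin

lemma N_zero: "N \<zero> = 0"
  by (simp add: N_eq_zero zero_closed)

text \<open>No axiom of its own: 0 = N(x - x) \<le> N x + N x.\<close>

lemma N_nonneg: "x \<in> carrier V \<Longrightarrow> 0 \<le> N x"
  using N_triangle[of x "(- 1) \<odot> x"] by (simp add: add_neg N_zero N_scale scale_closed)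

lemma N_diff_commute: "\<lbrakk>x \<in> carrier V; y \<in> carrier V\<rbrakk> \<Longrightarrow> N (x \<ominus> y) = N (y \<ominus> x)"
  by (subst diff_commute) (simp_all add: N_scale diff_closed)

lemma N_diff_trans:
  "\<lbrakk>x \<in> carrier V; y \<in> carrier V; z \<in> carrier V\<rbrakk> \<Longrightarrow> N (x \<ominus> z) \<le> N (x \<ominus> y) + N (y \<ominus> z)"
  by (subst diff_trans[of x y z]) (auto intro!: N_triangle diff_closed)

lemma N_le_diff: "\<lbrakk>x \<in> carrier V; y \<in> carrier V\<rbrakk> \<Longrightarrow> N x \<le> N (x \<ominus> y) + N y"
  using N_diff_trans[of x y \<zero>] by (simp add: zero_closed diff_zero)

lemma N_abs_diff_le: "\<lbrakk>x \<in> carrier V; y \<in> carrier V\<rbrakk> \<Longrightarrow> \<bar>N x - N y\<bar> \<le> N (x \<ominus> y)"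
  using N_le_diff[of x y] N_le_diff[of y x] N_diff_commute[of x y] by linarith

text \<open>Membership of all terms and of the limit is part of the notion, so that the closure
  conditions of the limit rules come with each convergence.\<close>

definition converges :: "(nat \<Rightarrow> 'v) \<Rightarrow> 'v \<Rightarrow> bool"
  where "converges s l \<longleftrightarrow> (\<forall>n. s n \<in> carrier V) \<and> l \<in> carrier V \<and> (\<lambda>n. N (s n \<ominus> l)) \<longlonglongrightarrow> 0"

lemma convergesD:
  assumes "converges s l"
  shows "s n \<in> carrier V" "l \<in> carrier V" "(\<lambda>n. N (s n \<ominus> l)) \<longlonglongrightarrow> 0"
  using assms by (auto simp: converges_def)

lemma convergesI:
  assumes "\<And>n. s n \<in> carrier V" "l \<in> carrier V" "\<And>n. N (s n \<ominus> l) \<le> u n" "u \<longlonglongrightarrow> 0"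
  shows "converges s l"
  unfolding converges_def
  using assms by (auto intro!: Lim_null_comparison[OF _ assms(4)] simp: N_nonneg diff_closed)

lemma converges_const: "l \<in> carrier V \<Longrightarrow> converges (\<lambda>_. l) l"
  by (auto simp: converges_def add_inverse N_zero)

lemma converges_add:
  assumes "converges s l" "converges s' l'"
  shows "converges (\<lambda>n. s n \<oplus> s' n) (l \<oplus> l')"
proof (rule convergesI)
  show "N ((s n \<oplus> s' n) \<ominus> (l \<oplus> l')) \<le> N (s n \<ominus> l) + N (s' n \<ominus> l')" for n
    using assms[THEN convergesD(1)] assms[THEN convergesD(2)]
    by (simp add: add_diff_add N_triangle diff_closed)
  show "(\<lambda>n. N (s n \<ominus> l) + N (s' n \<ominus> l')) \<longlonglongrightarrow> 0"
    using tendsto_add[OF assms[THEN convergesD(3)]] by simp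
qed (use assms in \<open>auto dest: convergesD intro: add_closed\<close>)

lemma converges_scale:
  assumes "converges s l"
  shows "converges (\<lambda>n. c \<odot> s n) (c \<odot> l)"
proof (rule convergesI)
  show "N ((c \<odot> s n) \<ominus> (c \<odot> l)) \<le> cmod c * N (s n \<ominus> l)" for n
    using convergesD(1,2)[OF assms] by (simp flip: scale_diff add: N_scale diff_closed)
  show "(\<lambda>n. cmod c * N (s n \<ominus> l)) \<longlonglongrightarrow> 0"
    using tendsto_mult_left[OF convergesD(3)[OF assms]] by simp
qed (use assms in \<open>auto dest: convergesD intro: scale_closed\<close>)

lemma converges_diff:
  "\<lbrakk>converges s l; converges s' l'\<rbrakk> \<Longrightarrow> converges (\<lambda>n. s n \<ominus> s' n) (l \<ominus> l')"
  unfolding diff_def by (intro converges_add converges_scale)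

lemma converges_N:
  assumes "converges s l"
  shows "(\<lambda>n. N (s n)) \<longlonglongrightarrow> N l"
proof -
  have "(\<lambda>n. N (s n) - N l) \<longlonglongrightarrow> 0"
    using convergesD[OF assms] by (intro Lim_null_comparison[OF _ convergesD(3)[OF assms]])
      (auto intro!: always_eventually N_abs_diff_le)
  then show ?thesis by (simp add: LIM_zero_iff)
qed

text \<open>The difference of the sequence with itself is constantly zero and also tends to l - l';
  continuity of the norm finishes.\<close>

lemma converges_unique:
  assumes "converges s l" "converges s l'"
  shows "l = l'"
proof -
  have "s n \<ominus> s n = \<zero>" for n
    using convergesD(1)[OF assms(1)] by (simp add: add_inverse)
  then have "(\<lambda>n. N \<zero>) \<longlonglongrightarrow> N (l \<ominus> l')"
    using converges_N[OF converges_diff[OF assms]] by simp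
  then have "N (l \<ominus> l') = 0"
    by (simp add: LIMSEQ_const_iff N_zero)
  then show ?thesis
    using assms convergesD by (simp add: N_eq_zero diff_closed diff_eq_zero_iff)
qed

lemma converges_Cauchy:
  assumes "converges s l" "0 < \<epsilon>"
  shows "\<exists>n0. \<forall>m\<ge>n0. \<forall>n\<ge>n0. N (s m \<ominus> s n) < \<epsilon>"
proof -
  have "\<forall>\<^sub>F n in sequentially. N (s n \<ominus> l) < \<epsilon> / 2"
    using order_tendstoD(2)[OF convergesD(3)[OF assms(1)], of "\<epsilon> / 2"] assms(2) by simp
  then obtain n0 where n0: "\<And>n. n \<ge> n0 \<Longrightarrow> N (s n \<ominus> l) < \<epsilon> / 2"
    by (auto simp: eventually_sequentially)
  have "N (s m \<ominus> s n) < \<epsilon>" if "m \<ge> n0" "n \<ge> n0" for m n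
    using N_diff_trans[of "s m" l "s n"] n0[OF that(1)] n0[OF that(2)] convergesD[OF assms(1)]
      N_diff_commute[of "s n" l] by fastforce
  then show ?thesis by blast
qed

lemma complete_converges:
  assumes "complete_wrt V N" "\<And>n. s n \<in> carrier V"
    and "\<And>\<epsilon>. 0 < \<epsilon> \<Longrightarrow> \<exists>n0. \<forall>m\<ge>n0. \<forall>n\<ge>n0. N (s m \<ominus> s n) < \<epsilon>"
  obtains l where "converges s l"
  using assms unfolding complete_wrt_def converges_def by (metis image_subsetI)

end

sublocale cstar_algebra \<subseteq> normed_cvs A "nrm A"
  by unfold_locales (simp_all add: nrm_eq_zero nrm_triangle nrm_scale)

section \<open>Continuity of the C*-algebra operations; closed spans through sequences\<close>

context cstar_algebra
begin

text \<open>The C*-identity gives \<open>(nrm A x)\<^sup>2\<close> \<le>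
  \<open>nrm A (star A x) * nrm A x\<close>; cancelling one factor yields one inequality, and
  applying it to \<open>star A x\<close> yields the other.\<close>

lemma nrm_star: 
  assumes "x \<in> carrier A" shows "nrm A (star A x) = nrm A x"
proof -
  have *: "nrm A x \<le> nrm A (star A x)" if "x \<in> carrier A" for x
  proof (cases "nrm A x = 0")
    case False
    then have "0 < nrm A x" using N_nonneg[OF that] by simp
    moreover have "(nrm A x)\<^sup>2 \<le> nrm A (star A x) * nrm A x"
      using that nrm_mult[of "star A x" x] by (simp add: nrm_star_mult star_closed)
    ultimately show ?thesis by (simp add: power2_eq_square)
  qed (simp add: N_nonneg that star_closed)
  show ?thesis
    using *[OF assms] *[OF star_closed[OF assms]] by (simp add: star_star assms)
qed

lemma mult_diff_left:
  "\<lbrakk>x \<in> carrier A; y \<in> carrier A; z \<in> carrier A\<rbrakk> \<Longrightarrow> x \<otimes> (y \<ominus> z) = x \<otimes> y \<ominus> x \<otimes> z"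
  by (simp add: diff_def distrib_left mult_scale_right vs_closed)

lemma mult_diff_right:
  "\<lbrakk>x \<in> carrier A; y \<in> carrier A; z \<in> carrier A\<rbrakk> \<Longrightarrow> (y \<ominus> z) \<otimes> x = y \<otimes> x \<ominus> z \<otimes> x"
  by (simp add: diff_def distrib_right mult_scale_left vs_closed)

lemma star_diff:
  "\<lbrakk>x \<in> carrier A; y \<in> carrier A\<rbrakk> \<Longrightarrow> star A (x \<ominus> y) = star A x \<ominus> star A y"
  by (simp add: diff_def star_add star_scale vs_closed)

lemma converges_star:
  assumes "converges s l"
  shows "converges (\<lambda>n. star A (s n)) (star A l)"
proof (rule convergesI)
  show "nrm A (star A (s n) \<ominus> star A l) \<le> nrm A (s n \<ominus> l)" for n
    using convergesD(1,2)[OF assms] by (simp flip: star_diff add: nrm_star diff_closed)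
  show "(\<lambda>n. nrm A (s n \<ominus> l)) \<longlonglongrightarrow> 0" by (rule convergesD(3)[OF assms])
qed (use assms in \<open>auto dest: convergesD intro: star_closed\<close>)

lemma converges_mult:
  assumes "converges s l" "converges s' l'"
  shows "converges (\<lambda>n. s n \<otimes> s' n) (l \<otimes> l')"
proof (rule convergesI)
  fix n
  have c: "s n \<in> carrier A" "s' n \<in> carrier A" "l \<in> carrier A" "l' \<in> carrier A"
    using assms convergesD by auto
  have "nrm A (s n \<otimes> s' n \<ominus> l \<otimes> l')
      \<le> nrm A (s n \<otimes> s' n \<ominus> s n \<otimes> l') + nrm A (s n \<otimes> l' \<ominus> l \<otimes> l')"
    using c by (intro N_diff_trans mult_closed)
  also have "\<dots> = nrm A (s n \<otimes> (s' n \<ominus> l')) + nrm A ((s n \<ominus> l) \<otimes> l')"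
    using c by (simp add: mult_diff_left mult_diff_right)
  also have "\<dots> \<le> nrm A (s n) * nrm A (s' n \<ominus> l') + nrm A (s n \<ominus> l) * nrm A l'"
    using c by (intro add_mono nrm_mult diff_closed)
  finally show "nrm A (s n \<otimes> s' n \<ominus> l \<otimes> l')
      \<le> nrm A (s n) * nrm A (s' n \<ominus> l') + nrm A (s n \<ominus> l) * nrm A l'" .
next
  show "(\<lambda>n. nrm A (s n) * nrm A (s' n \<ominus> l') + nrm A (s n \<ominus> l) * nrm A l') \<longlonglongrightarrow> 0"
    using tendsto_add[OF tendsto_mult[OF converges_N[OF assms(1)] convergesD(3)[OF assms(2)]]
      tendsto_mult[OF convergesD(3)[OF assms(1)] tendsto_const[of "nrm A l'"]]] by simp
qed (use assms in \<open>auto dest: convergesD intro: mult_closed\<close>)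

text \<open>Sequences replace the \<epsilon> of the definition because the closure of a graph needs
  both coordinates to converge along the same indices.\<close>

lemma closed_span_iff_converges:
  assumes "S \<subseteq> carrier A"
  shows "x \<in> closed_span A S \<longleftrightarrow> (\<exists>s. (\<forall>n. s n \<in> linear_span A S) \<and> converges s x)"
proof
  assume x: "x \<in> closed_span A S"
  then have "\<exists>y\<in>linear_span A S. nrm A (x \<ominus> y) < inverse (real (Suc n))" for n
    unfolding closed_span_def by (simp del: of_nat_Suc)
  then obtain s where s: "\<And>n. s n \<in> linear_span A S" "\<And>n. nrm A (x \<ominus> s n) < inverse (real (Suc n))"
    by metis
  have "converges s x"
  proof (rule convergesI)
    show "s n \<in> carrier A" for n using linear_span_closed[OF s(1) assms] .
    show "nrm A (s n \<ominus> x) \<le> inverse (real (Suc n))" for n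
      using s[of n] x assms linear_span_closed[OF s(1)[of n] assms] N_diff_commute[of x "s n"]
      unfolding closed_span_def by auto
  qed (use x LIMSEQ_inverse_real_of_nat in \<open>auto simp: closed_span_def\<close>)
  then show "\<exists>s. (\<forall>n. s n \<in> linear_span A S) \<and> converges s x" using s by blast
next
  assume "\<exists>s. (\<forall>n. s n \<in> linear_span A S) \<and> converges s x"
  then obtain s where s: "\<And>n. s n \<in> linear_span A S" "converges s x" by blast
  have "\<exists>y\<in>linear_span A S. nrm A (x \<ominus> y) < \<epsilon>" if "\<epsilon> > 0" for \<epsilon>
  proof -
    have "\<exists>n. nrm A (s n \<ominus> x) < \<epsilon>"
      using order_tendstoD(2)[OF convergesD(3)[OF s(2)] that]
      by (meson eventually_happens sequentially_bot)
    then show ?thesis using s convergesD(1,2)[OF s(2)] N_diff_commute by metis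
  qed
  then show "x \<in> closed_span A S" using convergesD(2)[OF s(2)] by (simp add: closed_span_def)
qed

end

subsection \<open>Extending contractive correspondences of operators\<close>

text \<open>\<open>G\<close> stands for a map that is known only through expressions for its
  arguments. That it is single-valued is not assumed: it follows from linearity and
  \<open>G_contractive\<close>, since a pair (0, b) has \<open>nrm B b\<close> \<le> 0.\<close>

locale contractive_graph = A: cstar_algebra A + B: cstar_algebra B
  for A :: "('a, 'm) calg_scheme" and B :: "('b, 'n) calg_scheme" +
  fixes G :: "('a \<times> 'b) set"
  assumes G_closed: "G \<subseteq> carrier A \<times> carrier B"
    and G_add: "\<lbrakk>(a, b) \<in> G; (a', b') \<in> G\<rbrakk> \<Longrightarrow> (a \<oplus>\<^bsub>A\<^esub> a', b \<oplus>\<^bsub>B\<^esub> b') \<in> G"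
    and G_scale: "(a, b) \<in> G \<Longrightarrow> (c \<odot>\<^bsub>A\<^esub> a, c \<odot>\<^bsub>B\<^esub> b) \<in> G"
    and G_mult: "\<lbrakk>(a, b) \<in> G; (a', b') \<in> G\<rbrakk> \<Longrightarrow> (a \<otimes>\<^bsub>A\<^esub> a', b \<otimes>\<^bsub>B\<^esub> b') \<in> G"
    and G_star: "(a, b) \<in> G \<Longrightarrow> (star A a, star B b) \<in> G"
    and G_contractive: "(a, b) \<in> G \<Longrightarrow> nrm B b \<le> nrm A a"
begin

definition gclosure :: "('a \<times> 'b) set"
  where "gclosure = {(a, b). \<exists>s t. (\<forall>n. (s n, t n) \<in> G) \<and> A.converges s a \<and> B.converges t b}"

lemma gclosureE:
  assumes "(a, b) \<in> gclosure"
  obtains s t where "\<And>n. (s n, t n) \<in> G" "A.converges s a" "B.converges t b"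
  using assms by (auto simp: gclosure_def)

lemma gclosureI:
  "\<lbrakk>\<And>n. (s n, t n) \<in> G; A.converges s a; B.converges t b\<rbrakk> \<Longrightarrow> (a, b) \<in> gclosure"
  by (auto simp: gclosure_def)

lemma gclosure_closed: "(a, b) \<in> gclosure \<Longrightarrow> a \<in> carrier A \<and> b \<in> carrier B"
  by (auto simp: gclosure_def A.converges_def B.converges_def)

lemma G_subset_gclosure: "(a, b) \<in> G \<Longrightarrow> (a, b) \<in> gclosure"
  using G_closed by (intro gclosureI[of "\<lambda>_. a" "\<lambda>_. b"] A.converges_const B.converges_const) auto

lemma gclosure_add:
  "\<lbrakk>(a, b) \<in> gclosure; (a', b') \<in> gclosure\<rbrakk> \<Longrightarrow> (a \<oplus>\<^bsub>A\<^esub> a', b \<oplus>\<^bsub>B\<^esub> b') \<in> gclosure"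
  by (elim gclosureE) (rule gclosureI[OF G_add A.converges_add B.converges_add]; assumption)

lemma gclosure_scale: "(a, b) \<in> gclosure \<Longrightarrow> (c \<odot>\<^bsub>A\<^esub> a, c \<odot>\<^bsub>B\<^esub> b) \<in> gclosure"
  by (elim gclosureE) (rule gclosureI[OF G_scale A.converges_scale B.converges_scale]; assumption)

lemma gclosure_mult:
  "\<lbrakk>(a, b) \<in> gclosure; (a', b') \<in> gclosure\<rbrakk> \<Longrightarrow> (a \<otimes>\<^bsub>A\<^esub> a', b \<otimes>\<^bsub>B\<^esub> b') \<in> gclosure"
  by (elim gclosureE) (rule gclosureI[OF G_mult A.converges_mult B.converges_mult]; assumption)

lemma gclosure_star: "(a, b) \<in> gclosure \<Longrightarrow> (star A a, star B b) \<in> gclosure"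
  by (elim gclosureE) (rule gclosureI[OF G_star A.converges_star B.converges_star]; assumption)

lemma gclosure_contractive: "(a, b) \<in> gclosure \<Longrightarrow> nrm B b \<le> nrm A a"
  by (elim gclosureE)
     (auto intro: LIMSEQ_le[OF B.converges_N A.converges_N] simp: G_contractive)

lemma gclosure_unique:
  assumes "(a, b) \<in> gclosure" "(a, b') \<in> gclosure"
  shows "b = b'"
proof -
  have c: "a \<in> carrier A" "b \<in> carrier B" "b' \<in> carrier B" using assms gclosure_closed by auto
  have "(a \<ominus>\<^bsub>A\<^esub> a, b \<ominus>\<^bsub>B\<^esub> b') \<in> gclosure"
    unfolding diff_def using assms by (intro gclosure_add gclosure_scale)
  then have "nrm B (b \<ominus>\<^bsub>B\<^esub> b') \<le> 0"
    using gclosure_contractive[of "a \<ominus>\<^bsub>A\<^esub> a"] c by (simp add: A.add_inverse A.N_zero)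
  then have "nrm B (b \<ominus>\<^bsub>B\<^esub> b') = 0"
    using B.N_nonneg[of "b \<ominus>\<^bsub>B\<^esub> b'"] c by (simp add: B.diff_closed)
  then show ?thesis using c by (simp add: B.nrm_eq_zero B.diff_closed B.diff_eq_zero_iff)
qed

text \<open>Any choice of partners \<open>t n\<close> of the \<open>s n\<close> is Cauchy, because
  differences of pairs lie in \<open>G\<close> and \<open>G\<close> is contractive. Completeness of
  \<open>B\<close> then supplies the value.\<close>

lemma gclosure_total:
  assumes "\<And>n. s n \<in> Domain G" "A.converges s a"
  obtains b where "(a, b) \<in> gclosure"
proof -
  have "\<forall>n. \<exists>b. (s n, b) \<in> G" using assms(1) by blast
  then obtain t where t: "\<And>n. (s n, t n) \<in> G" by metis
  have tB: "t n \<in> carrier B" for n using t G_closed by blast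
  have "\<exists>n0. \<forall>m\<ge>n0. \<forall>n\<ge>n0. nrm B (t m \<ominus>\<^bsub>B\<^esub> t n) < \<epsilon>" if "\<epsilon> > 0" for \<epsilon>
  proof -
    have "(s m \<ominus>\<^bsub>A\<^esub> s n, t m \<ominus>\<^bsub>B\<^esub> t n) \<in> G" for m n
      unfolding diff_def by (intro G_add G_scale t)
    then have "nrm B (t m \<ominus>\<^bsub>B\<^esub> t n) \<le> nrm A (s m \<ominus>\<^bsub>A\<^esub> s n)" for m n
      by (rule G_contractive)
    then show ?thesis using A.converges_Cauchy[OF assms(2) that] by (meson order_le_less_trans)
  qed
  then obtain b where "B.converges t b"
    using B.complete_converges[of t, OF B.complete tB] by blast
  then show thesis using that gclosureI[of s t, OF t assms(2)] by blast
qed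

text \<open>For a value b that is known in advance, where no sequence is at hand. One pair must
  approximate both coordinates at once; the tolerances 1/(n+1) turn such pairs into
  sequences.\<close>

lemma gclosureI_approx:
  assumes "\<And>\<epsilon>. 0 < \<epsilon> \<Longrightarrow> \<exists>(t, r)\<in>G. nrm A (a \<ominus>\<^bsub>A\<^esub> t) < \<epsilon> \<and> nrm B (b \<ominus>\<^bsub>B\<^esub> r) < \<epsilon>"
    and "a \<in> carrier A" "b \<in> carrier B"
  shows "(a, b) \<in> gclosure"
proof -
  have "\<exists>t r. (t, r) \<in> G \<and> nrm A (a \<ominus>\<^bsub>A\<^esub> t) < inverse (real (Suc n))
      \<and> nrm B (b \<ominus>\<^bsub>B\<^esub> r) < inverse (real (Suc n))" for n
    using assms(1)[of "inverse (real (Suc n))"] by (auto simp del: of_nat_Suc)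
  then obtain s t where st: "\<And>n. (s n, t n) \<in> G"
    "\<And>n. nrm A (a \<ominus>\<^bsub>A\<^esub> s n) < inverse (real (Suc n))"
    "\<And>n. nrm B (b \<ominus>\<^bsub>B\<^esub> t n) < inverse (real (Suc n))"
    by metis
  have c: "s n \<in> carrier A" "t n \<in> carrier B" for n using st(1) G_closed by blast+
  show ?thesis
  proof (rule gclosureI[OF st(1)])
    show "A.converges s a"
      using st(2) c assms(2) A.N_diff_commute[OF c(1) assms(2)]
      by (intro A.convergesI[OF _ _ _ LIMSEQ_inverse_real_of_nat]) (auto intro: less_imp_le)
    show "B.converges t b"
      using st(3) c assms(3) B.N_diff_commute[OF c(2) assms(3)]
      by (intro B.convergesI[OF _ _ _ LIMSEQ_inverse_real_of_nat]) (auto intro: less_imp_le)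
  qed
qed

end

subsection \<open>Adjointable operators\<close>

text \<open>The Cauchy--Schwarz inequality holds in every Hilbert module; it is assumed because its
  general proof needs the order structure of \<open>C*\<close>-algebras, while for branched functions it can be
  read off fibrewise.\<close>

locale hilbert_module_CS = hilbert_module E
  for E :: "('e, 'b, 'm) hmod_scheme" (structure) +
  assumes ip_bound: "\<lbrakk>e \<in> carrier E; f \<in> carrier E\<rbrakk>
      \<Longrightarrow> nrm (coeff E) (ip E e f) \<le> hnorm E e * hnorm E f"
begin

lemma ip_add_left:
  "\<lbrakk>e \<in> carrier E; f \<in> carrier E; g \<in> carrier E\<rbrakk>
    \<Longrightarrow> ip E (e \<oplus> f) g = ip E e g \<oplus>\<^bsub>coeff E\<^esub> ip E f g"
  by (metis B.star_add add_closed ip_add ip_closed ip_star)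

lemma ip_scale_left:
  "\<lbrakk>e \<in> carrier E; f \<in> carrier E\<rbrakk> \<Longrightarrow> ip E (z \<odot> e) f = cnj z \<odot>\<^bsub>coeff E\<^esub> ip E e f"
  by (metis B.star_scale scale_closed ip_scale ip_closed ip_star)

lemma ip_ract_left:
  "\<lbrakk>e \<in> carrier E; f \<in> carrier E; b \<in> carrier (coeff E)\<rbrakk>
    \<Longrightarrow> ip E (ract E e b) f = star (coeff E) b \<otimes>\<^bsub>coeff E\<^esub> ip E e f"
  by (metis B.star_mult ract_closed ip_ract ip_closed ip_star)

lemma ip_zero_right: "e \<in> carrier E \<Longrightarrow> ip E e \<zero> = \<zero>\<^bsub>coeff E\<^esub>"
  using ip_scale[of e \<zero> 0] by (simp add: zero_closed scale_zero_right ip_closed B.scale_zero_left)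

lemma hnorm_squared: "e \<in> carrier E \<Longrightarrow> (hnorm E e)\<^sup>2 = nrm (coeff E) (ip E e e)"
  by (simp add: hnorm_def B.N_nonneg ip_closed)

lemma hnorm_nonneg: "e \<in> carrier E \<Longrightarrow> 0 \<le> hnorm E e"
  by (simp add: hnorm_def B.N_nonneg ip_closed)

lemma hnorm_triangle:
  assumes "e \<in> carrier E" "f \<in> carrier E"
  shows "hnorm E (e \<oplus> f) \<le> hnorm E e + hnorm E f"
proof (rule power2_le_imp_le)
  have "(hnorm E (e \<oplus> f))\<^sup>2 = nrm (coeff E)
      ((ip E e e \<oplus>\<^bsub>coeff E\<^esub> ip E e f) \<oplus>\<^bsub>coeff E\<^esub> (ip E f e \<oplus>\<^bsub>coeff E\<^esub> ip E f f))"
    using assms by (simp add: hnorm_squared add_closed ip_add ip_add_left)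
      (simp add: ip_closed B.add_assoc B.add_left_commute B.add_closed)
  also have "\<dots> \<le> (nrm (coeff E) (ip E e e) + nrm (coeff E) (ip E e f))
      + (nrm (coeff E) (ip E f e) + nrm (coeff E) (ip E f f))"
    using assms by (intro B.N_triangle[THEN order_trans] add_mono B.N_triangle B.add_closed ip_closed)
  also have "\<dots> \<le> ((hnorm E e)\<^sup>2 + hnorm E e * hnorm E f) + (hnorm E f * hnorm E e + (hnorm E f)\<^sup>2)"
    using assms by (intro add_mono ip_bound) (simp_all add: hnorm_squared)
  also have "\<dots> = (hnorm E e + hnorm E f)\<^sup>2" by (simp add: power2_eq_square algebra_simps)
  finally show "(hnorm E (e \<oplus> f))\<^sup>2 \<le> (hnorm E e + hnorm E f)\<^sup>2" .
qed (simp add: assms hnorm_nonneg)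

end

sublocale hilbert_module_CS \<subseteq> normed_cvs E "hnorm E"
proof
  fix x y and c assume x: "x \<in> carrier E"
  show "hnorm E x = 0 \<longleftrightarrow> x = \<zero>"
    using x ip_definite[OF x] ip_zero_right[of \<zero>]
    by (auto simp: hnorm_def B.nrm_eq_zero ip_closed zero_closed B.N_zero)
  have "(hnorm E (c \<odot> x))\<^sup>2 = (cmod c * hnorm E x)\<^sup>2"
    using x by (simp add: hnorm_squared power_mult_distrib scale_closed ip_scale ip_scale_left
        ip_closed B.nrm_scale B.scale_closed) (simp add: power2_eq_square)
  then show "hnorm E (c \<odot> x) = cmod c * hnorm E x"
    using x by (simp add: hnorm_nonneg scale_closed power2_eq_iff_nonneg)
qed (rule hnorm_triangle)

context hilbert_module_CS
begin

text \<open>Definiteness applied to e - f. This is the device by which identities between operators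
  are read off their adjoints.\<close>

lemma ip_separates:
  assumes "e \<in> carrier E" "f \<in> carrier E" "\<And>g. g \<in> carrier E \<Longrightarrow> ip E e g = ip E f g"
  shows "e = f"
proof -
  have "ip E (e \<ominus> f) (e \<ominus> f) = \<zero>\<^bsub>coeff E\<^esub>"
    using assms by (simp add: diff_def ip_add_left ip_scale_left vs_closed)
      (metis B.add_neg add_closed ip_closed scale_closed)
  then show ?thesis using assms ip_definite[of "e \<ominus> f"] by (simp add: diff_closed diff_eq_zero_iff)
qed

text \<open>The inner product of e b with itself is \<open>star b\<close> times the inner product of
  e with itself times b, and \<open>star\<close> preserves the norm.\<close>

lemma hnorm_ract:
  assumes "e \<in> carrier E" "b \<in> carrier (coeff E)"
  shows "hnorm E (ract E e b) \<le> hnorm E e * nrm (coeff E) b"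
proof (rule power2_le_imp_le)
  have "(hnorm E (ract E e b))\<^sup>2
      = nrm (coeff E) (star (coeff E) b \<otimes>\<^bsub>coeff E\<^esub> (ip E e e \<otimes>\<^bsub>coeff E\<^esub> b))"
    using assms by (simp add: hnorm_squared ract_closed ip_ract ip_ract_left
        B.mult_assoc B.star_closed ip_closed)
  also have "\<dots> \<le> nrm (coeff E) b * (nrm (coeff E) (ip E e e) * nrm (coeff E) b)"
    using assms by (intro B.nrm_mult[THEN order_trans] mult_mono B.nrm_mult)
      (simp_all add: B.star_closed ip_closed B.nrm_star B.N_nonneg B.mult_closed)
  also have "\<dots> = (hnorm E e * nrm (coeff E) b)\<^sup>2"
    using assms by (simp add: power_mult_distrib hnorm_squared) (simp add: power2_eq_square)
  finally show "(hnorm E (ract E e b))\<^sup>2 \<le> (hnorm E e * nrm (coeff E) b)\<^sup>2" .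
qed (simp add: assms hnorm_nonneg B.N_nonneg)

lemma adjoint_pairI:
  assumes "\<And>e. e \<in> carrier E \<Longrightarrow> T e \<in> carrier E" "\<And>e. e \<in> carrier E \<Longrightarrow> T' e \<in> carrier E"
    and "T \<in> extensional (carrier E)" "T' \<in> extensional (carrier E)"
    and "\<And>e f. \<lbrakk>e \<in> carrier E; f \<in> carrier E\<rbrakk> \<Longrightarrow> ip E (T e) f = ip E e (T' f)"
  shows "adjoint_pair E T T'"
  using assms by (auto simp: adjoint_pair_def PiE_iff)

lemma adjoint_pairD:
  assumes "adjoint_pair E T T'"
  shows "e \<in> carrier E \<Longrightarrow> T e \<in> carrier E" "e \<in> carrier E \<Longrightarrow> T' e \<in> carrier E"
    "T \<in> extensional (carrier E)" "T' \<in> extensional (carrier E)"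
    "\<lbrakk>e \<in> carrier E; f \<in> carrier E\<rbrakk> \<Longrightarrow> ip E (T e) f = ip E e (T' f)"
  using assms by (auto simp: adjoint_pair_def PiE_iff)

lemma adjoint_pair_sym:
  assumes "adjoint_pair E T T'"
  shows "adjoint_pair E T' T"
proof (rule adjoint_pairI)
  note D = adjoint_pairD[OF assms]
  fix e f assume ef: "e \<in> carrier E" "f \<in> carrier E"
  have "ip E (T' e) f = star (coeff E) (ip E f (T' e))" using ip_star[OF ef(2) D(2)[OF ef(1)]] by simp
  also have "\<dots> = star (coeff E) (ip E (T f) e)" using D(5) ef by simp
  also have "\<dots> = ip E e (T f)" by (rule ip_star[OF D(1)[OF ef(2)] ef(1)])
  finally show "ip E (T' e) f = ip E e (T f)" .
qed (use adjoint_pairD[OF assms] in auto)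

lemma adjoint_pair_unique:
  assumes "adjoint_pair E T T'" "adjoint_pair E T T''"
  shows "T' = T''"
proof (rule extensionalityI[OF assms[THEN adjoint_pairD(4)]])
  fix e assume "e \<in> carrier E"
  then show "T' e = T'' e"
    using assms[THEN adjoint_pair_sym] adjoint_pairD(1,5)
    by (intro ip_separates) (blast, blast, metis)
qed

abbreviation (input) "L \<equiv> adjointables E"

lemma adjointables_carrier:
  "T \<in> carrier L \<longleftrightarrow> (\<exists>T'. adjoint_pair E T T') \<and>
     (\<exists>c. \<forall>e\<in>carrier E. hnorm E (T e) \<le> c * hnorm E e)"
  by (simp add: adjointables_def)

lemma star_eqI: "adjoint_pair E T T' \<Longrightarrow> star L T = T'"
  by (auto simp: adjointables_def intro: adjoint_pair_unique)

lemma adjoint_pair_star: "T \<in> carrier L \<Longrightarrow> adjoint_pair E T (star L T)"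
  by (metis adjointables_carrier star_eqI)

lemma adjointablesI:
  "\<lbrakk>adjoint_pair E T T'; \<And>e. e \<in> carrier E \<Longrightarrow> hnorm E (T e) \<le> c * hnorm E e\<rbrakk> \<Longrightarrow> T \<in> carrier L"
  by (auto simp: adjointables_carrier)

lemma op_closed: "\<lbrakk>T \<in> carrier L; e \<in> carrier E\<rbrakk> \<Longrightarrow> T e \<in> carrier E"
  by (meson adjoint_pairD(1) adjoint_pair_star)

lemma op_extensional: "T \<in> carrier L \<Longrightarrow> T \<in> extensional (carrier E)"
  by (meson adjoint_pairD(3) adjoint_pair_star)

lemma op_eqI:
  "\<lbrakk>T \<in> carrier L; T' \<in> carrier L; \<And>e. e \<in> carrier E \<Longrightarrow> T e = T' e\<rbrakk> \<Longrightarrow> T = T'"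
  by (rule extensionalityI[OF op_extensional op_extensional])

lemma ip_op:
  "\<lbrakk>T \<in> carrier L; e \<in> carrier E; f \<in> carrier E\<rbrakk> \<Longrightarrow> ip E (T e) f = ip E e (star L T f)"
  by (meson adjoint_pairD(5) adjoint_pair_star)

lemma star_op_closed: "\<lbrakk>T \<in> carrier L; e \<in> carrier E\<rbrakk> \<Longrightarrow> star L T e \<in> carrier E"
  by (meson adjoint_pairD(2) adjoint_pair_star)

text \<open>Linearity and the module property in the next lemmas are consequences of having an
  adjoint: move T to the other side of the inner product and test against every vector.\<close>

lemma op_add:
  assumes "T \<in> carrier L" "e \<in> carrier E" "f \<in> carrier E"
  shows "T (e \<oplus> f) = T e \<oplus> T f"
  using assms by (intro ip_separates)
    (simp_all add: op_closed add_closed ip_op star_op_closed ip_add_left)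

lemma op_scale:
  assumes "T \<in> carrier L" "e \<in> carrier E"
  shows "T (c \<odot> e) = c \<odot> T e"
  using assms by (intro ip_separates)
    (simp_all add: op_closed scale_closed ip_op star_op_closed ip_scale_left)

lemma op_ract:
  assumes "T \<in> carrier L" "e \<in> carrier E" "b \<in> carrier (coeff E)"
  shows "T (ract E e b) = ract E (T e) b"
  using assms by (intro ip_separates)
    (simp_all add: op_closed ract_closed ip_op star_op_closed ip_ract_left)

lemma op_zero: "T \<in> carrier L \<Longrightarrow> T \<zero> = \<zero>"
  using op_scale[of T \<zero> 0] by (simp add: op_closed scale_zero_left zero_closed)

lemma nrm_adjointables:
  "nrm L T = (SUP e\<in>{e\<in>carrier E. hnorm E e \<le> 1}. hnorm E (T e))"
  by (simp add: adjointables_def)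

lemma op_le_nrm:
  assumes "T \<in> carrier L" "e \<in> carrier E" "hnorm E e \<le> 1"
  shows "hnorm E (T e) \<le> nrm L T"
proof -
  obtain c where c: "\<And>e. e \<in> carrier E \<Longrightarrow> hnorm E (T e) \<le> c * hnorm E e"
    using assms(1) by (auto simp: adjointables_carrier)
  \<comment> \<open>The bounding constant c may be negative, hence the absolute value.\<close>
  have "hnorm E (T e) \<le> \<bar>c\<bar>" if "e \<in> carrier E" "hnorm E e \<le> 1" for e
  proof -
    have "c * hnorm E e \<le> \<bar>c\<bar> * 1"
      using that by (intro mult_mono) (auto simp: hnorm_nonneg)
    then show ?thesis using c[OF that(1)] by simp
  qed
  then show ?thesis
    unfolding nrm_adjointables using assms by (intro cSUP_upper) (auto intro!: bdd_aboveI2)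
qed

lemma nrm_op_nonneg: "T \<in> carrier L \<Longrightarrow> 0 \<le> nrm L T"
  using op_le_nrm[of T \<zero>] by (simp add: op_zero N_zero zero_closed)

lemma op_bound:
  assumes "T \<in> carrier L" "e \<in> carrier E"
  shows "hnorm E (T e) \<le> nrm L T * hnorm E e"
proof (cases "hnorm E e = 0")
  case True
  then show ?thesis using assms by (simp add: N_eq_zero op_zero N_zero)
next
  case False
  then have p: "0 < hnorm E e" using assms hnorm_nonneg[of e] by simp
  let ?c = "complex_of_real (inverse (hnorm E e))"
  have "hnorm E (T (?c \<odot> e)) \<le> nrm L T"
    using assms p by (intro op_le_nrm) (simp_all add: scale_closed N_scale norm_inverse)
  then have "inverse (hnorm E e) * hnorm E (T e) \<le> nrm L T"
    using assms p by (simp add: op_scale N_scale op_closed norm_inverse)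
  then show ?thesis using p by (simp add: field_simps)
qed

lemma nrm_op_leI:
  assumes "\<And>e. e \<in> carrier E \<Longrightarrow> hnorm E (T e) \<le> c * hnorm E e" "0 \<le> c"
  shows "nrm L T \<le> c"
  unfolding nrm_adjointables
proof (rule cSUP_least)
  show "{e \<in> carrier E. hnorm E e \<le> 1} \<noteq> {}"
    using zero_closed N_zero by (metis (mono_tags, lifting) empty_iff mem_Collect_eq zero_le_one)
  fix e assume "e \<in> {e \<in> carrier E. hnorm E e \<le> 1}"
  then show "hnorm E (T e) \<le> c"
    using assms(1)[of e] mult_left_mono[of "hnorm E e" 1 c] assms(2) by simp
qed

text \<open>With g = \<open>star L T f\<close>, the square of the norm of g is the norm of the inner
  product of T g and f, at most |T| |g| |f|; divide by |g|. This bound is what puts the adjoint back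
  into the algebra.\<close>

lemma star_op_bound:
  assumes "T \<in> carrier L" "f \<in> carrier E"
  shows "hnorm E (star L T f) \<le> nrm L T * hnorm E f"
proof (cases "hnorm E (star L T f) = 0")
  case True
  then show ?thesis using assms by (simp add: nrm_op_nonneg hnorm_nonneg)
next
  case False
  let ?g = "star L T f"
  have g: "?g \<in> carrier E" using assms by (rule star_op_closed)
  have "(hnorm E ?g)\<^sup>2 = nrm (coeff E) (ip E (T ?g) f)"
    using assms g by (simp add: hnorm_squared ip_op)
  also have "\<dots> \<le> hnorm E (T ?g) * hnorm E f"
    using op_closed[OF assms(1) g] assms(2) by (rule ip_bound)
  also have "\<dots> \<le> (nrm L T * hnorm E ?g) * hnorm E f"
    using op_bound[OF assms(1) g] hnorm_nonneg[OF assms(2)] by (rule mult_right_mono)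
  finally have "hnorm E ?g * hnorm E ?g \<le> hnorm E ?g * (nrm L T * hnorm E f)"
    by (simp add: power2_eq_square ac_simps)
  moreover have "0 < hnorm E ?g" using False hnorm_nonneg[OF g] by simp
  ultimately show ?thesis by simp
qed

lemma star_op:
  assumes "T \<in> carrier L"
  shows "star L T \<in> carrier L" "star L (star L T) = T"
  using adjointablesI[OF adjoint_pair_sym[OF adjoint_pair_star[OF assms]] star_op_bound[OF assms]]
    star_eqI[OF adjoint_pair_sym[OF adjoint_pair_star[OF assms]]] by auto

lemma adjointables_simps:
  "zero L = (\<lambda>e\<in>carrier E. \<zero>)"
  "S \<oplus>\<^bsub>L\<^esub> T = (\<lambda>e\<in>carrier E. S e \<oplus> T e)"
  "c \<odot>\<^bsub>L\<^esub> T = (\<lambda>e\<in>carrier E. c \<odot> T e)"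
  "S \<otimes>\<^bsub>L\<^esub> T = (\<lambda>e\<in>carrier E. S (T e))"
  by (simp_all add: adjointables_def compose_def)

lemma ip_zero_left: "e \<in> carrier E \<Longrightarrow> ip E \<zero> e = \<zero>\<^bsub>coeff E\<^esub>"
  using ip_scale_left[of \<zero> e 0] by (simp add: zero_closed scale_zero_right ip_closed B.scale_zero_left)

lemma op_zero_closed: "zero L \<in> carrier L"
proof (rule adjointablesI)
  show "adjoint_pair E (zero L) (zero L)"
    by (rule adjoint_pairI) (simp_all add: adjointables_simps zero_closed ip_zero_left ip_zero_right)
  show "hnorm E (zero L e) \<le> 0 * hnorm E e" if "e \<in> carrier E" for e
    using that by (simp add: adjointables_simps N_zero)
qed

lemma op_add_pair:
  assumes "S \<in> carrier L" "T \<in> carrier L"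
  shows "adjoint_pair E (S \<oplus>\<^bsub>L\<^esub> T) (star L S \<oplus>\<^bsub>L\<^esub> star L T)"
  using assms by (intro adjoint_pairI)
    (simp_all add: adjointables_simps op_closed star_op_closed add_closed ip_add ip_add_left ip_op)

lemma op_scale_pair:
  assumes "T \<in> carrier L"
  shows "adjoint_pair E (c \<odot>\<^bsub>L\<^esub> T) (cnj c \<odot>\<^bsub>L\<^esub> star L T)"
  using assms by (intro adjoint_pairI)
    (simp_all add: adjointables_simps op_closed star_op_closed scale_closed ip_scale ip_scale_left ip_op)

lemma op_mult_pair:
  assumes "S \<in> carrier L" "T \<in> carrier L"
  shows "adjoint_pair E (S \<otimes>\<^bsub>L\<^esub> T) (star L T \<otimes>\<^bsub>L\<^esub> star L S)"
  using assms by (intro adjoint_pairI)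
    (simp_all add: adjointables_simps op_closed star_op_closed ip_op)

lemma op_add_bound:
  assumes "S \<in> carrier L" "T \<in> carrier L" "e \<in> carrier E"
  shows "hnorm E ((S \<oplus>\<^bsub>L\<^esub> T) e) \<le> (nrm L S + nrm L T) * hnorm E e"
  using assms hnorm_triangle[of "S e" "T e"] op_bound[of S e] op_bound[of T e]
  by (simp add: adjointables_simps op_closed algebra_simps)

lemma op_scale_bound:
  assumes "T \<in> carrier L" "e \<in> carrier E"
  shows "hnorm E ((c \<odot>\<^bsub>L\<^esub> T) e) \<le> (cmod c * nrm L T) * hnorm E e"
  using assms op_bound[of T e] by (simp add: adjointables_simps op_closed N_scale mult.assoc mult_left_mono)

lemma op_mult_bound:
  assumes "S \<in> carrier L" "T \<in> carrier L" "e \<in> carrier E"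
  shows "hnorm E ((S \<otimes>\<^bsub>L\<^esub> T) e) \<le> (nrm L S * nrm L T) * hnorm E e"
proof -
  have "hnorm E (S (T e)) \<le> nrm L S * hnorm E (T e)"
    by (rule op_bound[OF assms(1) op_closed[OF assms(2,3)]])
  also have "\<dots> \<le> nrm L S * (nrm L T * hnorm E e)"
    by (rule mult_left_mono[OF op_bound[OF assms(2,3)] nrm_op_nonneg[OF assms(1)]])
  finally show ?thesis using assms by (simp add: adjointables_simps mult.assoc)
qed

lemma op_add_closed: "\<lbrakk>S \<in> carrier L; T \<in> carrier L\<rbrakk> \<Longrightarrow> S \<oplus>\<^bsub>L\<^esub> T \<in> carrier L"
  by (rule adjointablesI[OF op_add_pair op_add_bound])

lemma op_scale_closed: "T \<in> carrier L \<Longrightarrow> c \<odot>\<^bsub>L\<^esub> T \<in> carrier L"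
  by (rule adjointablesI[OF op_scale_pair op_scale_bound])

lemma op_mult_closed: "\<lbrakk>S \<in> carrier L; T \<in> carrier L\<rbrakk> \<Longrightarrow> S \<otimes>\<^bsub>L\<^esub> T \<in> carrier L"
  by (rule adjointablesI[OF op_mult_pair op_mult_bound])

lemma nrm_op_scale_le: "T \<in> carrier L \<Longrightarrow> nrm L (c \<odot>\<^bsub>L\<^esub> T) \<le> cmod c * nrm L T"
  by (rule nrm_op_leI) (auto intro: op_scale_bound simp: nrm_op_nonneg)

lemma op_diff_apply:
  "\<lbrakk>S \<in> carrier L; T \<in> carrier L; e \<in> carrier E\<rbrakk> \<Longrightarrow> (S \<ominus>\<^bsub>L\<^esub> T) e = S e \<ominus> T e"
  by (simp add: diff_def adjointables_simps)

section \<open>The adjointable operators as a C*-algebra\<close>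

lemma op_vector_space: "complex_vector_space L"
proof
  show "zero L \<in> carrier L" by (rule op_zero_closed)
  fix x y z and c d :: complex
  show "x \<oplus>\<^bsub>L\<^esub> y \<in> carrier L" if "x \<in> carrier L" "y \<in> carrier L"
    using that by (rule op_add_closed)
  show "c \<odot>\<^bsub>L\<^esub> x \<in> carrier L" if "x \<in> carrier L"
    using that by (rule op_scale_closed)
  show "x \<oplus>\<^bsub>L\<^esub> y \<oplus>\<^bsub>L\<^esub> z = x \<oplus>\<^bsub>L\<^esub> (y \<oplus>\<^bsub>L\<^esub> z)"
    if "x \<in> carrier L" "y \<in> carrier L" "z \<in> carrier L"
    using that by (intro ext) (simp add: adjointables_simps op_closed add_assoc restrict_def)
  show "x \<oplus>\<^bsub>L\<^esub> y = y \<oplus>\<^bsub>L\<^esub> x" if "x \<in> carrier L" "y \<in> carrier L"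
    using that by (intro ext) (simp add: adjointables_simps op_closed add_commute restrict_def)
  show "x \<oplus>\<^bsub>L\<^esub> zero L = x" if "x \<in> carrier L"
    using that op_extensional[OF that]
    by (intro ext) (simp add: adjointables_simps op_closed add_zero restrict_def extensional_def)
  show "x \<ominus>\<^bsub>L\<^esub> x = zero L" if "x \<in> carrier L"
    using that by (intro ext) (simp add: diff_def adjointables_simps op_closed add_neg restrict_def)
  show "c \<odot>\<^bsub>L\<^esub> (x \<oplus>\<^bsub>L\<^esub> y) = c \<odot>\<^bsub>L\<^esub> x \<oplus>\<^bsub>L\<^esub> c \<odot>\<^bsub>L\<^esub> y" if "x \<in> carrier L" "y \<in> carrier L"
    using that by (intro ext) (simp add: adjointables_simps op_closed scale_add_right restrict_def)
  show "(c + d) \<odot>\<^bsub>L\<^esub> x = c \<odot>\<^bsub>L\<^esub> x \<oplus>\<^bsub>L\<^esub> d \<odot>\<^bsub>L\<^esub> x" if "x \<in> carrier L"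
    using that by (intro ext) (simp add: adjointables_simps op_closed scale_add_left restrict_def)
  show "c \<odot>\<^bsub>L\<^esub> d \<odot>\<^bsub>L\<^esub> x = (c * d) \<odot>\<^bsub>L\<^esub> x" if "x \<in> carrier L"
    using that by (intro ext) (simp add: adjointables_simps op_closed scale_scale restrict_def)
  show "1 \<odot>\<^bsub>L\<^esub> x = x" if "x \<in> carrier L"
    using that op_extensional[OF that]
    by (intro ext) (simp add: adjointables_simps op_closed scale_one restrict_def extensional_def)
qed

lemma op_diff_closed: "\<lbrakk>S \<in> carrier L; T \<in> carrier L\<rbrakk> \<Longrightarrow> S \<ominus>\<^bsub>L\<^esub> T \<in> carrier L"
  by (rule complex_vector_space.diff_closed[OF op_vector_space])

lemma star_op_diff:
  assumes "S \<in> carrier L" "T \<in> carrier L"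
  shows "star L (S \<ominus>\<^bsub>L\<^esub> T) = star L S \<ominus>\<^bsub>L\<^esub> star L T"
  unfolding diff_def using assms
  by (simp add: star_eqI[OF op_add_pair] star_eqI[OF op_scale_pair] op_scale_closed)

lemma nrm_star_op: "T \<in> carrier L \<Longrightarrow> nrm L (star L T) \<le> nrm L T"
  by (rule nrm_op_leI) (auto intro: star_op_bound nrm_op_nonneg)

lemma converges_pointwise:
  assumes T: "\<And>n. T n \<in> carrier L"
    and C: "\<And>\<epsilon>. 0 < \<epsilon> \<Longrightarrow> \<exists>n0. \<forall>m\<ge>n0. \<forall>n\<ge>n0. nrm L (T m \<ominus>\<^bsub>L\<^esub> T n) < \<epsilon>"
    and e: "e \<in> carrier E"
  shows "\<exists>l. converges (\<lambda>n. T n e) l"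
proof -
  have "\<exists>n0. \<forall>m\<ge>n0. \<forall>n\<ge>n0. hnorm E (T m e \<ominus> T n e) < \<epsilon>" if "0 < \<epsilon>" for \<epsilon>
  proof -
    \<comment> \<open>The summand 1 keeps the divisor positive when \<open>hnorm E e\<close> is
      0.\<close>
    have p: "0 < \<epsilon> / (hnorm E e + 1)" using that hnorm_nonneg[OF e] by simp
    obtain n0 where n0: "\<And>m n. m \<ge> n0 \<Longrightarrow> n \<ge> n0 \<Longrightarrow> nrm L (T m \<ominus>\<^bsub>L\<^esub> T n) < \<epsilon> / (hnorm E e + 1)"
      using C[OF p] by blast
    have "hnorm E (T m e \<ominus> T n e) < \<epsilon>" if mn: "m \<ge> n0" "n \<ge> n0" for m n
    proof -
      have "hnorm E (T m e \<ominus> T n e) \<le> nrm L (T m \<ominus>\<^bsub>L\<^esub> T n) * hnorm E e"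
        using op_bound[OF op_diff_closed[OF T T] e] by (simp add: op_diff_apply T e)
      also have "\<dots> \<le> nrm L (T m \<ominus>\<^bsub>L\<^esub> T n) * (hnorm E e + 1)"
        by (simp add: mult_left_mono nrm_op_nonneg op_diff_closed T)
      also have "\<dots> < \<epsilon>" using n0[OF mn] hnorm_nonneg[OF e] by (simp add: field_simps)
      finally show ?thesis .
    qed
    then show ?thesis by blast
  qed
  from complete_converges[OF hcomplete op_closed[OF T e] this] show ?thesis by blast
qed

lemma converges_ip_left:
  assumes "converges s l" "f \<in> carrier E"
  shows "B.converges (\<lambda>n. ip E (s n) f) (ip E l f)"
proof (rule B.convergesI)
  note c = convergesD(1,2)[OF assms(1)]
  have d: "ip E (s n) f \<ominus>\<^bsub>coeff E\<^esub> ip E l f = ip E (s n \<ominus> l) f" for n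
    using c(1)[of n] c(2) assms(2) by (simp add: diff_def ip_add_left ip_scale_left scale_closed)
  show "nrm (coeff E) (ip E (s n) f \<ominus>\<^bsub>coeff E\<^esub> ip E l f) \<le> hnorm E (s n \<ominus> l) * hnorm E f" for n
    unfolding d using c(1)[of n] c(2) assms(2) by (intro ip_bound diff_closed)
  show "(\<lambda>n. hnorm E (s n \<ominus> l) * hnorm E f) \<longlonglongrightarrow> 0"
    using tendsto_mult_right[OF convergesD(3)[OF assms(1)]] by simp
qed (use assms convergesD ip_closed in auto)

lemma converges_ip_right:
  assumes "converges s l" "e \<in> carrier E"
  shows "B.converges (\<lambda>n. ip E e (s n)) (ip E e l)"
  using B.converges_star[OF converges_ip_left[OF assms]] assms convergesD(1,2)[OF assms(1)]
  by (simp add: ip_star)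

text \<open>The adjoints form a Cauchy sequence too, since \<open>star\<close> does not increase the
  norm. Pointwise limits of the operators and of their adjoints therefore both exist, and the
  adjoint relation passes to the limit by continuity of the inner product.\<close>

lemma op_complete: "complete_wrt L (nrm L)"
  unfolding complete_wrt_def
proof (intro allI impI, elim conjE)
  fix T :: "nat \<Rightarrow> 'e \<Rightarrow> 'e" assume rT: "range T \<subseteq> carrier L"
    and C: "\<forall>\<epsilon>>0. \<exists>n0. \<forall>m\<ge>n0. \<forall>n\<ge>n0. nrm L (T m \<ominus>\<^bsub>L\<^esub> T n) < \<epsilon>"
  have T: "T n \<in> carrier L" for n using rT by auto
  have C': "\<exists>n0. \<forall>m\<ge>n0. \<forall>n\<ge>n0. nrm L (star L (T m) \<ominus>\<^bsub>L\<^esub> star L (T n)) < \<epsilon>" if "0 < \<epsilon>" for \<epsilon>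
  proof -
    have "nrm L (star L (T m) \<ominus>\<^bsub>L\<^esub> star L (T n)) \<le> nrm L (T m \<ominus>\<^bsub>L\<^esub> T n)" for m n
      using nrm_star_op[OF op_diff_closed[OF T[of m] T[of n]]] by (simp add: star_op_diff T)
    then show ?thesis using C that by (meson order_le_less_trans)
  qed
  obtain R where R: "\<And>e. e \<in> carrier E \<Longrightarrow> converges (\<lambda>n. T n e) (R e)"
    using converges_pointwise[of T, OF T C[rule_format]] by metis
  obtain R' where R': "\<And>e. e \<in> carrier E \<Longrightarrow> converges (\<lambda>n. star L (T n) e) (R' e)"
    using converges_pointwise[of "\<lambda>n. star L (T n)", OF star_op(1)[OF T] C'] by metis
  let ?R = "restrict R (carrier E)" and ?R' = "restrict R' (carrier E)"
  have pair: "adjoint_pair E ?R ?R'"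
  proof (rule adjoint_pairI)
    fix e f assume ef: "e \<in> carrier E" "f \<in> carrier E"
    have "B.converges (\<lambda>n. ip E (T n e) f) (ip E (R e) f)"
      by (rule converges_ip_left[OF R]) fact+
    moreover have "B.converges (\<lambda>n. ip E (T n e) f) (ip E e (R' f))"
      using converges_ip_right[OF R' ef(1)] ef by (simp add: ip_op T)
    ultimately show "ip E (?R e) f = ip E e (?R' f)" using B.converges_unique ef by simp
  qed (use R R' in \<open>auto dest: convergesD(2)\<close>)
  \<comment> \<open>Letting m tend to infinity in the Cauchy estimate gives a rate that does not
    depend on e. It yields boundedness of the limit and convergence in operator norm.\<close>
  have bound: "\<exists>n0. \<forall>n\<ge>n0. \<forall>e\<in>carrier E. hnorm E (T n e \<ominus> R e) \<le> \<epsilon> * hnorm E e" if "0 < \<epsilon>" for \<epsilon>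
  proof -
    obtain n0 where n0: "\<And>m n. m \<ge> n0 \<Longrightarrow> n \<ge> n0 \<Longrightarrow> nrm L (T m \<ominus>\<^bsub>L\<^esub> T n) < \<epsilon>"
      using C \<open>0 < \<epsilon>\<close> by blast
    have "hnorm E (T n e \<ominus> R e) \<le> \<epsilon> * hnorm E e" if "n \<ge> n0" "e \<in> carrier E" for n e
    proof (rule LIMSEQ_le_const2)
      show "(\<lambda>m. hnorm E (T n e \<ominus> T m e)) \<longlonglongrightarrow> hnorm E (T n e \<ominus> R e)"
        by (rule converges_N[OF converges_diff[OF converges_const[OF op_closed[OF T that(2)]] R[OF that(2)]]])
      have "hnorm E (T n e \<ominus> T m e) \<le> \<epsilon> * hnorm E e" if "m \<ge> n0" for m
      proof -
        have "hnorm E (T n e \<ominus> T m e) \<le> nrm L (T n \<ominus>\<^bsub>L\<^esub> T m) * hnorm E e"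
          using op_bound[OF op_diff_closed[OF T T] \<open>e \<in> carrier E\<close>]
          by (simp add: op_diff_apply T \<open>e \<in> carrier E\<close>)
        also have "\<dots> \<le> \<epsilon> * hnorm E e"
          using n0[OF \<open>n \<ge> n0\<close> that] \<open>e \<in> carrier E\<close> by (intro mult_right_mono hnorm_nonneg) auto
        finally show ?thesis .
      qed
      then show "\<exists>k. \<forall>m\<ge>k. hnorm E (T n e \<ominus> T m e) \<le> \<epsilon> * hnorm E e" by blast
    qed
    then show ?thesis by blast
  qed
  obtain n1 where n1: "\<And>e. e \<in> carrier E \<Longrightarrow> hnorm E (T n1 e \<ominus> R e) \<le> 1 * hnorm E e"
    using bound[of 1] by auto
  have RL: "?R \<in> carrier L"
  proof (rule adjointablesI[OF pair])
    fix e assume e: "e \<in> carrier E"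
    have c: "T n1 e \<in> carrier E" "R e \<in> carrier E" using op_closed[OF T e] convergesD(2)[OF R[OF e]] by auto
    show "hnorm E (?R e) \<le> (1 + nrm L (T n1)) * hnorm E e"
      using N_le_diff[of "R e" "T n1 e"] N_diff_commute[of "R e" "T n1 e"] c n1[OF e]
        op_bound[OF T e, of n1] e by (simp add: algebra_simps)
  qed
  have "(\<lambda>n. nrm L (T n \<ominus>\<^bsub>L\<^esub> ?R)) \<longlonglongrightarrow> 0"
  proof (rule LIMSEQ_I)
    fix \<epsilon> :: real assume "0 < \<epsilon>"
    then obtain n0 where n0: "\<And>n e. n \<ge> n0 \<Longrightarrow> e \<in> carrier E \<Longrightarrow> hnorm E (T n e \<ominus> R e) \<le> \<epsilon> / 2 * hnorm E e"
      using bound[of "\<epsilon> / 2"] by auto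
    have "nrm L (T n \<ominus>\<^bsub>L\<^esub> ?R) \<le> \<epsilon> / 2" if "n \<ge> n0" for n
      using n0[OF that] \<open>0 < \<epsilon>\<close> by (intro nrm_op_leI) (simp_all add: op_diff_apply T RL)
    then show "\<exists>n0. \<forall>n\<ge>n0. norm (nrm L (T n \<ominus>\<^bsub>L\<^esub> ?R) - 0) < \<epsilon>"
      using \<open>0 < \<epsilon>\<close> nrm_op_nonneg[OF op_diff_closed[OF T RL]] by (auto intro!: exI[of _ n0]) fastforce
  qed
  then show "\<exists>l\<in>carrier L. (\<lambda>n. nrm L (T n \<ominus>\<^bsub>L\<^esub> l)) \<longlonglongrightarrow> 0" using RL by blast
qed

lemma cstar_algebra_adjointables: "cstar_algebra L"
proof (rule cstar_algebra.intro[OF op_vector_space], unfold_locales)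
  fix x y z and c :: complex
  assume x: "x \<in> carrier L"
  note [simp] = adjointables_simps op_closed restrict_def
  show "star L x \<in> carrier L" "star L (star L x) = x" using x by (rule star_op)+
  show "star L (c \<odot>\<^bsub>L\<^esub> x) = cnj c \<odot>\<^bsub>L\<^esub> star L x" using x by (intro star_eqI op_scale_pair)
  show "nrm L x = 0 \<longleftrightarrow> x = zero L"
  proof
    assume "nrm L x = 0"
    then have "x e = \<zero>" if "e \<in> carrier E" for e
      using op_bound[OF x that] hnorm_nonneg[OF op_closed[OF x that]] x that
      by (simp flip: N_eq_zero)
    then show "x = zero L" using x by (intro op_eqI op_zero_closed) simp_all
  next
    assume "x = zero L"
    then show "nrm L x = 0"
      using nrm_op_leI[of x 0] nrm_op_nonneg[OF x] by (simp add: N_zero)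
  qed
  show "nrm L (c \<odot>\<^bsub>L\<^esub> x) = cmod c * nrm L x"
  proof (rule antisym[OF nrm_op_scale_le[OF x]])
    show "cmod c * nrm L x \<le> nrm L (c \<odot>\<^bsub>L\<^esub> x)"
    proof (cases "c = 0")
      case False
      \<comment> \<open>The reverse inequality is the one already known, applied to the inverse
        scalar.\<close>
      have "nrm L (inverse c \<odot>\<^bsub>L\<^esub> (c \<odot>\<^bsub>L\<^esub> x)) \<le> cmod (inverse c) * nrm L (c \<odot>\<^bsub>L\<^esub> x)"
        by (intro nrm_op_scale_le op_scale_closed x)
      moreover have "inverse c \<odot>\<^bsub>L\<^esub> (c \<odot>\<^bsub>L\<^esub> x) = x"
        using False x op_extensional[OF x]
        by (intro ext) (simp add: scale_scale scale_one extensional_def)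
      ultimately show ?thesis
        using False by (simp add: norm_inverse norm_divide field_simps del: adjointables_simps)
    qed (simp add: nrm_op_nonneg op_scale_closed x del: adjointables_simps)
  qed
  show "nrm L (star L x \<otimes>\<^bsub>L\<^esub> x) = (nrm L x)\<^sup>2"
  proof (rule antisym)
    have c: "star L x \<otimes>\<^bsub>L\<^esub> x \<in> carrier L" using x by (intro op_mult_closed star_op)
    have "nrm L (star L x \<otimes>\<^bsub>L\<^esub> x) \<le> nrm L (star L x) * nrm L x"
      by (rule nrm_op_leI[OF op_mult_bound[OF star_op(1)[OF x] x]])
        (use x in \<open>simp_all add: nrm_op_nonneg star_op(1)\<close>)
    also have "\<dots> \<le> (nrm L x)\<^sup>2"
      using x by (simp add: power2_eq_square mult_right_mono nrm_star_op nrm_op_nonneg)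
    finally show "nrm L (star L x \<otimes>\<^bsub>L\<^esub> x) \<le> (nrm L x)\<^sup>2" .
    \<comment> \<open>The hard half of the C*-identity: the square of |x e| is the norm of the inner
      product of e and \<open>star L x\<close> x e, which Cauchy-Schwarz bounds.\<close>
    have "nrm L x \<le> sqrt (nrm L (star L x \<otimes>\<^bsub>L\<^esub> x))"
    proof (rule nrm_op_leI)
      fix e assume e: "e \<in> carrier E"
      have "(hnorm E (x e))\<^sup>2 = nrm (coeff E) (ip E e ((star L x \<otimes>\<^bsub>L\<^esub> x) e))"
        using x e by (simp add: hnorm_squared ip_op)
      also have "\<dots> \<le> hnorm E e * hnorm E ((star L x \<otimes>\<^bsub>L\<^esub> x) e)"
        by (rule ip_bound[OF e op_closed[OF c e]])
      also have "\<dots> \<le> hnorm E e * (nrm L (star L x \<otimes>\<^bsub>L\<^esub> x) * hnorm E e)"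
        by (rule mult_left_mono[OF op_bound[OF c e] hnorm_nonneg[OF e]])
      also have "\<dots> = (sqrt (nrm L (star L x \<otimes>\<^bsub>L\<^esub> x)) * hnorm E e)\<^sup>2"
        using nrm_op_nonneg[OF c] by (simp add: power_mult_distrib power2_eq_square del: adjointables_simps)
      finally show "hnorm E (x e) \<le> sqrt (nrm L (star L x \<otimes>\<^bsub>L\<^esub> x)) * hnorm E e"
        by (rule power2_le_imp_le) (simp add: hnorm_nonneg[OF e] nrm_op_nonneg[OF c] del: adjointables_simps)
    qed (simp add: nrm_op_nonneg[OF c] del: adjointables_simps)
    then show "(nrm L x)\<^sup>2 \<le> nrm L (star L x \<otimes>\<^bsub>L\<^esub> x)"
      using power_mono[OF _ nrm_op_nonneg[OF x], of "sqrt (nrm L (star L x \<otimes>\<^bsub>L\<^esub> x))" 2]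
        nrm_op_nonneg[OF c] by (simp del: adjointables_simps)
  qed
  assume y: "y \<in> carrier L"
  show "x \<otimes>\<^bsub>L\<^esub> y \<in> carrier L" using x y by (rule op_mult_closed)
  show "(c \<odot>\<^bsub>L\<^esub> x) \<otimes>\<^bsub>L\<^esub> y = c \<odot>\<^bsub>L\<^esub> (x \<otimes>\<^bsub>L\<^esub> y)" using x y by (intro ext) simp
  show "x \<otimes>\<^bsub>L\<^esub> (c \<odot>\<^bsub>L\<^esub> y) = c \<odot>\<^bsub>L\<^esub> (x \<otimes>\<^bsub>L\<^esub> y)" using x y by (intro ext) (simp add: op_scale)
  show "star L (x \<oplus>\<^bsub>L\<^esub> y) = star L x \<oplus>\<^bsub>L\<^esub> star L y" using x y by (intro star_eqI op_add_pair)
  show "star L (x \<otimes>\<^bsub>L\<^esub> y) = star L y \<otimes>\<^bsub>L\<^esub> star L x" using x y by (intro star_eqI op_mult_pair)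
  show "nrm L (x \<oplus>\<^bsub>L\<^esub> y) \<le> nrm L x + nrm L y"
    using x y by (intro nrm_op_leI op_add_bound add_nonneg_nonneg nrm_op_nonneg)
  show "nrm L (x \<otimes>\<^bsub>L\<^esub> y) \<le> nrm L x * nrm L y"
    using x y by (intro nrm_op_leI op_mult_bound mult_nonneg_nonneg nrm_op_nonneg)
  assume z: "z \<in> carrier L"
  show "x \<otimes>\<^bsub>L\<^esub> y \<otimes>\<^bsub>L\<^esub> z = x \<otimes>\<^bsub>L\<^esub> (y \<otimes>\<^bsub>L\<^esub> z)" using x y z by (intro ext) simp
  show "x \<otimes>\<^bsub>L\<^esub> (y \<oplus>\<^bsub>L\<^esub> z) = x \<otimes>\<^bsub>L\<^esub> y \<oplus>\<^bsub>L\<^esub> x \<otimes>\<^bsub>L\<^esub> z"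
    using x y z by (intro ext) (simp add: op_add)
  show "(x \<oplus>\<^bsub>L\<^esub> y) \<otimes>\<^bsub>L\<^esub> z = x \<otimes>\<^bsub>L\<^esub> z \<oplus>\<^bsub>L\<^esub> y \<otimes>\<^bsub>L\<^esub> z"
    using x y z by (intro ext) simp
qed (rule op_complete)

section \<open>Rank-one operators\<close>

lemma theta_apply: "g \<in> carrier E \<Longrightarrow> theta E e f g = ract E e (ip E f g)"
  by (simp add: theta_def)

lemma theta_pair:
  assumes "e \<in> carrier E" "f \<in> carrier E"
  shows "adjoint_pair E (theta E e f) (theta E f e)"
  using assms by (intro adjoint_pairI)
    (simp_all add: theta_def ract_closed ip_closed ip_ract ip_ract_left ip_star)

lemma theta_closed:
  assumes "e \<in> carrier E" "f \<in> carrier E"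
  shows "theta E e f \<in> carrier L"
proof (rule adjointablesI[OF theta_pair[OF assms]])
  fix g assume g: "g \<in> carrier E"
  have "hnorm E (theta E e f g) \<le> hnorm E e * nrm (coeff E) (ip E f g)"
    using assms g by (simp add: theta_apply hnorm_ract ip_closed)
  also have "\<dots> \<le> hnorm E e * (hnorm E f * hnorm E g)"
    using assms g by (intro mult_left_mono ip_bound hnorm_nonneg)
  finally show "hnorm E (theta E e f g) \<le> (hnorm E e * hnorm E f) * hnorm E g"
    by (simp add: mult.assoc)
qed

lemma star_theta:
  "\<lbrakk>e \<in> carrier E; f \<in> carrier E\<rbrakk> \<Longrightarrow> star L (theta E e f) = theta E f e"
  by (rule star_eqI[OF theta_pair])

text \<open>T commutes with the right action. The finite-rank operators thus absorb left
  multiplication, which is the source of closure under products below.\<close>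

lemma op_mult_theta:
  assumes "T \<in> carrier L" "e \<in> carrier E" "f \<in> carrier E"
  shows "T \<otimes>\<^bsub>L\<^esub> theta E e f = theta E (T e) f"
  using assms by (intro ext) (simp add: adjointables_simps theta_def restrict_def op_ract ip_closed)

end

subsection \<open>The homomorphism of compact operators\<close>

lemma compacts_simps:
  "carrier (compacts E) = closed_span (adjointables E)
     {theta E e f | e f. e \<in> carrier E \<and> f \<in> carrier E}"
  "add (compacts E) = add (adjointables E)"
  "scale (compacts E) = scale (adjointables E)"
  "mult (compacts E) = mult (adjointables E)"
  "star (compacts E) = star (adjointables E)"
  "nrm (compacts E) = nrm (adjointables E)"
  by (simp_all add: compacts_def)

text \<open>Compatibility of S with \<phi> on inner products and on the right action is what is
  needed to carry e <f, g> to S e <S f, S g>, that is, to make S intertwine the rank-one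
  operators.\<close>

locale hilbert_module_map = E: hilbert_module_CS E + F: hilbert_module_CS F
  for E :: "('e, 'b, 'm) hmod_scheme" and F :: "('f, 'd, 'n) hmod_scheme" +
  fixes S :: "'e \<Rightarrow> 'f" and \<phi> :: "'b \<Rightarrow> 'd"
  assumes S_linear: "complex_linear E F S"
    and ip_S: "\<lbrakk>e \<in> carrier E; f \<in> carrier E\<rbrakk> \<Longrightarrow> ip F (S e) (S f) = \<phi> (ip E e f)"
    and S_ract: "\<lbrakk>e \<in> carrier E; b \<in> carrier (coeff E)\<rbrakk> \<Longrightarrow> S (ract E e b) = ract F (S e) (\<phi> b)"
begin

abbreviation (input) "LE \<equiv> adjointables E"
abbreviation (input) "LF \<equiv> adjointables F"
abbreviation (input) "thetas \<equiv> {theta E e f | e f. e \<in> carrier E \<and> f \<in> carrier E}"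
abbreviation (input) "thetasF \<equiv> {theta F e f | e f. e \<in> carrier F \<and> f \<in> carrier F}"

sublocale LE: cstar_algebra LE by (rule E.cstar_algebra_adjointables)
sublocale LF: cstar_algebra LF by (rule F.cstar_algebra_adjointables)

lemmas S_closed = complex_linear_closed[OF S_linear]

text \<open>Both coordinates grow in parallel, mirroring \<open>linear_span\<close>. A given t may a
  priori occur with several r, one for each expansion of t.\<close>

inductive_set span_graph :: "(('e \<Rightarrow> 'e) \<times> ('f \<Rightarrow> 'f)) set" where
  zero: "(zero LE, zero LF) \<in> span_graph"
| step: "\<lbrakk>(t, r) \<in> span_graph; e \<in> carrier E; f \<in> carrier E\<rbrakk> \<Longrightarrow>
    (t \<oplus>\<^bsub>LE\<^esub> c \<odot>\<^bsub>LE\<^esub> theta E e f, r \<oplus>\<^bsub>LF\<^esub> c \<odot>\<^bsub>LF\<^esub> theta F (S e) (S f)) \<in> span_graph"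

lemma thetas_closed: "thetas \<subseteq> carrier LE" "thetasF \<subseteq> carrier LF"
  by (auto intro: E.theta_closed F.theta_closed)

lemma span_graph_closed:
  "(t, r) \<in> span_graph \<Longrightarrow> t \<in> carrier LE \<and> r \<in> carrier LF"
  by (induction rule: span_graph.induct)
     (auto intro!: LE.vs_closed LF.vs_closed E.theta_closed F.theta_closed S_closed)

lemma span_graph_span:
  "(t, r) \<in> span_graph \<Longrightarrow> t \<in> linear_span LE thetas \<and> r \<in> linear_span LF thetasF"
  by (induction rule: span_graph.induct) (auto intro!: linear_span.intros S_closed)

lemma Domain_span_graph: "t \<in> linear_span LE thetas \<Longrightarrow> t \<in> Domain span_graph"
  by (induction rule: linear_span.induct) (auto intro: span_graph.intros)

text \<open>It determines r only on the range of S. That is enough for products, where r meets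
  nothing but vectors S e.\<close>

lemma span_graph_intertwines:
  "\<lbrakk>(t, r) \<in> span_graph; e \<in> carrier E\<rbrakk> \<Longrightarrow> r (S e) = S (t e)"
proof (induction rule: span_graph.induct)
  case zero
  then show ?case
    using complex_linear_scale[OF S_linear E.zero_closed, of 0]
    by (simp add: E.adjointables_simps F.adjointables_simps S_closed E.zero_closed E.scale_zero_left
        F.scale_zero_left)
next
  case (step t r f g c)
  then have "t \<in> carrier LE" using span_graph_closed by blast
  with step show ?case
    by (simp add: E.adjointables_simps F.adjointables_simps S_closed E.theta_apply F.theta_apply
        E.op_closed E.vs_closed E.ract_closed E.ip_closed ip_S
        complex_linear_add[OF S_linear] complex_linear_scale[OF S_linear] S_ract)
qed

lemma span_graph_add:
  assumes "(t, r) \<in> span_graph" "(t', r') \<in> span_graph"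
  shows "(t \<oplus>\<^bsub>LE\<^esub> t', r \<oplus>\<^bsub>LF\<^esub> r') \<in> span_graph"
  using assms(2)
proof (induction rule: span_graph.induct)
  case zero
  then show ?case using assms(1) span_graph_closed[OF assms(1)] by (simp add: LE.add_zero LF.add_zero)
next
  case (step t' r' e f c)
  then show ?case
    using span_graph.step[OF step.IH step.hyps(2,3), of c]
      span_graph_closed[OF assms(1)] span_graph_closed[OF step.hyps(1)]
    by (simp add: LE.add_assoc LF.add_assoc LE.vs_closed LF.vs_closed E.theta_closed F.theta_closed S_closed)
qed

lemma span_graph_theta:
  assumes "e \<in> carrier E" "f \<in> carrier E"
  shows "(c \<odot>\<^bsub>LE\<^esub> theta E e f, c \<odot>\<^bsub>LF\<^esub> theta F (S e) (S f)) \<in> span_graph"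
  using span_graph.step[OF span_graph.zero assms, of c] assms
  by (simp add: LE.zero_add LF.zero_add LE.vs_closed LF.vs_closed E.theta_closed F.theta_closed S_closed)

lemma span_graph_scale:
  "(t, r) \<in> span_graph \<Longrightarrow> (c \<odot>\<^bsub>LE\<^esub> t, c \<odot>\<^bsub>LF\<^esub> r) \<in> span_graph"
proof (induction rule: span_graph.induct)
  case zero
  then show ?case using span_graph.zero by (simp add: LE.scale_zero_right LF.scale_zero_right)
next
  case (step t r e f d)
  then show ?case
    using span_graph.step[OF step.IH step.hyps(2,3), of "c * d"] span_graph_closed[OF step.hyps(1)]
    by (simp add: LE.scale_add_right LF.scale_add_right LE.scale_scale LF.scale_scale
        LE.vs_closed LF.vs_closed E.theta_closed F.theta_closed S_closed)
qed

lemma star_zero: "star LE (zero LE) = zero LE" "star LF (zero LF) = zero LF"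
  using LE.star_scale[OF LE.zero_closed, of 0] LF.star_scale[OF LF.zero_closed, of 0]
  by (simp_all add: LE.scale_zero_left LE.scale_zero_right LE.star_closed LE.zero_closed
      LF.scale_zero_left LF.scale_zero_right LF.star_closed LF.zero_closed)

lemma span_graph_star:
  "(t, r) \<in> span_graph \<Longrightarrow> (star LE t, star LF r) \<in> span_graph"
proof (induction rule: span_graph.induct)
  case zero
  then show ?case using span_graph.zero by (simp add: star_zero)
next
  case (step t r e f c)
  then show ?case
    using span_graph.step[OF step.IH step.hyps(3,2), of "cnj c"] span_graph_closed[OF step.hyps(1)]
    by (simp add: LE.star_add LF.star_add LE.star_scale LF.star_scale E.star_theta F.star_theta
        LE.vs_closed LF.vs_closed E.theta_closed F.theta_closed S_closed)
qed

lemma op_mult_zero: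
  "t \<in> carrier LE \<Longrightarrow> t \<otimes>\<^bsub>LE\<^esub> zero LE = zero LE"
  "r \<in> carrier LF \<Longrightarrow> r \<otimes>\<^bsub>LF\<^esub> zero LF = zero LF"
  using LE.mult_scale_right[OF _ LE.zero_closed, of t 0] LF.mult_scale_right[OF _ LF.zero_closed, of r 0]
  by (simp_all add: LE.scale_zero_left LE.zero_closed LE.mult_closed
      LF.scale_zero_left LF.zero_closed LF.mult_closed)

text \<open>Induction on the second factor alone suffices: t absorbs \<open>theta E e f\<close> into
  \<open>theta E (t e) f\<close>, and r absorbs \<open>theta F (S e) (S f)\<close> into a rank-one
  operator with vector r (S e) = S (t e), so the two products match.\<close>

lemma span_graph_mult:
  assumes "(t, r) \<in> span_graph" "(t', r') \<in> span_graph"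
  shows "(t \<otimes>\<^bsub>LE\<^esub> t', r \<otimes>\<^bsub>LF\<^esub> r') \<in> span_graph"
  using assms(2)
proof (induction rule: span_graph.induct)
  case zero
  then show ?case using span_graph_closed[OF assms(1)] span_graph.zero by (simp add: op_mult_zero)
next
  case (step t' r' e f c)
  have c: "t \<in> carrier LE" "r \<in> carrier LF" "t' \<in> carrier LE" "r' \<in> carrier LF"
    using span_graph_closed[OF assms(1)] span_graph_closed[OF step.hyps(1)] by auto
  show ?case
    using span_graph.step[OF step.IH E.op_closed[OF c(1) step.hyps(2)] step.hyps(3), of c] step.hyps c
    by (simp add: LE.distrib_left LF.distrib_left LE.mult_scale_right LF.mult_scale_right
        E.op_mult_theta F.op_mult_theta span_graph_intertwines[OF assms(1)]
        LE.vs_closed LF.vs_closed E.theta_closed F.theta_closed S_closed)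
qed

end

text \<open>The norm inequality is isolated here as an assumption: for the inclusion of the module
  over \<open>U\<close> it is the analytic content and is proved later with cutoff
  functions.\<close>

locale contractive_module_map = hilbert_module_map E F S \<phi>
  for E :: "('e, 'b, 'm) hmod_scheme" and F :: "('f, 'd, 'n) hmod_scheme" and S \<phi> +
  assumes span_graph_contractive:
    "(t, r) \<in> span_graph \<Longrightarrow> nrm (adjointables F) r \<le> nrm (adjointables E) t"
begin

sublocale K: contractive_graph LE LF span_graph
  by unfold_locales
     (auto dest: span_graph_closed span_graph_add span_graph_scale span_graph_mult span_graph_star
        span_graph_contractive)

lemma compact_gclosure:
  assumes "T \<in> carrier (compacts E)"
  obtains R where "(T, R) \<in> K.gclosure"
proof -
  obtain s where s: "\<And>n. s n \<in> linear_span LE thetas" "LE.converges s T"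
    using assms LE.closed_span_iff_converges[OF thetas_closed(1)] by (auto simp: compacts_simps)
  then show thesis using K.gclosure_total[OF Domain_span_graph[OF s(1)] s(2)] that by blast
qed

text \<open>Each finite stage lies in the span of rank-one operators on either side, so both limits
  are compact. Applied to left multiplications, the second half will give the inclusion of the
  ideals.\<close>

lemma gclosure_compact:
  assumes "(T, R) \<in> K.gclosure"
  shows "T \<in> carrier (compacts E)" "R \<in> carrier (compacts F)"
proof -
  obtain s t where st: "\<And>n. (s n, t n) \<in> span_graph" "LE.converges s T" "LF.converges t R"
    using assms K.gclosureE by metis
  show "T \<in> carrier (compacts E)"
    unfolding compacts_simps LE.closed_span_iff_converges[OF thetas_closed(1)]
    using st span_graph_span by blast
  show "R \<in> carrier (compacts F)"
    unfolding compacts_simps LF.closed_span_iff_converges[OF thetas_closed(2)]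
    using st span_graph_span by blast
qed

definition extension :: "('e \<Rightarrow> 'e) \<Rightarrow> ('f \<Rightarrow> 'f)"
  where "extension = (\<lambda>T\<in>carrier (compacts E). THE R. (T, R) \<in> K.gclosure)"

lemma extension_eq: "(T, R) \<in> K.gclosure \<Longrightarrow> extension T = R"
  using gclosure_compact by (auto simp: extension_def intro: K.gclosure_unique)

lemma extension_gclosure: "T \<in> carrier (compacts E) \<Longrightarrow> (T, extension T) \<in> K.gclosure"
  by (metis compact_gclosure extension_eq)

lemma theta_gclosure:
  "\<lbrakk>e \<in> carrier E; f \<in> carrier E\<rbrakk> \<Longrightarrow> (theta E e f, theta F (S e) (S f)) \<in> K.gclosure"
  using span_graph_theta[of e f 1]
  by (intro K.G_subset_gclosure)
     (simp add: LE.scale_one LF.scale_one E.theta_closed F.theta_closed S_closed)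

lemma star_hom_extension: "star_hom (compacts E) (compacts F) extension"
proof -
  note g = extension_gclosure
  show ?thesis
    unfolding star_hom_def complex_linear_def
    by (auto simp: compacts_simps(2-) intro: gclosure_compact(2)[OF g]
        intro!: extension_eq K.gclosure_add K.gclosure_scale K.gclosure_mult K.gclosure_star g)
qed

text \<open>Linearity and the prescribed values fix h on finite sums of rank-one operators;
  contractivity makes h continuous, hence fixed on their closure.\<close>

lemma star_hom_compacts_unique:
  assumes h: "h \<in> extensional (carrier (compacts E))" "star_hom (compacts E) (compacts F) h"
    and contr: "\<And>T. T \<in> carrier (compacts E) \<Longrightarrow> nrm (compacts F) (h T) \<le> nrm (compacts E) T"
    and theta: "\<And>e f. \<lbrakk>e \<in> carrier E; f \<in> carrier E\<rbrakk> \<Longrightarrow> h (theta E e f) = theta F (S e) (S f)"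
  shows "h = extension"
proof (rule extensionalityI[OF h(1)])
  show "extension \<in> extensional (carrier (compacts E))" by (simp add: extension_def)
  have lin: "complex_linear (compacts E) (compacts F) h" using h(2) by (simp add: star_hom_def)
  note hadd = complex_linear_add[OF lin, unfolded compacts_simps(2)]
    and hscale = complex_linear_scale[OF lin, unfolded compacts_simps(3)]
  note g = K.G_subset_gclosure gclosure_compact(1)
  have on_graph: "h t = r" if "(t, r) \<in> span_graph" for t r
    using that
  proof (induction rule: span_graph.induct)
    case zero
    have z: "zero LE \<in> carrier (compacts E)"
      by (rule gclosure_compact(1)[OF K.G_subset_gclosure[OF span_graph.zero]])
    have "h (zero LE) \<in> carrier LF"
      using complex_linear_closed[OF lin z] by (simp add: compacts_simps closed_span_def)
    then show ?case using hscale[OF z, of 0] by (simp add: LE.scale_zero_right LF.scale_zero_left)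
  next
    case (step t r e f c)
    have "theta E e f \<in> carrier (compacts E)" "c \<odot>\<^bsub>LE\<^esub> theta E e f \<in> carrier (compacts E)"
      using gclosure_compact(1)[OF theta_gclosure] gclosure_compact(1)[OF K.gclosure_scale[OF theta_gclosure]]
        step.hyps by blast+
    moreover have "t \<in> carrier (compacts E)"
      by (rule gclosure_compact(1)[OF K.G_subset_gclosure[OF step.hyps(1)]])
    ultimately show ?case using step by (simp add: hadd hscale theta)
  qed
  fix T assume T: "T \<in> carrier (compacts E)"
  obtain s t where st: "\<And>n. (s n, t n) \<in> span_graph" "LE.converges s T" "LF.converges t (extension T)"
    using extension_gclosure[OF T] K.gclosureE by metis
  have s: "s n \<in> carrier (compacts E)" for n
    by (rule gclosure_compact(1)[OF K.G_subset_gclosure[OF st(1)]])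
  have hT: "h T \<in> carrier LF"
    using complex_linear_closed[OF lin T] by (simp add: compacts_simps closed_span_def)
  \<comment> \<open>Since \<open>t n\<close> = h (s n), the distance from \<open>t n\<close> to
    \<open>h T\<close> is at most that from \<open>s n\<close> to \<open>T\<close>; so
    \<open>h T\<close> is a limit of the same sequence as \<open>extension T\<close>.\<close>
  have "LF.converges t (h T)"
  proof (rule LF.convergesI)
    fix n
    have neg: "(- 1) \<odot>\<^bsub>LE\<^esub> T \<in> carrier (compacts E)"
      by (rule gclosure_compact(1)[OF K.gclosure_scale[OF extension_gclosure[OF T]]])
    have sub: "s n \<ominus>\<^bsub>LE\<^esub> T \<in> carrier (compacts E)"
      unfolding diff_def
      by (rule gclosure_compact(1)[OF K.gclosure_add[OF extension_gclosure[OF s]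
            K.gclosure_scale[OF extension_gclosure[OF T]]]])
    have "t n \<ominus>\<^bsub>LF\<^esub> h T = h (s n \<ominus>\<^bsub>LE\<^esub> T)"
      using on_graph[OF st(1)[of n]] by (simp add: diff_def hadd[OF s neg] hscale[OF T])
    then show "nrm LF (t n \<ominus>\<^bsub>LF\<^esub> h T) \<le> nrm LE (s n \<ominus>\<^bsub>LE\<^esub> T)"
      using contr[OF sub] by (simp add: compacts_simps)
  qed (use st hT LE.convergesD LF.convergesD in auto)
  then show "h T = extension T" using st(3) by (rule LF.converges_unique)
qed

theorem hat_eq_extension: "hat E F S = extension"
  unfolding hat_def
proof (rule the_equality)
  show "extension \<in> extensional (carrier (compacts E)) \<and>
    star_hom (compacts E) (compacts F) extension \<and>
    (\<forall>T\<in>carrier (compacts E). nrm (compacts F) (extension T) \<le> nrm (compacts E) T) \<and>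
    (\<forall>e\<in>carrier E. \<forall>f\<in>carrier E. extension (theta E e f) = theta F (S e) (S f))"
    using star_hom_extension K.gclosure_contractive[OF extension_gclosure] extension_eq[OF theta_gclosure]
    by (simp add: compacts_simps(6)) (simp add: extension_def)
qed (use star_hom_compacts_unique in blast)

end

subsection \<open>Functions vanishing at infinity\<close>

text \<open>Reduces continuity of arithmetic expressions on an abstract space to the limit rules for
  filters.\<close>

lemma continuous_map_tendsto:
  "continuous_map X euclidean f \<longleftrightarrow> (\<forall>x\<in>topspace X. (f \<longlongrightarrow> f x) (atin X x))"
  by (simp add: continuous_map_atin)

lemma C0_carrier:
  "f \<in> carrier (C0 X) \<longleftrightarrow> continuous_map X euclidean f \<and> (\<forall>x. x \<notin> topspace X \<longrightarrow> f x = 0) \<and>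
     (\<forall>\<epsilon>>0. \<exists>K. compactin X K \<and> (\<forall>x\<in>topspace X - K. cmod (f x) < \<epsilon>))"
  by (simp add: C0_def)

lemma C0_simps:
  "zero (C0 X) = (\<lambda>x. 0)" "f \<oplus>\<^bsub>C0 X\<^esub> g = (\<lambda>x. f x + g x)" "c \<odot>\<^bsub>C0 X\<^esub> f = (\<lambda>x. c * f x)"
  "f \<otimes>\<^bsub>C0 X\<^esub> g = (\<lambda>x. f x * g x)" "star (C0 X) f = (\<lambda>x. cnj (f x))"
  "f \<ominus>\<^bsub>C0 X\<^esub> g = (\<lambda>x. f x - g x)"
  by (simp_all add: C0_def diff_def)

lemma C0_continuous: "f \<in> carrier (C0 X) \<Longrightarrow> continuous_map X euclidean f"
  and C0_outside: "\<lbrakk>f \<in> carrier (C0 X); x \<notin> topspace X\<rbrakk> \<Longrightarrow> f x = 0"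
  by (auto simp: C0_carrier)

lemma C0_small:
  assumes "f \<in> carrier (C0 X)" "0 < \<epsilon>"
  obtains K where "compactin X K" "\<And>x. x \<notin> K \<Longrightarrow> cmod (f x) < \<epsilon>"
proof -
  obtain K where "compactin X K" "\<forall>x\<in>topspace X - K. cmod (f x) < \<epsilon>"
    using assms by (auto simp: C0_carrier)
  then have "cmod (f x) < \<epsilon>" if "x \<notin> K" for x
    using that assms C0_outside[OF assms(1), of x] by (cases "x \<in> topspace X") auto
  then show thesis using that \<open>compactin X K\<close> by blast
qed

lemma C0_bounded:
  assumes "f \<in> carrier (C0 X)"
  shows "bdd_above (range (\<lambda>x. cmod (f x)))"
proof -
  obtain K where K: "compactin X K" "\<And>x. x \<notin> K \<Longrightarrow> cmod (f x) < 1"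
    using C0_small[OF assms, of 1] by auto
  have "compact (f ` K)"
    using image_compactin[OF K(1) C0_continuous[OF assms]] by simp
  then obtain b where b: "\<And>x. x \<in> K \<Longrightarrow> cmod (f x) \<le> b"
    using compact_imp_bounded by (fastforce simp: bounded_iff)
  show ?thesis
    by (rule bdd_aboveI2[of _ _ "max b 1"]) (use b K(2) in \<open>fastforce simp: le_max_iff_disj\<close>)
qed

lemma C0_norm_upper: "f \<in> carrier (C0 X) \<Longrightarrow> cmod (f x) \<le> nrm (C0 X) f"
  by (simp add: C0_def cSUP_upper[OF _ C0_bounded[unfolded C0_def, simplified]])

lemma C0_norm_least: "(\<And>x. cmod (f x) \<le> c) \<Longrightarrow> nrm (C0 X) f \<le> c"
  by (simp add: C0_def cSUP_least)

lemma C0_dominated: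
  assumes "continuous_map X euclidean f" "\<And>x. x \<notin> topspace X \<Longrightarrow> f x = 0"
    and "g \<in> carrier (C0 X)" "\<And>x. x \<in> topspace X \<Longrightarrow> cmod (f x) \<le> c * cmod (g x)"
  shows "f \<in> carrier (C0 X)"
  unfolding C0_carrier
proof (intro conjI allI impI)
  fix \<epsilon> :: real assume e: "0 < \<epsilon>"
  \<comment> \<open>The divisor \<open>\<bar>c\<bar> + 1\<close> is positive whatever the sign of
    c.\<close>
  obtain K where K: "compactin X K" "\<And>x. x \<notin> K \<Longrightarrow> cmod (g x) < \<epsilon> / (\<bar>c\<bar> + 1)"
    using C0_small[OF assms(3), of "\<epsilon> / (\<bar>c\<bar> + 1)"] e by (auto intro: divide_pos_pos)
  have "cmod (f x) < \<epsilon>" if "x \<in> topspace X - K" for x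
  proof -
    have "cmod (f x) \<le> c * cmod (g x)" using assms(4) that by simp
    also have "\<dots> \<le> (\<bar>c\<bar> + 1) * cmod (g x)" by (intro mult_right_mono) auto
    also have "\<dots> < \<epsilon>" using K(2)[of x] that by (simp add: field_simps)
    finally show ?thesis .
  qed
  then show "\<exists>K. compactin X K \<and> (\<forall>x\<in>topspace X - K. cmod (f x) < \<epsilon>)" using K(1) by blast
qed (use assms in auto)

lemma C0_zero: "(\<lambda>x. 0) \<in> carrier (C0 X)"
  by (auto simp: C0_carrier intro!: exI[of _ "{}"])

lemma C0_add:
  assumes "f \<in> carrier (C0 X)" "g \<in> carrier (C0 X)"
  shows "(\<lambda>x. f x + g x) \<in> carrier (C0 X)"
  unfolding C0_carrier
proof (intro conjI allI impI)
  show "continuous_map X euclidean (\<lambda>x. f x + g x)"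
    using assms by (intro continuous_map_add C0_continuous)
  fix \<epsilon> :: real assume e: "0 < \<epsilon>"
  obtain K where K: "compactin X K" "\<And>x. x \<notin> K \<Longrightarrow> cmod (f x) < \<epsilon> / 2"
    using C0_small[OF assms(1), of "\<epsilon> / 2"] e by auto
  obtain K' where K': "compactin X K'" "\<And>x. x \<notin> K' \<Longrightarrow> cmod (g x) < \<epsilon> / 2"
    using C0_small[OF assms(2), of "\<epsilon> / 2"] e by auto
  have "cmod (f x + g x) < \<epsilon>" if "x \<notin> K \<union> K'" for x
    using norm_triangle_ineq[of "f x" "g x"] K(2)[of x] K'(2)[of x] that by simp
  then show "\<exists>K. compactin X K \<and> (\<forall>x\<in>topspace X - K. cmod (f x + g x) < \<epsilon>)"
    using compactin_Un[OF K(1) K'(1)] by blast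
qed (use C0_outside[OF assms(1)] C0_outside[OF assms(2)] in auto)

lemma C0_mult_bounded:
  assumes "continuous_map X euclidean f" "g \<in> carrier (C0 X)"
    and "\<And>x. x \<in> topspace X \<Longrightarrow> cmod (f x) \<le> c"
  shows "(\<lambda>x. f x * g x) \<in> carrier (C0 X)"
proof (rule C0_dominated[OF _ _ assms(2)])
  show "continuous_map X euclidean (\<lambda>x. f x * g x)"
    using assms(1) C0_continuous[OF assms(2)]
    by (auto simp: continuous_map_tendsto intro!: tendsto_mult)
  show "cmod (f x * g x) \<le> c * cmod (g x)" if "x \<in> topspace X" for x
    using assms(3)[OF that] by (simp add: norm_mult mult_right_mono)
qed (use C0_outside[OF assms(2)] in auto)

lemma C0_mult:
  "\<lbrakk>f \<in> carrier (C0 X); g \<in> carrier (C0 X)\<rbrakk> \<Longrightarrow> (\<lambda>x. f x * g x) \<in> carrier (C0 X)"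
  by (rule C0_mult_bounded[OF C0_continuous _ C0_norm_upper])

lemma C0_scale: "f \<in> carrier (C0 X) \<Longrightarrow> (\<lambda>x. c * f x) \<in> carrier (C0 X)"
  by (rule C0_mult_bounded[of X "\<lambda>_. c" f "cmod c"]) auto

lemma C0_star: "f \<in> carrier (C0 X) \<Longrightarrow> (\<lambda>x. cnj (f x)) \<in> carrier (C0 X)"
  by (rule C0_dominated[of _ _ f 1])
     (auto simp: continuous_map_tendsto C0_outside intro!: tendsto_cnj dest!: C0_continuous)

text \<open>Serves twice: for completeness of \<open>C0 X\<close>, and for the fibre sums of a limit
  of module elements, which are uniform limits of fibre sums.\<close>

lemma C0_uniform_limit:
  assumes "\<And>x. x \<notin> topspace X \<Longrightarrow> f x = 0"
    and "\<And>\<epsilon>. 0 < \<epsilon> \<Longrightarrow> \<exists>g\<in>carrier (C0 X). \<forall>x. cmod (f x - g x) \<le> \<epsilon>"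
  shows "f \<in> carrier (C0 X)"
  unfolding C0_carrier continuous_map_tendsto
proof (intro conjI allI impI ballI)
  fix x assume x: "x \<in> topspace X"
  show "(f \<longlongrightarrow> f x) (atin X x)"
  proof (rule tendstoI)
    fix \<epsilon> :: real assume "0 < \<epsilon>"
    then obtain g where g: "g \<in> carrier (C0 X)" "\<And>x. cmod (f x - g x) \<le> \<epsilon> / 3"
      using assms(2)[of "\<epsilon> / 3"] by auto
    have "(g \<longlongrightarrow> g x) (atin X x)"
      using C0_continuous[OF g(1)] x by (simp add: continuous_map_tendsto)
    then have "\<forall>\<^sub>F y in atin X x. dist (g y) (g x) < \<epsilon> / 3"
      using \<open>0 < \<epsilon>\<close> by (intro tendstoD) auto
    then show "\<forall>\<^sub>F y in atin X x. dist (f y) (f x) < \<epsilon>"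
    proof eventually_elim
      case (elim y)
      have "dist (f y) (f x) \<le> dist (f y) (g y) + dist (g y) (g x) + dist (f x) (g x)"
        using dist_triangle[of "f y" "f x" "g y"] dist_triangle[of "g y" "f x" "g x"]
        by (simp add: dist_commute)
      then show ?case using elim g(2)[of x] g(2)[of y] by (simp add: dist_norm)
    qed
  qed
next
  fix \<epsilon> :: real assume "0 < \<epsilon>"
  then obtain g where g: "g \<in> carrier (C0 X)" "\<And>x. cmod (f x - g x) \<le> \<epsilon> / 2"
    using assms(2)[of "\<epsilon> / 2"] by auto
  obtain K where K: "compactin X K" "\<And>x. x \<notin> K \<Longrightarrow> cmod (g x) < \<epsilon> / 2"
    using C0_small[OF g(1), of "\<epsilon> / 2"] \<open>0 < \<epsilon>\<close> by auto
  have "cmod (f x) < \<epsilon>" if "x \<notin> K" for x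
    using norm_triangle_sub[of "f x" "g x"] K(2)[OF that] g(2)[of x] by simp
  then show "\<exists>K. compactin X K \<and> (\<forall>x\<in>topspace X - K. cmod (f x) < \<epsilon>)" using K(1) by blast
qed (use assms(1) in auto)

lemma C0_norm_nonneg: "f \<in> carrier (C0 X) \<Longrightarrow> 0 \<le> nrm (C0 X) f"
  \<comment> \<open>The supremum runs over the whole type, which is nonempty;
    \<open>undefined\<close> is just some point of it.\<close>
  using C0_norm_upper[of f X undefined] norm_ge_zero order_trans by blast

lemma C0_norm_eq_zero:
  assumes "f \<in> carrier (C0 X)"
  shows "nrm (C0 X) f = 0 \<longleftrightarrow> f = (\<lambda>x. 0)"
proof
  assume "nrm (C0 X) f = 0"
  then show "f = (\<lambda>x. 0)" using C0_norm_upper[OF assms] by (intro ext) simp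
next
  assume "f = (\<lambda>x. 0)"
  then show "nrm (C0 X) f = 0" by (simp add: C0_def)
qed

lemma C0_complete: "complete_wrt (C0 X) (nrm (C0 X))"
  unfolding complete_wrt_def
proof (intro allI impI, elim conjE)
  fix s :: "nat \<Rightarrow> 'a \<Rightarrow> complex"
  assume rs: "range s \<subseteq> carrier (C0 X)"
    and C: "\<forall>\<epsilon>>0. \<exists>n0. \<forall>m\<ge>n0. \<forall>n\<ge>n0. nrm (C0 X) (s m \<ominus>\<^bsub>C0 X\<^esub> s n) < \<epsilon>"
  have s: "s n \<in> carrier (C0 X)" for n using rs by auto
  have up: "cmod (s m x - s n x) \<le> nrm (C0 X) (s m \<ominus>\<^bsub>C0 X\<^esub> s n)" for m n x
    using C0_norm_upper[OF C0_add[OF s[of m] C0_scale[OF s[of n], of "- 1"]], of x] by (simp add: C0_simps)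
  have "Cauchy (\<lambda>n. s n x)" for x
  proof (rule metric_CauchyI)
    fix \<epsilon> :: real assume "0 < \<epsilon>"
    then obtain n0 where n0: "\<And>m n. m \<ge> n0 \<Longrightarrow> n \<ge> n0 \<Longrightarrow> nrm (C0 X) (s m \<ominus>\<^bsub>C0 X\<^esub> s n) < \<epsilon>"
      using C by blast
    show "\<exists>n0. \<forall>m\<ge>n0. \<forall>n\<ge>n0. dist (s m x) (s n x) < \<epsilon>"
      unfolding dist_norm by (intro exI[of _ n0] allI impI order_le_less_trans[OF up] n0)
  qed
  then have "\<forall>x. \<exists>l. (\<lambda>n. s n x) \<longlonglongrightarrow> l"
    by (simp add: Cauchy_convergent_iff convergent_def)
  then obtain l where l: "\<And>x. (\<lambda>n. s n x) \<longlonglongrightarrow> l x" by metis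
  \<comment> \<open>At each fixed x the Cauchy estimate passes to the limit in m, and n0 does not
    depend on x.\<close>
  have unif: "\<exists>n0. \<forall>n\<ge>n0. \<forall>x. cmod (s n x - l x) \<le> \<epsilon>" if e: "0 < \<epsilon>" for \<epsilon>
  proof -
    obtain n0 where n0: "\<And>m n. m \<ge> n0 \<Longrightarrow> n \<ge> n0 \<Longrightarrow> nrm (C0 X) (s m \<ominus>\<^bsub>C0 X\<^esub> s n) < \<epsilon>"
      using C e by blast
    have "cmod (s n x - l x) \<le> \<epsilon>" if "n \<ge> n0" for n x
    proof (rule LIMSEQ_le_const2)
      show "(\<lambda>m. cmod (s n x - s m x)) \<longlonglongrightarrow> cmod (s n x - l x)" by (intro tendsto_intros l)
      show "\<exists>k. \<forall>m\<ge>k. cmod (s n x - s m x) \<le> \<epsilon>"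
        using n0[OF that] up[of n x] by (meson less_imp_le order_trans)
    qed
    then show ?thesis by blast
  qed
  have lC: "l \<in> carrier (C0 X)"
  proof (rule C0_uniform_limit)
    show "l x = 0" if "x \<notin> topspace X" for x
      using l[of x] C0_outside[OF s that] by (simp add: LIMSEQ_const_iff)
    show "\<exists>g\<in>carrier (C0 X). \<forall>x. cmod (l x - g x) \<le> \<epsilon>" if "0 < \<epsilon>" for \<epsilon>
      using unif[OF that] s by (metis norm_minus_commute order_refl)
  qed
  have "(\<lambda>n. nrm (C0 X) (s n \<ominus>\<^bsub>C0 X\<^esub> l)) \<longlonglongrightarrow> 0"
  proof (rule LIMSEQ_I)
    fix \<epsilon> :: real assume "0 < \<epsilon>"
    then obtain n0 where n0: "\<And>n x. n \<ge> n0 \<Longrightarrow> cmod (s n x - l x) \<le> \<epsilon> / 2"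
      using unif[of "\<epsilon> / 2"] by auto
    have "norm (nrm (C0 X) (s n \<ominus>\<^bsub>C0 X\<^esub> l) - 0) < \<epsilon>" if "n \<ge> n0" for n
    proof -
      have "nrm (C0 X) (s n \<ominus>\<^bsub>C0 X\<^esub> l) \<le> \<epsilon> / 2"
        using n0[OF that] by (intro C0_norm_least) (simp add: C0_simps)
      moreover have "0 \<le> nrm (C0 X) (s n \<ominus>\<^bsub>C0 X\<^esub> l)"
        using C0_norm_nonneg[OF C0_add[OF s[of n] C0_scale[OF lC, of "- 1"]]] by (simp add: C0_simps)
      ultimately show ?thesis using \<open>0 < \<epsilon>\<close> by simp
    qed
    then show "\<exists>n0. \<forall>n\<ge>n0. norm (nrm (C0 X) (s n \<ominus>\<^bsub>C0 X\<^esub> l) - 0) < \<epsilon>" by blast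
  qed
  then show "\<exists>l\<in>carrier (C0 X). (\<lambda>n. nrm (C0 X) (s n \<ominus>\<^bsub>C0 X\<^esub> l)) \<longlonglongrightarrow> 0"
    using lC by blast
qed

lemma C0_norm_scale:
  assumes "f \<in> carrier (C0 X)"
  shows "nrm (C0 X) (\<lambda>x. c * f x) = cmod c * nrm (C0 X) f"
proof (rule antisym)
  show "nrm (C0 X) (\<lambda>x. c * f x) \<le> cmod c * nrm (C0 X) f"
    by (intro C0_norm_least) (simp add: norm_mult mult_left_mono C0_norm_upper assms)
  show "cmod c * nrm (C0 X) f \<le> nrm (C0 X) (\<lambda>x. c * f x)"
  proof (cases "c = 0")
    case False
    have "nrm (C0 X) f \<le> nrm (C0 X) (\<lambda>x. c * f x) / cmod c"
    proof (rule C0_norm_least)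
      fix x show "cmod (f x) \<le> nrm (C0 X) (\<lambda>x. c * f x) / cmod c"
        using C0_norm_upper[OF C0_scale[OF assms, of c], of x] False by (simp add: norm_mult field_simps)
    qed
    then show ?thesis using False by (simp add: field_simps)
  qed (simp add: C0_norm_nonneg[OF C0_zero])
qed

lemma C0_norm_star_mult:
  assumes "f \<in> carrier (C0 X)"
  shows "nrm (C0 X) (\<lambda>x. cnj (f x) * f x) = (nrm (C0 X) f)\<^sup>2"
proof (rule antisym)
  show "nrm (C0 X) (\<lambda>x. cnj (f x) * f x) \<le> (nrm (C0 X) f)\<^sup>2"
    by (rule C0_norm_least)
       (simp add: norm_mult power2_eq_square mult_mono C0_norm_upper C0_norm_nonneg assms)
  have m: "(\<lambda>x. cnj (f x) * f x) \<in> carrier (C0 X)" by (intro C0_mult C0_star assms)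
  have "nrm (C0 X) f \<le> sqrt (nrm (C0 X) (\<lambda>x. cnj (f x) * f x))"
    by (rule C0_norm_least)
       (use C0_norm_upper[OF m] in \<open>simp add: norm_mult real_le_rsqrt power2_eq_square\<close>)
  then show "(nrm (C0 X) f)\<^sup>2 \<le> nrm (C0 X) (\<lambda>x. cnj (f x) * f x)"
    using power_mono[OF _ C0_norm_nonneg[OF assms], of _ 2] C0_norm_nonneg[OF m] by fastforce
qed

lemma cstar_algebra_C0: "cstar_algebra (C0 X)"
proof unfold_locales
  fix f g :: "'a \<Rightarrow> complex" assume f: "f \<in> carrier (C0 X)"
  show "nrm (C0 X) f = 0 \<longleftrightarrow> f = \<zero>\<^bsub>C0 X\<^esub>" using f by (simp add: C0_simps C0_norm_eq_zero)
  show "nrm (C0 X) (star (C0 X) f \<otimes>\<^bsub>C0 X\<^esub> f) = (nrm (C0 X) f)\<^sup>2"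
    using f by (simp add: C0_simps C0_norm_star_mult)
  assume g: "g \<in> carrier (C0 X)"
  show "nrm (C0 X) (f \<oplus>\<^bsub>C0 X\<^esub> g) \<le> nrm (C0 X) f + nrm (C0 X) g"
    unfolding C0_simps
    by (rule C0_norm_least) (meson add_mono C0_norm_upper f g norm_triangle_ineq order_trans)
  show "nrm (C0 X) (f \<otimes>\<^bsub>C0 X\<^esub> g) \<le> nrm (C0 X) f * nrm (C0 X) g"
    unfolding C0_simps
    by (rule C0_norm_least) (simp add: norm_mult mult_mono C0_norm_upper C0_norm_nonneg f g)
qed (auto simp: C0_simps C0_zero C0_add C0_scale C0_mult C0_star C0_norm_scale algebra_simps
  intro: C0_complete)

subsection \<open>Fibre sums of branched functions\<close>

text \<open>The neighbourhoods in the definition of a branched function need not be open.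
  Intersecting with an open set inside V turns continuity between subspaces into a statement about
  open sets of Y.\<close>

lemma topcontinuous_at_near:
  assumes "topcontinuous_at (subtopology Y V) (subtopology X U) g y" "nhd Y y V"
    and "openin X N" "g y \<in> N"
  shows "\<exists>T. openin Y T \<and> y \<in> T \<and> T \<subseteq> V \<and> (\<forall>v\<in>T. g v \<in> N)"
proof -
  obtain W where W: "openin Y W" "y \<in> W" "W \<subseteq> V" using assms(2) by (auto simp: nhd_def)
  have "openin (subtopology X U) (N \<inter> U)" "g y \<in> N \<inter> U"
    using assms(1,3,4) by (auto simp: openin_subtopology topcontinuous_at_def)
  then obtain T where T: "openin (subtopology Y V) T" "y \<in> T" "\<forall>v\<in>T. g v \<in> N \<inter> U"
    using assms(1) unfolding topcontinuous_at_def by blast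
  then obtain T' where "openin Y T'" "T = T' \<inter> V" by (auto simp: openin_subtopology)
  then show ?thesis using W T by (intro exI[of _ "T' \<inter> W"]) auto
qed

locale branched_map =
  fixes X :: "'a topology" and Y :: "'b topology" and F :: "'a \<Rightarrow> 'b" and ind :: "'a \<Rightarrow> nat"
  assumes Hausdorff: "Hausdorff_space X" and branched: "branched X Y F ind"
begin

lemma F_continuous: "continuous_map X Y F"
  and ind_pos: "x \<in> topspace X \<Longrightarrow> 1 \<le> ind x"
  using branched by (auto simp: branched_def)

lemma F_closed: "x \<in> topspace X \<Longrightarrow> F x \<in> topspace Y"
  using continuous_map_image_subset_topspace[OF F_continuous] by auto

text \<open>Near x the fibre over y consists of the points G i y, and \<open>ind u\<close> counts
  the indices i with G i y = u. The weighted sum is therefore the sum of f (G i y) over i, with a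
  fixed number \<open>ind x\<close> of terms, each tending to f x. Continuity of the sections at the
  single point F x suffices.\<close>

lemma fibre_local_sum:
  assumes x: "x \<in> topspace X" and W: "openin X W" "x \<in> W"
  shows "\<exists>U\<subseteq>W. fibre X F (F x) \<inter> U = {x} \<and> (\<forall>\<^sub>F y in atin Y (F x). finite (fibre X F y \<inter> U)) \<and>
    (\<forall>f :: 'a \<Rightarrow> complex. continuous_map X euclidean f \<longrightarrow>
      ((\<lambda>y. \<Sum>u\<in>fibre X F y \<inter> U. of_nat (ind u) * f u) \<longlongrightarrow> of_nat (ind x) * f x) (atin Y (F x)))"
proof -
  let ?I = "{1..ind x}"
  obtain U V G where UV: "nhd X x U" "nhd Y (F x) V"
    and G': "\<forall>i\<in>?I. \<forall>v\<in>V. G i v \<in> U \<and> F (G i v) = v"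
    and Gx': "\<forall>i\<in>?I. G i (F x) = x \<and>
        topcontinuous_at (subtopology Y V) (subtopology X U) (G i) (F x)"
    and card': "\<forall>u\<in>U. ind u = card {i\<in>?I. u \<in> G i ` V}"
    using branched x unfolding branched_def by blast
  note G = G'[rule_format] and Gx = Gx'[rule_format, THEN conjunct1]
    and Gcont = Gx'[rule_format, THEN conjunct2] and card = card'[rule_format]
  have UX: "U \<subseteq> topspace X" using UV(1) by (simp add: nhd_def)
  have I0: "finite ?I" "?I \<noteq> {}" using ind_pos[OF x] by auto
  have near: "\<exists>T. openin Y T \<and> F x \<in> T \<and> T \<subseteq> V \<and> (\<forall>v\<in>T. G i v \<in> N)"
    if i: "i \<in> ?I" and N: "openin X N" "x \<in> N" for i N
    using topcontinuous_at_near[OF Gcont[OF i] UV(2) N(1)] N(2) Gx[OF i] by simp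
  \<comment> \<open>Over T i the section G i lands in the prescribed open set W.\<close>
  obtain T where T: "\<And>i. i \<in> ?I \<Longrightarrow> openin Y (T i) \<and> F x \<in> T i \<and> T i \<subseteq> V \<and> (\<forall>v\<in>T i. G i v \<in> W)"
    using near[OF _ W] by metis
  define V0 where "V0 = (\<Inter>i\<in>?I. T i)"
  obtain i0 where i0: "i0 \<in> ?I" using I0(2) by blast
  have V0: "openin Y V0" "F x \<in> V0" "V0 \<subseteq> V"
    using T I0 T[OF i0] i0 unfolding V0_def by (blast intro!: openin_INT2)+
  define U0 where "U0 = (\<Union>i\<in>?I. G i ` V0)"
  have fib: "fibre X F y \<inter> U0 = (\<lambda>i. G i y) ` ?I" if "y \<in> V0" for y
    using that V0(3) G UX by (force simp: fibre_def U0_def)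
  have ind_eq: "ind u = card {i\<in>?I. G i y = u}" if "u \<in> fibre X F y \<inter> U0" "y \<in> V0" for u y
  proof -
    have u: "u \<in> U" "F u = y" using that G V0(3) by (auto simp: fib[OF that(2)])
    \<comment> \<open>If u = G i v then v = F u = y, so the sections through u are those with value
      u at y.\<close>
    have "{i\<in>?I. u \<in> G i ` V} = {i\<in>?I. G i y = u}"
      using u(2) that(2) V0(3) G by force
    then show ?thesis using card[OF u(1)] by simp
  qed
  have sum_eq: "(\<Sum>u\<in>fibre X F y \<inter> U0. of_nat (ind u) * f u) = (\<Sum>i\<in>?I. f (G i y))"
    if y: "y \<in> V0" for y and f :: "'a \<Rightarrow> complex"
  proof -
    have "(\<Sum>i\<in>?I. f (G i y)) = (\<Sum>u\<in>(\<lambda>i. G i y) ` ?I. \<Sum>i\<in>{i\<in>?I. G i y = u}. f (G i y))"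
      by (rule sum.image_gen) simp
    also have "\<dots> = (\<Sum>u\<in>(\<lambda>i. G i y) ` ?I. of_nat (ind u) * f u)"
    proof (rule sum.cong[OF refl])
      fix u assume "u \<in> (\<lambda>i. G i y) ` ?I"
      then have "ind u = card {i\<in>?I. G i y = u}" using ind_eq[OF _ y, of u] fib[OF y] by simp
      moreover have "(\<Sum>i\<in>{i\<in>?I. G i y = u}. f (G i y)) = (\<Sum>i\<in>{i\<in>?I. G i y = u}. f u)"
        by (rule sum.cong) auto
      ultimately show "(\<Sum>i\<in>{i\<in>?I. G i y = u}. f (G i y)) = of_nat (ind u) * f u" by simp
    qed
    finally show ?thesis by (simp add: fib[OF y])
  qed
  have ev: "\<forall>\<^sub>F y in atin Y (F x). y \<in> V0"
    using V0 unfolding eventually_atin by blast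
  show ?thesis
  proof (intro exI[of _ U0] conjI allI impI)
    show "U0 \<subseteq> W" using T unfolding U0_def V0_def by blast
    show "fibre X F (F x) \<inter> U0 = {x}" using fib[OF V0(2)] Gx I0 by auto
    show "\<forall>\<^sub>F y in atin Y (F x). finite (fibre X F y \<inter> U0)"
      using ev by eventually_elim (simp add: fib)
    fix f :: "'a \<Rightarrow> complex" assume f: "continuous_map X euclidean f"
    have "((\<lambda>y. f (G i y)) \<longlongrightarrow> f x) (atin Y (F x))" if i: "i \<in> ?I" for i
    proof (rule topological_tendstoI)
      fix S assume S: "open S" "f x \<in> S"
      have "openin X {u \<in> topspace X. f u \<in> S}"
        using openin_continuous_map_preimage[OF f] S by simp
      from near[OF i this] obtain T where "openin Y T" "F x \<in> T" "\<forall>v\<in>T. f (G i v) \<in> S"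
        using x S by auto
      then show "\<forall>\<^sub>F y in atin Y (F x). f (G i y) \<in> S" unfolding eventually_atin by blast
    qed
    then have "((\<lambda>y. \<Sum>i\<in>?I. f (G i y)) \<longlongrightarrow> (\<Sum>i\<in>?I. f x)) (atin Y (F x))"
      by (rule tendsto_sum)
    moreover have "\<forall>\<^sub>F y in atin Y (F x).
        (\<Sum>i\<in>?I. f (G i y)) = (\<Sum>u\<in>fibre X F y \<inter> U0. of_nat (ind u) * f u)"
      using ev by eventually_elim (simp add: sum_eq)
    ultimately show "((\<lambda>y. \<Sum>u\<in>fibre X F y \<inter> U0. of_nat (ind u) * f u) \<longlongrightarrow> of_nat (ind x) * f x)
        (atin Y (F x))"
      by (simp add: tendsto_cong)
  qed
qed

text \<open>Induction on B: the Hausdorff property separates the new point from the rest by disjoint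
  open sets, and the ambient W confines the local pieces to them, so their sums add. Finiteness of
  the nearby fibre parts is carried along because a sum over an infinite set is 0 by
  convention.\<close>

lemma fibre_finite_sum:
  assumes "finite B" "B \<subseteq> fibre X F y0" "openin X W" "B \<subseteq> W"
  shows "\<exists>U\<subseteq>W. fibre X F y0 \<inter> U = B \<and> (\<forall>\<^sub>F y in atin Y y0. finite (fibre X F y \<inter> U)) \<and>
    (\<forall>f :: 'a \<Rightarrow> complex. continuous_map X euclidean f \<longrightarrow>
      ((\<lambda>y. \<Sum>u\<in>fibre X F y \<inter> U. of_nat (ind u) * f u) \<longlongrightarrow> (\<Sum>u\<in>B. of_nat (ind u) * f u)) (atin Y y0))"
  using assms
proof (induction B arbitrary: W rule: finite_induct)
  case empty
  then show ?case by (intro exI[of _ "{}"]) auto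
next
  case (insert x B)
  have x: "x \<in> topspace X" "F x = y0" and BX: "B \<subseteq> topspace X"
    using insert.prems(1) by (auto simp: fibre_def)
  obtain O1 O2 where O: "openin X O1" "openin X O2" "{x} \<subseteq> O1" "B \<subseteq> O2" "disjnt O1 O2"
    using Hausdorff_space_compact_separation[OF Hausdorff, of "{x}" B] x BX insert.hyps
    by (auto simp: finite_imp_compactin)
  have "openin X (O1 \<inter> W)" "x \<in> O1 \<inter> W" "openin X (O2 \<inter> W)" "B \<subseteq> O2 \<inter> W"
    using O insert.prems by (auto intro: openin_Int)
  note W = this
  obtain U1 where U1: "U1 \<subseteq> O1 \<inter> W" "fibre X F y0 \<inter> U1 = {x}"
    "\<forall>\<^sub>F y in atin Y y0. finite (fibre X F y \<inter> U1)"
    and l1: "\<And>f :: 'a \<Rightarrow> complex. continuous_map X euclidean f \<Longrightarrow>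
      ((\<lambda>y. \<Sum>u\<in>fibre X F y \<inter> U1. of_nat (ind u) * f u) \<longlongrightarrow> of_nat (ind x) * f x) (atin Y y0)"
    using fibre_local_sum[OF x(1) W(1,2)] unfolding x(2) by blast
  obtain U2 where U2: "U2 \<subseteq> O2 \<inter> W" "fibre X F y0 \<inter> U2 = B"
    "\<forall>\<^sub>F y in atin Y y0. finite (fibre X F y \<inter> U2)"
    and l2: "\<And>f :: 'a \<Rightarrow> complex. continuous_map X euclidean f \<Longrightarrow>
      ((\<lambda>y. \<Sum>u\<in>fibre X F y \<inter> U2. of_nat (ind u) * f u) \<longlongrightarrow> (\<Sum>u\<in>B. of_nat (ind u) * f u)) (atin Y y0)"
    using insert.IH[OF _ W(3,4)] insert.prems(1) by blast
  show ?case
  proof (intro exI[of _ "U1 \<union> U2"] conjI allI impI)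
    show "U1 \<union> U2 \<subseteq> W" "fibre X F y0 \<inter> (U1 \<union> U2) = insert x B" using U1 U2 by auto
    show "\<forall>\<^sub>F y in atin Y y0. finite (fibre X F y \<inter> (U1 \<union> U2))"
      using U1(3) U2(3) by eventually_elim (simp add: Int_Un_distrib)
    fix f :: "'a \<Rightarrow> complex" assume f: "continuous_map X euclidean f"
    have "\<forall>\<^sub>F y in atin Y y0. (\<Sum>u\<in>fibre X F y \<inter> U1. of_nat (ind u) * f u)
        + (\<Sum>u\<in>fibre X F y \<inter> U2. of_nat (ind u) * f u)
        = (\<Sum>u\<in>fibre X F y \<inter> (U1 \<union> U2). of_nat (ind u) * f u)"
      using U1(3) U2(3)
    proof eventually_elim
      case (elim y)
      have "fibre X F y \<inter> U1 \<inter> (fibre X F y \<inter> U2) = {}" using U1(1) U2(1) O(5) by (auto simp: disjnt_iff)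
      then show ?case using elim by (simp add: Int_Un_distrib sum.union_disjoint)
    qed
    then show "((\<lambda>y. \<Sum>u\<in>fibre X F y \<inter> (U1 \<union> U2). of_nat (ind u) * f u)
        \<longlongrightarrow> (\<Sum>u\<in>insert x B. of_nat (ind u) * f u)) (atin Y y0)"
      using tendsto_add[OF l1[OF f] l2[OF f]] insert.hyps by (simp add: tendsto_cong)
  qed
qed

text \<open>Off Y the fibre is empty and the infinite sum is 0 anyway, so the case distinction
  disappears.\<close>

lemma Phi_eq: "Phi X Y F ind f y = (\<Sum>\<^sub>\<infinity>x\<in>fibre X F y. of_nat (ind x) * f x)"
proof (cases "y \<in> topspace Y")
  case False
  then have "fibre X F y = {}" using F_closed by (auto simp: fibre_def)
  then show ?thesis using False by (simp add: Phi_def)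
qed (simp add: Phi_def)

section \<open>Real fibre sums and dominated convergence\<close>

definition fibre_sum :: "('a \<Rightarrow> real) \<Rightarrow> 'b \<Rightarrow> real"
  where "fibre_sum h y = (\<Sum>\<^sub>\<infinity>x\<in>fibre X F y. real (ind x) * h x)"

definition fibre_summable :: "('a \<Rightarrow> real) \<Rightarrow> bool"
  where "fibre_summable h \<longleftrightarrow> (\<forall>y. (\<lambda>x. real (ind x) * h x) summable_on fibre X F y)"

lemma Phi_of_real:
  assumes "fibre_summable h"
  shows "Phi X Y F ind (\<lambda>x. complex_of_real (h x)) = (\<lambda>y. complex_of_real (fibre_sum h y))"
proof
  fix y
  have "((\<lambda>x. real (ind x) * h x) has_sum fibre_sum h y) (fibre X F y)"
    using assms unfolding fibre_sum_def fibre_summable_def by (intro has_sum_infsum) blast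
  from has_sum_of_real[OF this, where ?'a = complex]
  show "Phi X Y F ind (\<lambda>x. complex_of_real (h x)) y = complex_of_real (fibre_sum h y)"
    unfolding Phi_eq by (intro infsumI) simp
qed

lemma summable_dominated:
  assumes "fibre_summable h" "\<And>x. x \<in> topspace X \<Longrightarrow> cmod (f x) \<le> h x"
  shows "(\<lambda>x. of_nat (ind x) * f x) summable_on fibre X F y"
proof (rule Infinite_Sum.abs_summable_summable[OF Infinite_Sum.abs_summable_on_comparison_test'])
  show "(\<lambda>x. real (ind x) * h x) summable_on fibre X F y"
    using assms(1) by (simp add: fibre_summable_def)
qed (use assms(2) in \<open>auto simp: norm_mult fibre_def mult_left_mono\<close>)

lemma fibre_summable_mono:
  assumes "fibre_summable h" "\<And>x. x \<in> topspace X \<Longrightarrow> 0 \<le> h' x \<and> h' x \<le> h x"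
  shows "fibre_summable h'"
  unfolding fibre_summable_def
proof
  fix y show "(\<lambda>x. real (ind x) * h' x) summable_on fibre X F y"
    by (rule summable_on_comparison_test[of "\<lambda>x. real (ind x) * h x"])
      (use assms in \<open>auto simp: fibre_summable_def fibre_def mult_left_mono\<close>)
qed

lemma fibre_summable_add:
  "\<lbrakk>fibre_summable h; fibre_summable h'\<rbrakk> \<Longrightarrow> fibre_summable (\<lambda>x. h x + h' x)"
  by (simp add: fibre_summable_def distrib_left summable_on_add)

lemma fibre_summable_cmult: "fibre_summable h \<Longrightarrow> fibre_summable (\<lambda>x. c * h x)"
  unfolding fibre_summable_def mult.left_commute[of _ c] by (intro allI summable_on_cmult_right) blast

lemma fibre_sum_add:
  "\<lbrakk>fibre_summable h; fibre_summable h'\<rbrakk> \<Longrightarrow> fibre_sum (\<lambda>x. h x + h' x) y = fibre_sum h y + fibre_sum h' y"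
  by (simp add: fibre_sum_def fibre_summable_def distrib_left infsum_add)

lemma fibre_sum_cmult:
  "fibre_sum (\<lambda>x. c * h x) y = c * fibre_sum h y"
  unfolding fibre_sum_def mult.left_commute[of _ c] by (rule infsum_cmult_right')

lemma fibre_sum_upper:
  assumes "fibre_summable h" "\<And>x. x \<in> topspace X \<Longrightarrow> 0 \<le> h x" "finite B" "B \<subseteq> fibre X F y"
  shows "(\<Sum>x\<in>B. real (ind x) * h x) \<le> fibre_sum h y"
  unfolding fibre_sum_def using assms
  by (intro finite_sum_le_infsum) (auto simp: fibre_summable_def fibre_def)

lemma fibre_sum_least:
  assumes "fibre_summable h"
    and "\<And>B. \<lbrakk>finite B; B \<subseteq> fibre X F y\<rbrakk> \<Longrightarrow> (\<Sum>x\<in>B. real (ind x) * h x) \<le> c"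
  shows "fibre_sum h y \<le> c"
  unfolding fibre_sum_def using assms by (intro infsum_le_finite_sums) (auto simp: fibre_summable_def)

lemma fibre_summable_bounded:
  assumes "\<And>x. x \<in> topspace X \<Longrightarrow> 0 \<le> h x"
    and "\<And>B y. \<lbrakk>finite B; B \<subseteq> fibre X F y\<rbrakk> \<Longrightarrow> (\<Sum>x\<in>B. real (ind x) * h x) \<le> c"
  shows "fibre_summable h"
  unfolding fibre_summable_def
  by (intro allI nonneg_bdd_above_summable_on bdd_aboveI2[of _ _ c])
     (use assms in \<open>auto simp: fibre_def\<close>)

text \<open>The part of the sum of f outside D is dominated by the part of the sum of h outside D.
  Empty D gives the plain norm bound; a large finite D gives the approximations behind the limit
  arguments.\<close>

lemma Phi_residual:
  assumes "fibre_summable h" "\<And>x. x \<in> topspace X \<Longrightarrow> cmod (f x) \<le> h x"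
    and D: "finite D" "D \<subseteq> fibre X F y"
  shows "cmod (Phi X Y F ind f y - (\<Sum>x\<in>D. of_nat (ind x) * f x))
    \<le> fibre_sum h y - (\<Sum>x\<in>D. real (ind x) * h x)"
proof -
  have h: "(\<lambda>x. real (ind x) * h x) summable_on fibre X F y"
    using assms(1) by (simp add: fibre_summable_def)
  have f: "(\<lambda>x. of_nat (ind x) * f x) summable_on fibre X F y"
    by (rule summable_dominated[OF assms(1,2)])
  have rest: "infsum g (fibre X F y) - sum g D = infsum g (fibre X F y - D)"
    if "g summable_on fibre X F y" for g :: "'a \<Rightarrow> 'c::banach"
    using infsum_Diff[OF that summable_on_finite[OF D(1)] D(2)] D(1) by simp
  show ?thesis
    unfolding Phi_eq fibre_sum_def rest[OF f] rest[OF h]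
  proof (rule norm_infsum_le)
    have "(\<lambda>x. real (ind x) * h x) summable_on fibre X F y - D"
      "(\<lambda>x. of_nat (ind x) * f x) summable_on fibre X F y - D"
      using h f summable_on_subset_banach by blast+
    then show "((\<lambda>x. of_nat (ind x) * f x) has_sum
        (\<Sum>\<^sub>\<infinity>x\<in>fibre X F y - D. of_nat (ind x) * f x)) (fibre X F y - D)"
      "((\<lambda>x. real (ind x) * h x) has_sum
        (\<Sum>\<^sub>\<infinity>x\<in>fibre X F y - D. real (ind x) * h x)) (fibre X F y - D)"
      by simp_all
  qed (use assms(2) in \<open>auto simp: norm_mult fibre_def mult_left_mono\<close>)
qed

lemma Phi_norm_le:
  assumes "fibre_summable h" "\<And>x. x \<in> topspace X \<Longrightarrow> cmod (f x) \<le> h x"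
  shows "cmod (Phi X Y F ind f y) \<le> fibre_sum h y"
  using Phi_residual[OF assms, of "{}" y] by simp

text \<open>The integrable majorants of dominated convergence. A function of \<open>C0 X\<close> is
  in the module exactly when its squared modulus is one, so closure of the module under operations
  reduces to finding majorants.\<close>

definition dominator :: "('a \<Rightarrow> real) \<Rightarrow> bool"
  where "dominator h \<longleftrightarrow> continuous_map X euclideanreal h \<and> (\<forall>x\<in>topspace X. 0 \<le> h x) \<and>
    fibre_summable h \<and> Phi X Y F ind (\<lambda>x. complex_of_real (h x)) \<in> carrier (C0 Y)"

lemma dominator_summable: "dominator h \<Longrightarrow> fibre_summable h"
  by (simp add: dominator_def)

text \<open>Outside finitely many points of the fibre over \<open>y0\<close> the sum of \<open>h\<close> is small, and it stays
  small over nearby points because \<open>\<Phi>(h)\<close> and the finite part are both continuous at \<open>y0\<close>.\<close>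

theorem Phi_dominated:
  assumes h: "dominator h" and f: "continuous_map X euclidean f"
    and le: "\<And>x. x \<in> topspace X \<Longrightarrow> cmod (f x) \<le> h x"
  shows "Phi X Y F ind f \<in> carrier (C0 Y)"
proof (rule C0_dominated)
  note hs = dominator_summable[OF h]
  have h0: "0 \<le> h x" if "x \<in> topspace X" for x using h that by (simp add: dominator_def)
  let ?h = "\<lambda>x. complex_of_real (h x)"
  show "Phi X Y F ind ?h \<in> carrier (C0 Y)" using h by (simp add: dominator_def)
  note cont = C0_continuous[OF this]
  show "cmod (Phi X Y F ind f y) \<le> 1 * cmod (Phi X Y F ind ?h y)" for y
    using Phi_norm_le[OF hs le, of y] by (simp add: Phi_of_real[OF hs])
  have hcont: "continuous_map X euclidean ?h"
    using h by (auto simp: dominator_def continuous_map_tendsto intro: tendsto_of_real)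
  show "continuous_map Y euclidean (Phi X Y F ind f)"
    unfolding continuous_map_tendsto
  proof (intro ballI tendstoI)
    fix y0 and \<epsilon> :: real assume y0: "y0 \<in> topspace Y" and e: "0 < \<epsilon>"
    have "(\<lambda>x. real (ind x) * h x) summable_on fibre X F y0" using hs by (simp add: fibre_summable_def)
    \<comment> \<open>Budget: \<epsilon>/4 for the rest of the sum at y0, \<epsilon>/4 for the
      change of the finite part, and \<epsilon>/2 for the rest at nearby y, whose limit is at most
      \<epsilon>/4.\<close>
    from infsum_finite_approximation[OF this, of "\<epsilon> / 4"] e
    obtain B where B: "finite B" "B \<subseteq> fibre X F y0"
      and Bsum: "\<bar>(\<Sum>x\<in>B. real (ind x) * h x) - fibre_sum h y0\<bar> \<le> \<epsilon> / 4"
      by (auto simp: dist_real_def fibre_sum_def)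
    obtain U where U: "\<forall>\<^sub>F y in atin Y y0. finite (fibre X F y \<inter> U)"
      and lim: "\<And>f :: 'a \<Rightarrow> complex. continuous_map X euclidean f \<Longrightarrow>
        ((\<lambda>y. \<Sum>u\<in>fibre X F y \<inter> U. of_nat (ind u) * f u) \<longlongrightarrow> (\<Sum>u\<in>B. of_nat (ind u) * f u)) (atin Y y0)"
      using fibre_finite_sum[OF B openin_topspace] B(2) by (auto simp: fibre_def)
    let ?s = "\<lambda>y. \<Sum>u\<in>fibre X F y \<inter> U. real (ind u) * h u" and ?b = "\<Sum>u\<in>B. real (ind u) * h u"
    have "((\<lambda>y. complex_of_real (?s y)) \<longlongrightarrow> complex_of_real ?b) (atin Y y0)"
      using lim[OF hcont] by simp
    then have s: "(?s \<longlongrightarrow> ?b) (atin Y y0)" by (simp only: tendsto_of_real_iff)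
    have "((\<lambda>y. complex_of_real (fibre_sum h y)) \<longlongrightarrow> complex_of_real (fibre_sum h y0)) (atin Y y0)"
      using cont y0 by (simp add: continuous_map_tendsto Phi_of_real[OF hs])
    then have H: "(fibre_sum h \<longlongrightarrow> fibre_sum h y0) (atin Y y0)" by (simp only: tendsto_of_real_iff)
    have res: "cmod (Phi X Y F ind f y0 - (\<Sum>x\<in>B. of_nat (ind x) * f x)) \<le> \<epsilon> / 4"
      using Phi_residual[OF hs le B] Bsum by linarith
    have "fibre_sum h y0 - ?b < \<epsilon> / 2" using Bsum e by linarith
    then have "\<forall>\<^sub>F y in atin Y y0. fibre_sum h y - ?s y < \<epsilon> / 2"
      by (rule order_tendstoD(2)[OF tendsto_diff[OF H s]])
    moreover have "\<forall>\<^sub>F y in atin Y y0. dist (\<Sum>u\<in>fibre X F y \<inter> U. of_nat (ind u) * f u)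
        (\<Sum>u\<in>B. of_nat (ind u) * f u) < \<epsilon> / 4"
      using tendstoD[OF lim[OF f], of "\<epsilon> / 4"] e by simp
    ultimately show "\<forall>\<^sub>F y in atin Y y0. dist (Phi X Y F ind f y) (Phi X Y F ind f y0) < \<epsilon>"
      using U
    proof eventually_elim
      case (elim y)
      let ?S = "\<Sum>u\<in>fibre X F y \<inter> U. of_nat (ind u) * f u" and ?B = "\<Sum>u\<in>B. of_nat (ind u) * f u"
      have "cmod (Phi X Y F ind f y - ?S) \<le> fibre_sum h y - ?s y"
        using elim by (intro Phi_residual[OF hs le]) auto
      moreover have "dist (Phi X Y F ind f y) (Phi X Y F ind f y0)
          \<le> cmod (Phi X Y F ind f y - ?S) + cmod (?S - ?B) + cmod (Phi X Y F ind f y0 - ?B)"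
        using dist_triangle[of "Phi X Y F ind f y" "Phi X Y F ind f y0" ?S]
          dist_triangle[of ?S "Phi X Y F ind f y0" ?B] by (simp add: dist_norm norm_minus_commute)
      ultimately show ?case using elim res by (simp add: dist_norm)
    qed
  qed
  show "Phi X Y F ind f y = 0" if "y \<notin> topspace Y" for y using that by (simp add: Phi_def)
qed

text \<open>That the fibre sum of the smaller function is again in \<open>C0 Y\<close> is the
  preceding theorem; monotonicity of the sums alone would not give continuity.\<close>

lemma dominator_mono:
  assumes "dominator h" "continuous_map X euclideanreal h'"
    and "\<And>x. x \<in> topspace X \<Longrightarrow> 0 \<le> h' x \<and> h' x \<le> h x"
  shows "dominator h'"
  unfolding dominator_def
proof (intro conjI)
  show "fibre_summable h'" by (rule fibre_summable_mono[OF dominator_summable[OF assms(1)] assms(3)])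
  show "Phi X Y F ind (\<lambda>x. complex_of_real (h' x)) \<in> carrier (C0 Y)"
    using assms by (intro Phi_dominated[OF assms(1)])
      (auto simp: continuous_map_tendsto intro: tendsto_of_real)
qed (use assms in auto)

lemma dominator_add:
  assumes "dominator h" "dominator h'"
  shows "dominator (\<lambda>x. h x + h' x)"
  unfolding dominator_def
proof (intro conjI)
  note s = assms[THEN dominator_summable]
  show "fibre_summable (\<lambda>x. h x + h' x)" by (rule fibre_summable_add[OF s])
  have "Phi X Y F ind (\<lambda>x. complex_of_real (h x + h' x))
      = (\<lambda>y. Phi X Y F ind (\<lambda>x. complex_of_real (h x)) y + Phi X Y F ind (\<lambda>x. complex_of_real (h' x)) y)"
    unfolding Phi_of_real[OF fibre_summable_add[OF s]] Phi_of_real[OF s(1)] Phi_of_real[OF s(2)]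
    by (simp add: fibre_sum_add[OF s])
  then show "Phi X Y F ind (\<lambda>x. complex_of_real (h x + h' x)) \<in> carrier (C0 Y)"
    using assms by (simp add: dominator_def C0_add)
qed (use assms in \<open>auto simp: dominator_def intro: continuous_map_add\<close>)

lemma dominator_cmult:
  assumes "dominator h" "0 \<le> c"
  shows "dominator (\<lambda>x. c * h x)"
  unfolding dominator_def
proof (intro conjI)
  note s = dominator_summable[OF assms(1)]
  show "fibre_summable (\<lambda>x. c * h x)" by (rule fibre_summable_cmult[OF s])
  have "Phi X Y F ind (\<lambda>x. complex_of_real (c * h x))
      = (\<lambda>y. complex_of_real c * Phi X Y F ind (\<lambda>x. complex_of_real (h x)) y)"
    unfolding Phi_of_real[OF fibre_summable_cmult[OF s]] Phi_of_real[OF s]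
    by (simp add: fibre_sum_cmult)
  then show "Phi X Y F ind (\<lambda>x. complex_of_real (c * h x)) \<in> carrier (C0 Y)"
    using assms by (simp add: dominator_def C0_scale)
qed (use assms in \<open>auto simp: dominator_def intro: continuous_map_real_mult_left\<close>)

subsection \<open>The correspondence of a branched function\<close>

abbreviation (input) "M \<equiv> branched_module_carrier X Y F ind"

lemma continuous_map_cmod_square:
  "continuous_map X euclidean \<psi> \<Longrightarrow> continuous_map X euclideanreal (\<lambda>x. (cmod (\<psi> x))\<^sup>2)"
  by (auto simp: continuous_map_tendsto intro!: tendsto_intros)

lemma module_iff: "\<psi> \<in> M \<longleftrightarrow> \<psi> \<in> carrier (C0 X) \<and> dominator (\<lambda>x. (cmod (\<psi> x))\<^sup>2)"
proof -
  have "fibre X F y = {}" if "y \<notin> topspace Y" for y using that F_closed by (auto simp: fibre_def)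
  then have "(\<forall>y\<in>topspace Y. g summable_on fibre X F y) \<longleftrightarrow> (\<forall>y. g summable_on fibre X F y)"
    for g :: "'a \<Rightarrow> real"
    by (metis summable_on_empty)
  then show ?thesis
    by (auto simp: branched_module_carrier_def dominator_def fibre_summable_def
        intro: continuous_map_cmod_square C0_continuous)
qed

lemma module_C0: "\<psi> \<in> M \<Longrightarrow> \<psi> \<in> carrier (C0 X)"
  and module_dominator: "\<psi> \<in> M \<Longrightarrow> dominator (\<lambda>x. (cmod (\<psi> x))\<^sup>2)"
  by (simp_all add: module_iff)

lemmas module_summable = dominator_summable[OF module_dominator]

lemma module_dominated:
  assumes "\<psi> \<in> carrier (C0 X)" "dominator h" "\<And>x. x \<in> topspace X \<Longrightarrow> (cmod (\<psi> x))\<^sup>2 \<le> h x"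
  shows "\<psi> \<in> M"
  unfolding module_iff
  using assms(3) by (intro conjI assms(1) dominator_mono[OF assms(2)] continuous_map_cmod_square
      C0_continuous[OF assms(1)]) auto

lemma module_add:
  assumes "\<psi> \<in> M" "\<phi> \<in> M"
  shows "(\<lambda>x. \<psi> x + \<phi> x) \<in> M"
proof (rule module_dominated)
  show "(\<lambda>x. \<psi> x + \<phi> x) \<in> carrier (C0 X)" using assms by (intro C0_add module_C0)
  show "dominator (\<lambda>x. 2 * (cmod (\<psi> x))\<^sup>2 + 2 * (cmod (\<phi> x))\<^sup>2)"
    using assms by (intro dominator_add dominator_cmult module_dominator) auto
  show "(cmod (\<psi> x + \<phi> x))\<^sup>2 \<le> 2 * (cmod (\<psi> x))\<^sup>2 + 2 * (cmod (\<phi> x))\<^sup>2" for x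
  proof -
    have "(cmod (\<psi> x + \<phi> x))\<^sup>2 \<le> (cmod (\<psi> x) + cmod (\<phi> x))\<^sup>2"
      by (intro power_mono norm_triangle_ineq) auto
    also have "\<dots> \<le> 2 * (cmod (\<psi> x))\<^sup>2 + 2 * (cmod (\<phi> x))\<^sup>2"
      using sum_squares_bound[of "cmod (\<psi> x)" "cmod (\<phi> x)"] by (simp add: power2_sum)
    finally show ?thesis .
  qed
qed

text \<open>Stated for bounded continuous multipliers because it must cover the right action, where
  the multiplier g o F is bounded but need not vanish at infinity, as well as scalars and the left
  action.\<close>

lemma module_mult_bounded:
  assumes "continuous_map X euclidean f" "\<psi> \<in> M" "\<And>x. x \<in> topspace X \<Longrightarrow> cmod (f x) \<le> c"
  shows "(\<lambda>x. f x * \<psi> x) \<in> M"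
proof (rule module_dominated)
  show "(\<lambda>x. f x * \<psi> x) \<in> carrier (C0 X)"
    using assms by (intro C0_mult_bounded module_C0)
  show "dominator (\<lambda>x. c\<^sup>2 * (cmod (\<psi> x))\<^sup>2)"
    using assms by (intro dominator_cmult module_dominator) auto
  show "(cmod (f x * \<psi> x))\<^sup>2 \<le> c\<^sup>2 * (cmod (\<psi> x))\<^sup>2" if "x \<in> topspace X" for x
    using assms(3)[OF that] by (simp add: norm_mult power_mult_distrib mult_right_mono power_mono)
qed

lemma module_lact: "\<lbrakk>f \<in> carrier (C0 X); \<psi> \<in> M\<rbrakk> \<Longrightarrow> (\<lambda>x. f x * \<psi> x) \<in> M"
  by (rule module_mult_bounded[OF C0_continuous _ C0_norm_upper])

lemma module_scale: "\<psi> \<in> M \<Longrightarrow> (\<lambda>x. c * \<psi> x) \<in> M"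
  by (rule module_mult_bounded[of "\<lambda>_. c" \<psi> "cmod c"]) auto

lemma module_diff: "\<lbrakk>\<psi> \<in> M; \<phi> \<in> M\<rbrakk> \<Longrightarrow> (\<lambda>x. \<psi> x - \<phi> x) \<in> M"
  using module_add[OF _ module_scale[of \<phi> "- 1"]] by simp

lemma module_ract:
  assumes "\<psi> \<in> M" "g \<in> carrier (C0 Y)"
  shows "(\<lambda>x. \<psi> x * g (F x)) \<in> M"
  using module_mult_bounded[OF _ assms(1), of "g \<circ> F"] C0_norm_upper[OF assms(2)]
    continuous_map_compose[OF F_continuous C0_continuous[OF assms(2)]]
  by (auto simp: mult.commute)

lemma module_zero: "(\<lambda>x. 0) \<in> M"
proof -
  have "Phi X Y F ind (\<lambda>x. 0) = (\<lambda>y. 0)" by (rule ext) (simp add: Phi_eq)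
  then show ?thesis
    by (simp add: module_iff C0_zero dominator_def fibre_summable_def)
qed

lemma ip_dominator:
  assumes "\<psi> \<in> M" "\<phi> \<in> M"
  shows "dominator (\<lambda>x. (cmod (\<psi> x))\<^sup>2 + (cmod (\<phi> x))\<^sup>2)"
    and "cmod (cnj (\<psi> x) * \<phi> x) \<le> (cmod (\<psi> x))\<^sup>2 + (cmod (\<phi> x))\<^sup>2"
proof -
  have "2 * (cmod (\<psi> x) * cmod (\<phi> x)) \<le> (cmod (\<psi> x))\<^sup>2 + (cmod (\<phi> x))\<^sup>2"
    using sum_squares_bound[of "cmod (\<psi> x)" "cmod (\<phi> x)"] by simp
  moreover have "0 \<le> cmod (\<psi> x) * cmod (\<phi> x)" by simp
  ultimately show "cmod (cnj (\<psi> x) * \<phi> x) \<le> (cmod (\<psi> x))\<^sup>2 + (cmod (\<phi> x))\<^sup>2"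
    by (simp only: norm_mult complex_mod_cnj)
qed (intro dominator_add module_dominator assms)

lemma ip_closed_C0:
  assumes "\<psi> \<in> M" "\<phi> \<in> M"
  shows "Phi X Y F ind (\<lambda>x. cnj (\<psi> x) * \<phi> x) \<in> carrier (C0 Y)"
proof (rule Phi_dominated[OF ip_dominator(1)[OF assms] _ ip_dominator(2)[OF assms]])
  show "continuous_map X euclidean (\<lambda>x. cnj (\<psi> x) * \<phi> x)"
    using assms[THEN module_C0, THEN C0_continuous]
    by (auto simp: continuous_map_tendsto intro!: tendsto_intros)
qed

lemma ip_summable:
  assumes "\<psi> \<in> M" "\<phi> \<in> M"
  shows "(\<lambda>x. of_nat (ind x) * (cnj (\<psi> x) * \<phi> x)) summable_on fibre X F y"
  by (rule summable_dominated[OF dominator_summable[OF ip_dominator(1)[OF assms]] ip_dominator(2)[OF assms]])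

section \<open>The module norm as a supremum of finite fibre sums\<close>

abbreviation (input) "E \<equiv> branched_corr X Y F ind"
abbreviation (input) "sq \<psi> \<equiv> fibre_sum (\<lambda>x. (cmod (\<psi> x))\<^sup>2)"

lemma corr_simps:
  "carrier E = M" "zero E = (\<lambda>x. 0)" "\<psi> \<oplus>\<^bsub>E\<^esub> \<phi> = (\<lambda>x. \<psi> x + \<phi> x)" "c \<odot>\<^bsub>E\<^esub> \<psi> = (\<lambda>x. c * \<psi> x)"
  "coeff E = C0 Y" "ract E \<psi> g = (\<lambda>x. \<psi> x * g (F x))"
  "ip E \<psi> \<phi> = Phi X Y F ind (\<lambda>x. cnj (\<psi> x) * \<phi> x)"
  "left_alg E = C0 X" "lact E f = (\<lambda>\<psi>\<in>M. \<lambda>x. f x * \<psi> x)"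
  "\<psi> \<ominus>\<^bsub>E\<^esub> \<phi> = (\<lambda>x. \<psi> x - \<phi> x)"
  by (simp_all add: branched_corr_def diff_def)

lemma ip_self: "\<psi> \<in> M \<Longrightarrow> ip E \<psi> \<psi> = (\<lambda>y. complex_of_real (sq \<psi> y))"
  using Phi_of_real[OF module_summable, of \<psi>]
  by (simp add: corr_simps mult.commute[of "cnj _"] flip: complex_norm_square)

lemma sq_nonneg: "0 \<le> sq \<psi> y"
  unfolding fibre_sum_def by (intro infsum_nonneg) simp

lemma sq_le_hnorm:
  assumes "\<psi> \<in> M" shows "sq \<psi> y \<le> (hnorm E \<psi>)\<^sup>2"
proof -
  have c: "ip E \<psi> \<psi> \<in> carrier (C0 Y)" using ip_closed_C0[OF assms assms] by (simp add: corr_simps)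
  have "sq \<psi> y = cmod (ip E \<psi> \<psi> y)" by (simp add: ip_self assms sq_nonneg)
  also have "\<dots> \<le> nrm (C0 Y) (ip E \<psi> \<psi>)" by (rule C0_norm_upper[OF c])
  also have "\<dots> = (hnorm E \<psi>)\<^sup>2" using C0_norm_nonneg[OF c] by (simp add: hnorm_def corr_simps(5))
  finally show ?thesis .
qed

lemma hnorm_nonneg: "\<psi> \<in> M \<Longrightarrow> 0 \<le> hnorm E \<psi>"
  using C0_norm_nonneg[OF ip_closed_C0[of \<psi> \<psi>]] by (simp add: hnorm_def corr_simps)

lemma finite_sum_le_hnorm:
  assumes "\<psi> \<in> M" "finite B" "B \<subseteq> fibre X F y"
  shows "(\<Sum>x\<in>B. real (ind x) * (cmod (\<psi> x))\<^sup>2) \<le> (hnorm E \<psi>)\<^sup>2"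
  using fibre_sum_upper[OF module_summable[OF assms(1)] _ assms(2,3)] sq_le_hnorm[OF assms(1), of y]
  by simp

text \<open>Converse of \<open>finite_sum_le_hnorm\<close>: together they express the squared norm
  as the supremum of finite sums over parts of fibres. Norm estimates are reduced to such sums,
  where termwise limits are allowed.\<close>

lemma hnorm_leI:
  assumes "\<psi> \<in> M" "0 \<le> c"
    and "\<And>B y. \<lbrakk>finite B; B \<subseteq> fibre X F y\<rbrakk> \<Longrightarrow> (\<Sum>x\<in>B. real (ind x) * (cmod (\<psi> x))\<^sup>2) \<le> c\<^sup>2"
  shows "hnorm E \<psi> \<le> c"
proof -
  have "sq \<psi> y \<le> c\<^sup>2" for y
    using assms by (intro fibre_sum_least module_summable) auto
  then have "nrm (C0 Y) (ip E \<psi> \<psi>) \<le> c\<^sup>2"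
    by (intro C0_norm_least) (simp add: ip_self assms(1) sq_nonneg)
  then show ?thesis using assms(2) by (simp add: hnorm_def corr_simps(5) real_le_lsqrt)
qed

text \<open>A single term of the fibre sum is bounded by the whole, and its weight is at least 1.
  Convergence in the module is therefore uniform convergence.\<close>

lemma cmod_le_hnorm:
  assumes "\<psi> \<in> M" shows "cmod (\<psi> x) \<le> hnorm E \<psi>"
proof (cases "x \<in> topspace X")
  case True
  have "(cmod (\<psi> x))\<^sup>2 \<le> real (ind x) * (cmod (\<psi> x))\<^sup>2"
    using ind_pos[OF True] by (simp add: mult_le_cancel_right1)
  also have "\<dots> \<le> (hnorm E \<psi>)\<^sup>2"
    using finite_sum_le_hnorm[OF assms, of "{x}" "F x"] True by (simp add: fibre_def)
  finally show ?thesis using hnorm_nonneg[OF assms] by (rule power2_le_imp_le)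
next
  case False
  then show ?thesis using C0_outside[OF module_C0[OF assms]] hnorm_nonneg[OF assms] by simp
qed

text \<open>The inequality for finite real sums on parts of a fibre, after splitting the weight
  \<open>ind x\<close> as a square root between the two factors.\<close>

lemma Cauchy_Schwarz:
  assumes "\<psi> \<in> M" "\<phi> \<in> M"
  shows "nrm (C0 Y) (ip E \<psi> \<phi>) \<le> hnorm E \<psi> * hnorm E \<phi>"
proof (rule C0_norm_least)
  fix y
  let ?h = "\<lambda>x. cmod (\<psi> x) * cmod (\<phi> x)"
  have h: "fibre_summable ?h"
    by (rule fibre_summable_mono[OF dominator_summable[OF ip_dominator(1)[OF assms]]])
       (use ip_dominator(2)[OF assms] in \<open>simp add: norm_mult\<close>)
  have "cmod (ip E \<psi> \<phi> y) \<le> fibre_sum ?h y"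
    unfolding corr_simps by (rule Phi_norm_le[OF h]) (simp add: norm_mult)
  also have "\<dots> \<le> hnorm E \<psi> * hnorm E \<phi>"
  proof (rule fibre_sum_least[OF h])
    fix B assume B: "finite B" "B \<subseteq> fibre X F y"
    have *: "L2_set (\<lambda>x. sqrt (real (ind x)) * cmod (\<eta> x)) B \<le> hnorm E \<eta>" if "\<eta> \<in> M" for \<eta>
      unfolding L2_set_def using finite_sum_le_hnorm[OF that B] hnorm_nonneg[OF that]
      by (simp add: power_mult_distrib real_le_lsqrt)
    have "(\<Sum>x\<in>B. real (ind x) * ?h x)
        = (\<Sum>x\<in>B. \<bar>sqrt (real (ind x)) * cmod (\<psi> x)\<bar> * \<bar>sqrt (real (ind x)) * cmod (\<phi> x)\<bar>)"
      by (rule sum.cong) (auto simp: abs_mult algebra_simps)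
    also have "\<dots> \<le> L2_set (\<lambda>x. sqrt (real (ind x)) * cmod (\<psi> x)) B
        * L2_set (\<lambda>x. sqrt (real (ind x)) * cmod (\<phi> x)) B"
      by (rule L2_set_mult_ineq)
    also have "\<dots> \<le> hnorm E \<psi> * hnorm E \<phi>"
      by (intro mult_mono * assms hnorm_nonneg L2_set_nonneg)
    finally show "(\<Sum>x\<in>B. real (ind x) * ?h x) \<le> hnorm E \<psi> * hnorm E \<phi>" .
  qed
  finally show "cmod (ip E \<psi> \<phi> y) \<le> hnorm E \<psi> * hnorm E \<phi>" .
qed

text \<open>With d = |b - a| the left side is at most d (2|a| + d), and the arithmetic-geometric
  mean inequality trades the cross term 2|a|d for t times the square of |a| plus the square of d
  divided by t. After summation over a fibre the first term is small because b is close to a, the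
  second because t is small.\<close>

lemma cmod_square_diff_le:
  fixes a b :: complex assumes "0 < t"
  shows "\<bar>(cmod a)\<^sup>2 - (cmod b)\<^sup>2\<bar> \<le> (1 + 1 / t) * (cmod (b - a))\<^sup>2 + t * (cmod a)\<^sup>2"
proof -
  let ?d = "cmod (b - a)"
  have am_gm: "2 * cmod a * ?d \<le> t * (cmod a)\<^sup>2 + ?d\<^sup>2 / t"
  proof -
    have "0 \<le> (t * cmod a - ?d)\<^sup>2 / t" using assms by simp
    also have "\<dots> = t * (cmod a)\<^sup>2 - 2 * cmod a * ?d + ?d\<^sup>2 / t"
      using assms by (simp add: power2_eq_square field_simps)
    finally show ?thesis by simp
  qed
  have "\<bar>cmod a - cmod b\<bar> \<le> ?d" using norm_triangle_ineq3[of b a] by (simp add: abs_minus_commute)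
  moreover have "cmod a + cmod b \<le> 2 * cmod a + ?d" using norm_triangle_sub[of b a] by simp
  ultimately have "\<bar>cmod a - cmod b\<bar> * (cmod a + cmod b) \<le> ?d * (2 * cmod a + ?d)"
    by (intro mult_mono) auto
  moreover have "(cmod a)\<^sup>2 - (cmod b)\<^sup>2 = (cmod a - cmod b) * (cmod a + cmod b)"
    by (simp add: power2_eq_square algebra_simps)
  then have "\<bar>(cmod a)\<^sup>2 - (cmod b)\<^sup>2\<bar> = \<bar>cmod a - cmod b\<bar> * (cmod a + cmod b)"
    by (simp add: abs_mult)
  ultimately show ?thesis using am_gm by (simp add: power2_eq_square algebra_simps)
qed

text \<open>The hypothesis bounds the deviation over all fibres at once, so the fibre sums of the
  squared moduli of s n converge uniformly to that of l, and a uniform limit of functions in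
  \<open>C0 Y\<close> stays there.\<close>

lemma module_limit:
  fixes s :: "nat \<Rightarrow> 'a \<Rightarrow> complex"
  assumes s: "\<And>n. s n \<in> M" and l: "l \<in> carrier (C0 X)"
    and close: "\<And>\<epsilon>. 0 < \<epsilon> \<Longrightarrow> \<exists>n0. \<forall>n\<ge>n0. \<forall>y B. finite B \<longrightarrow> B \<subseteq> fibre X F y \<longrightarrow>
      (\<Sum>x\<in>B. real (ind x) * (cmod (s n x - l x))\<^sup>2) \<le> \<epsilon>"
  shows "l \<in> M"
proof -
  let ?l = "\<lambda>x. (cmod (l x))\<^sup>2"
  have d: "fibre_summable (\<lambda>x. (cmod (s n x - l x))\<^sup>2)"
    if "\<And>y B. finite B \<Longrightarrow> B \<subseteq> fibre X F y \<Longrightarrow> (\<Sum>x\<in>B. real (ind x) * (cmod (s n x - l x))\<^sup>2) \<le> \<epsilon>" for n \<epsilon>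
    using that by (intro fibre_summable_bounded[of _ \<epsilon>]) auto
  obtain n1 where "\<forall>n\<ge>n1. \<forall>y B. finite B \<longrightarrow> B \<subseteq> fibre X F y \<longrightarrow>
      (\<Sum>x\<in>B. real (ind x) * (cmod (s n x - l x))\<^sup>2) \<le> 1"
    using close[OF zero_less_one] by blast
  note n1 = this[rule_format, OF order_refl]
  let ?g = "\<lambda>x. 2 * (cmod (s n1 x))\<^sup>2 + 2 * (cmod (s n1 x - l x))\<^sup>2"
  have g: "fibre_summable ?g"
    by (intro fibre_summable_add fibre_summable_cmult module_summable s d[OF n1])
  have lg: "?l x \<le> ?g x" for x
  proof -
    have "?l x \<le> (cmod (s n1 x) + cmod (s n1 x - l x))\<^sup>2"
      using norm_triangle_sub[of "l x" "s n1 x"] by (intro power_mono) (auto simp: norm_minus_commute)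
    then show ?thesis
      using sum_squares_bound[of "cmod (s n1 x)" "cmod (s n1 x - l x)"] by (simp add: power2_sum)
  qed
  have ls: "fibre_summable ?l" using lg by (intro fibre_summable_mono[OF g]) auto
  \<comment> \<open>From the majorant \<open>?g\<close>: twice the squared norm of
    \<open>s n1\<close>, plus twice the bound 1 on the deviation.\<close>
  define C where "C = 2 * (hnorm E (s n1))\<^sup>2 + 2"
  have lC: "sq l y \<le> C" for y
  proof (rule fibre_sum_least[OF ls])
    fix B assume B: "finite B" "B \<subseteq> fibre X F y"
    have "(\<Sum>x\<in>B. real (ind x) * ?l x) \<le> (\<Sum>x\<in>B. real (ind x) * ?g x)"
      using lg by (intro sum_mono mult_left_mono) auto
    also have "\<dots> = 2 * (\<Sum>x\<in>B. real (ind x) * (cmod (s n1 x))\<^sup>2)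
        + 2 * (\<Sum>x\<in>B. real (ind x) * (cmod (s n1 x - l x))\<^sup>2)"
      by (simp add: sum_distrib_left sum.distrib algebra_simps)
    also have "\<dots> \<le> C"
      using finite_sum_le_hnorm[OF s[of n1] B] n1[OF B] by (simp add: C_def)
    finally show "(\<Sum>x\<in>B. real (ind x) * ?l x) \<le> C" .
  qed
  have C0: "0 < C" by (simp add: C_def add_nonneg_pos)
  have "Phi X Y F ind (\<lambda>x. complex_of_real (?l x)) \<in> carrier (C0 Y)"
  proof (rule C0_uniform_limit)
    fix \<epsilon> :: real assume e: "0 < \<epsilon>"
    \<comment> \<open>Chosen so that \<open>t * C\<close> and \<open>(1 + 1 / t) * \<delta>\<close>
      are \<epsilon>/2 each.\<close>
    define t where "t = \<epsilon> / (2 * C)"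
    define \<delta> where "\<delta> = \<epsilon> / (2 * (1 + 1 / t))"
    have t: "0 < t" and \<delta>: "0 < \<delta>" using e C0 by (simp_all add: t_def \<delta>_def add_pos_pos)
    obtain n where "\<forall>m\<ge>n. \<forall>y B. finite B \<longrightarrow> B \<subseteq> fibre X F y \<longrightarrow>
        (\<Sum>x\<in>B. real (ind x) * (cmod (s m x - l x))\<^sup>2) \<le> \<delta>"
      using close[OF \<delta>] by blast
    note n = this[rule_format, OF order_refl]
    let ?sn = "\<lambda>x. (cmod (s n x))\<^sup>2"
    let ?h = "\<lambda>x. (1 + 1 / t) * (cmod (s n x - l x))\<^sup>2 + t * ?l x"
    have h: "fibre_summable ?h" by (intro fibre_summable_add fibre_summable_cmult ls d[OF n])
    have "cmod (Phi X Y F ind (\<lambda>x. complex_of_real (?l x)) y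
        - Phi X Y F ind (\<lambda>x. complex_of_real (?sn x)) y) \<le> \<epsilon>" for y
    proof -
      have "Phi X Y F ind (\<lambda>x. complex_of_real (?l x)) y - Phi X Y F ind (\<lambda>x. complex_of_real (?sn x)) y
          = complex_of_real (sq l y + (- 1) * sq (s n) y)"
        unfolding Phi_of_real[OF ls] Phi_of_real[OF module_summable[OF s]] by simp
      also have "\<dots> = Phi X Y F ind (\<lambda>x. complex_of_real (?l x + (- 1) * ?sn x)) y"
        by (subst Phi_of_real)
           (simp_all only: fibre_summable_add fibre_summable_cmult ls module_summable s
             fibre_sum_add fibre_sum_cmult)
      also have "cmod \<dots> \<le> fibre_sum ?h y"
        using cmod_square_diff_le[OF t] by (intro Phi_norm_le[OF h]) (simp only: norm_of_real, simp)
      also have "\<dots> = (1 + 1 / t) * fibre_sum (\<lambda>x. (cmod (s n x - l x))\<^sup>2) y + t * sq l y"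
        by (simp only: fibre_summable_cmult ls d[OF n] fibre_sum_add fibre_sum_cmult)
      also have "\<dots> \<le> (1 + 1 / t) * \<delta> + t * C"
        using t by (intro add_mono mult_left_mono lC fibre_sum_least[OF d[OF n]] n) auto
      also have "\<dots> = \<epsilon>"
      proof -
        have "1 + 1 / t \<noteq> 0" using t by (simp add: add_pos_pos less_imp_neq[symmetric])
        then have "(1 + 1 / t) * \<delta> = \<epsilon> / 2" unfolding \<delta>_def by (simp add: field_simps)
        moreover have "t * C = \<epsilon> / 2" unfolding t_def using C0 by simp
        ultimately show ?thesis by simp
      qed
      finally show ?thesis .
    qed
    moreover have "Phi X Y F ind (\<lambda>x. complex_of_real (?sn x)) \<in> carrier (C0 Y)"
      using module_dominator[OF s] by (simp add: dominator_def)
    ultimately show "\<exists>g\<in>carrier (C0 Y). \<forall>y. cmod (Phi X Y F ind (\<lambda>x. complex_of_real (?l x)) y - g y) \<le> \<epsilon>"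
      by blast
  qed (simp add: Phi_def)
  then show ?thesis
    using l ls by (auto simp: module_iff dominator_def intro: continuous_map_cmod_square C0_continuous)
qed

text \<open>The norm dominates the uniform norm, so a limit l exists in \<open>C0 X\<close>. On a
  finite part of a fibre the estimate for s n - s m passes to the limit in m; the resulting bound,
  uniform over fibres, both places l in the module and gives convergence in its norm.\<close>

lemma module_complete: "complete_wrt E (hnorm E)"
  unfolding complete_wrt_def
proof (intro allI impI, elim conjE)
  fix s :: "nat \<Rightarrow> 'a \<Rightarrow> complex"
  assume rs: "range s \<subseteq> carrier E"
    and C: "\<forall>\<epsilon>>0. \<exists>n0. \<forall>m\<ge>n0. \<forall>n\<ge>n0. hnorm E (s m \<ominus>\<^bsub>E\<^esub> s n) < \<epsilon>"
  have s: "s n \<in> M" for n using rs by (auto simp: corr_simps)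
  interpret CX: cstar_algebra "C0 X" by (rule cstar_algebra_C0)
  have diff_M: "s m \<ominus>\<^bsub>E\<^esub> s n \<in> M" for m n by (simp add: corr_simps module_diff s)
  have "nrm (C0 X) (s m \<ominus>\<^bsub>C0 X\<^esub> s n) \<le> hnorm E (s m \<ominus>\<^bsub>E\<^esub> s n)" for m n
    using cmod_le_hnorm[OF diff_M] by (intro C0_norm_least) (simp add: corr_simps C0_simps)
  then have "\<exists>n0. \<forall>m\<ge>n0. \<forall>n\<ge>n0. nrm (C0 X) (s m \<ominus>\<^bsub>C0 X\<^esub> s n) < \<epsilon>" if "0 < \<epsilon>" for \<epsilon>
    using C that order_le_less_trans by meson
  then obtain l where l: "CX.converges s l"
    using CX.complete_converges[of s, OF CX.complete module_C0[OF s]] by blast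
  note lC = CX.convergesD(2)[OF l]
  have pt: "(\<lambda>n. s n x) \<longlonglongrightarrow> l x" for x
  proof -
    have "cmod (s n x - l x) \<le> nrm (C0 X) (s n \<ominus>\<^bsub>C0 X\<^esub> l)" for n
      using C0_norm_upper[OF CX.diff_closed[OF module_C0[OF s[of n]] lC], of x] by (simp add: C0_simps)
    then have "(\<lambda>n. s n x - l x) \<longlonglongrightarrow> 0"
      by (intro Lim_null_comparison[OF _ CX.convergesD(3)[OF l]]) auto
    then show ?thesis by (simp add: LIM_zero_iff)
  qed
  have close: "\<exists>n0. \<forall>n\<ge>n0. \<forall>y B. finite B \<longrightarrow> B \<subseteq> fibre X F y \<longrightarrow>
      (\<Sum>x\<in>B. real (ind x) * (cmod (s n x - l x))\<^sup>2) \<le> \<epsilon>\<^sup>2" if e: "0 < \<epsilon>" for \<epsilon>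
  proof -
    obtain n0 where n0: "\<And>m n. m \<ge> n0 \<Longrightarrow> n \<ge> n0 \<Longrightarrow> hnorm E (s n \<ominus>\<^bsub>E\<^esub> s m) < \<epsilon>"
      using C e by blast
    have "(\<Sum>x\<in>B. real (ind x) * (cmod (s n x - l x))\<^sup>2) \<le> \<epsilon>\<^sup>2"
      if n: "n \<ge> n0" and B: "finite B" "B \<subseteq> fibre X F y" for n y B
    proof (rule LIMSEQ_le_const2)
      show "(\<lambda>m. \<Sum>x\<in>B. real (ind x) * (cmod (s n x - s m x))\<^sup>2)
          \<longlonglongrightarrow> (\<Sum>x\<in>B. real (ind x) * (cmod (s n x - l x))\<^sup>2)"
        by (intro tendsto_intros pt)
      have "(\<Sum>x\<in>B. real (ind x) * (cmod (s n x - s m x))\<^sup>2) \<le> \<epsilon>\<^sup>2" if m: "m \<ge> n0" for m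
      proof -
        have "(\<Sum>x\<in>B. real (ind x) * (cmod (s n x - s m x))\<^sup>2) \<le> (hnorm E (s n \<ominus>\<^bsub>E\<^esub> s m))\<^sup>2"
          using finite_sum_le_hnorm[OF diff_M B, of n m] by (simp add: corr_simps)
        also have "\<dots> \<le> \<epsilon>\<^sup>2"
          using n0[OF m n] by (intro power_mono hnorm_nonneg[OF diff_M]) auto
        finally show ?thesis .
      qed
      then show "\<exists>k. \<forall>m\<ge>k. (\<Sum>x\<in>B. real (ind x) * (cmod (s n x - s m x))\<^sup>2) \<le> \<epsilon>\<^sup>2" by blast
    qed
    then show ?thesis by blast
  qed
  have lM: "l \<in> M"
  proof (rule module_limit[OF s lC])
    fix \<epsilon> :: real assume "0 < \<epsilon>"
    then show "\<exists>n0. \<forall>n\<ge>n0. \<forall>y B. finite B \<longrightarrow> B \<subseteq> fibre X F y \<longrightarrow>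
      (\<Sum>x\<in>B. real (ind x) * (cmod (s n x - l x))\<^sup>2) \<le> \<epsilon>"
      using close[of "sqrt \<epsilon>"] by simp
  qed
  have "(\<lambda>n. hnorm E (s n \<ominus>\<^bsub>E\<^esub> l)) \<longlonglongrightarrow> 0"
  proof (rule LIMSEQ_I)
    fix \<epsilon> :: real assume e: "0 < \<epsilon>"
    obtain n0 where "\<forall>n\<ge>n0. \<forall>y B. finite B \<longrightarrow> B \<subseteq> fibre X F y \<longrightarrow>
        (\<Sum>x\<in>B. real (ind x) * (cmod (s n x - l x))\<^sup>2) \<le> (\<epsilon> / 2)\<^sup>2"
      using close[OF half_gt_zero[OF e]] by blast
    note n0 = this[rule_format]
    have "norm (hnorm E (s n \<ominus>\<^bsub>E\<^esub> l) - 0) < \<epsilon>" if "n \<ge> n0" for n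
    proof -
      have dM: "s n \<ominus>\<^bsub>E\<^esub> l \<in> M" by (simp add: corr_simps module_diff s lM)
      have "hnorm E (s n \<ominus>\<^bsub>E\<^esub> l) \<le> \<epsilon> / 2"
        using n0[OF that] e by (intro hnorm_leI[OF dM]) (simp_all add: corr_simps)
      then show ?thesis using e hnorm_nonneg[OF dM] by simp
    qed
    then show "\<exists>n0. \<forall>n\<ge>n0. norm (hnorm E (s n \<ominus>\<^bsub>E\<^esub> l) - 0) < \<epsilon>" by blast
  qed
  then show "\<exists>l\<in>carrier E. (\<lambda>n. hnorm E (s n \<ominus>\<^bsub>E\<^esub> l)) \<longlonglongrightarrow> 0"
    using lM by (auto simp: corr_simps(1))
qed

lemma ip_definite:
  assumes "\<psi> \<in> M" "ip E \<psi> \<psi> = (\<lambda>y. 0)"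
  shows "\<psi> = (\<lambda>x. 0)"
proof
  have "hnorm E \<psi> = 0"
    using assms(2) C0_norm_eq_zero[OF C0_zero, of Y] by (simp add: hnorm_def corr_simps(5))
  then show "\<psi> x = 0" for x using cmod_le_hnorm[OF assms(1), of x] by simp
qed

lemma ip_positive:
  assumes "\<psi> \<in> M"
  shows "\<exists>b\<in>carrier (C0 Y). ip E \<psi> \<psi> = (\<lambda>y. cnj (b y) * b y)"
proof
  \<comment> \<open>The pointwise square root of the inner product; it vanishes at infinity because
    the inner product falls below the square of \<epsilon> off a compact set.\<close>
  let ?b = "\<lambda>y. complex_of_real (sqrt (sq \<psi> y))"
  show "ip E \<psi> \<psi> = (\<lambda>y. cnj (?b y) * ?b y)"
    by (simp add: ip_self assms sq_nonneg flip: of_real_mult)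
  have c: "(\<lambda>y. complex_of_real (sq \<psi> y)) \<in> carrier (C0 Y)"
    using ip_closed_C0[OF assms assms] ip_self[OF assms] by (simp add: corr_simps)
  show "?b \<in> carrier (C0 Y)"
    unfolding C0_carrier
  proof (intro conjI allI impI)
    have "\<forall>y\<in>topspace Y. (sq \<psi> \<longlongrightarrow> sq \<psi> y) (atin Y y)"
      using C0_continuous[OF c] by (simp add: continuous_map_tendsto tendsto_of_real_iff)
    then show "continuous_map Y euclidean ?b"
      by (auto simp: continuous_map_tendsto intro!: tendsto_intros)
    show "?b y = 0" if "y \<notin> topspace Y" for y using C0_outside[OF c that] by simp
    fix \<epsilon> :: real assume e: "0 < \<epsilon>"
    obtain K where K: "compactin Y K" "\<And>y. y \<notin> K \<Longrightarrow> sq \<psi> y < \<epsilon>\<^sup>2"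
      using C0_small[OF c, of "\<epsilon>\<^sup>2"] e sq_nonneg by auto
    have "cmod (?b y) < \<epsilon>" if "y \<notin> K" for y
      using K(2)[OF that] e sq_nonneg by (simp add: real_less_lsqrt)
    then show "\<exists>K. compactin Y K \<and> (\<forall>y\<in>topspace Y - K. cmod (?b y) < \<epsilon>)" using K(1) by blast
  qed
qed

lemma hilbert_module_corr: "hilbert_module_CS E"
proof -
  have "cstar_algebra (coeff E)" by (simp add: corr_simps(5) cstar_algebra_C0)
  then interpret CY: cstar_algebra "coeff E" .
  show ?thesis
  proof unfold_locales
    show "complete_wrt E (hnorm E)" by (rule module_complete)
    fix \<psi> \<phi> \<eta> and z :: complex assume p: "\<psi> \<in> carrier E"
    then have p': "\<psi> \<in> M" by (simp add: corr_simps)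
    show "\<exists>b\<in>carrier (coeff E). ip E \<psi> \<psi> = star (coeff E) b \<otimes>\<^bsub>coeff E\<^esub> b"
      using ip_positive[OF p'] by (simp add: corr_simps(5) C0_simps)
    show "ip E \<psi> \<psi> = \<zero>\<^bsub>coeff E\<^esub> \<Longrightarrow> \<psi> = \<zero>\<^bsub>E\<^esub>"
      using ip_definite[OF p'] by (simp add: corr_simps(2,5) C0_simps)
    assume q: "\<phi> \<in> carrier E"
    then have q': "\<phi> \<in> M" by (simp add: corr_simps)
    show "nrm (coeff E) (ip E \<psi> \<phi>) \<le> hnorm E \<psi> * hnorm E \<phi>"
      using Cauchy_Schwarz[OF p' q'] by (simp add: corr_simps(5))
    show "ip E \<psi> (z \<odot>\<^bsub>E\<^esub> \<phi>) = z \<odot>\<^bsub>coeff E\<^esub> ip E \<psi> \<phi>"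
      by (rule ext) (simp add: corr_simps C0_simps Phi_eq mult.left_commute[of _ z] infsum_cmult_right')
    show "ip E \<psi> (ract E \<phi> b) = ip E \<psi> \<phi> \<otimes>\<^bsub>coeff E\<^esub> b" for b
    proof
      fix y
      \<comment> \<open>On the fibre over y the factor b (F x) is the constant b y and leaves the
        sum.\<close>
      have "(\<Sum>\<^sub>\<infinity>x\<in>fibre X F y. of_nat (ind x) * (cnj (\<psi> x) * (\<phi> x * b (F x))))
          = (\<Sum>\<^sub>\<infinity>x\<in>fibre X F y. of_nat (ind x) * (cnj (\<psi> x) * \<phi> x) * b y)"
        by (rule infsum_cong) (simp add: fibre_def)
      then show "ip E \<psi> (ract E \<phi> b) y = (ip E \<psi> \<phi> \<otimes>\<^bsub>coeff E\<^esub> b) y"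
        by (simp add: corr_simps C0_simps Phi_eq infsum_cmult_left')
    qed
    show "star (coeff E) (ip E \<psi> \<phi>) = ip E \<phi> \<psi>"
      by (rule ext) (simp add: corr_simps C0_simps Phi_eq mult.commute[of "cnj _"] flip: infsum_cnj)
    assume r: "\<eta> \<in> carrier E"
    then have r': "\<eta> \<in> M" by (simp add: corr_simps)
    show "ip E \<psi> (\<phi> \<oplus>\<^bsub>E\<^esub> \<eta>) = ip E \<psi> \<phi> \<oplus>\<^bsub>coeff E\<^esub> ip E \<psi> \<eta>"
      by (rule ext) (simp add: corr_simps C0_simps Phi_eq distrib_left
          infsum_add[OF ip_summable[OF p' q'] ip_summable[OF p' r']])
  qed (auto simp: corr_simps C0_simps module_zero module_add module_scale module_ract ip_closed_C0
    distrib_left distrib_right add.assoc add.commute add.left_commute mult.assoc mult.left_commute)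
qed

sublocale H: hilbert_module_CS E by (rule hilbert_module_corr)

section \<open>The left action\<close>

lemma hnorm_mult_le:
  assumes "\<psi> \<in> M" "(\<lambda>x. f x * \<psi> x) \<in> M" "0 \<le> c" "\<And>x. x \<in> topspace X \<Longrightarrow> cmod (f x) \<le> c"
  shows "hnorm E (\<lambda>x. f x * \<psi> x) \<le> c * hnorm E \<psi>"
proof (rule hnorm_leI[OF assms(2)])
  show "0 \<le> c * hnorm E \<psi>" using assms hnorm_nonneg by simp
  fix B y assume B: "finite B" "B \<subseteq> fibre X F y"
  have "(\<Sum>x\<in>B. real (ind x) * (cmod (f x * \<psi> x))\<^sup>2) \<le> (\<Sum>x\<in>B. c\<^sup>2 * (real (ind x) * (cmod (\<psi> x))\<^sup>2))"
  proof (rule sum_mono)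
    fix x assume "x \<in> B"
    then have "(cmod (f x))\<^sup>2 \<le> c\<^sup>2" using B assms(4) by (intro power_mono) (auto simp: fibre_def)
    then have "(cmod (f x))\<^sup>2 * (real (ind x) * (cmod (\<psi> x))\<^sup>2) \<le> c\<^sup>2 * (real (ind x) * (cmod (\<psi> x))\<^sup>2)"
      by (rule mult_right_mono) simp
    then show "real (ind x) * (cmod (f x * \<psi> x))\<^sup>2 \<le> c\<^sup>2 * (real (ind x) * (cmod (\<psi> x))\<^sup>2)"
      by (simp add: norm_mult power_mult_distrib ac_simps)
  qed
  also have "\<dots> \<le> c\<^sup>2 * (hnorm E \<psi>)\<^sup>2"
    unfolding sum_distrib_left[symmetric] by (intro mult_left_mono finite_sum_le_hnorm[OF assms(1) B]) simp
  finally show "(\<Sum>x\<in>B. real (ind x) * (cmod (f x * \<psi> x))\<^sup>2) \<le> (c * hnorm E \<psi>)\<^sup>2"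
    by (simp add: power_mult_distrib)
qed

lemma lact_pair:
  assumes "f \<in> carrier (C0 X)"
  shows "adjoint_pair E (lact E f) (lact E (\<lambda>x. cnj (f x)))"
proof (rule H.adjoint_pairI)
  fix \<psi> \<phi> assume "\<psi> \<in> carrier E" "\<phi> \<in> carrier E"
  then show "ip E (lact E f \<psi>) \<phi> = ip E \<psi> (lact E (\<lambda>x. cnj (f x)) \<phi>)"
    by (simp add: corr_simps ac_simps)
qed (use assms C0_star[OF assms] in \<open>simp_all add: corr_simps module_lact\<close>)

lemma lact_closed:
  assumes f: "f \<in> carrier (C0 X)"
  shows "lact E f \<in> carrier (adjointables E)"
  by (rule H.adjointablesI[OF lact_pair[OF f], of "nrm (C0 X) f"])
     (use hnorm_mult_le[OF _ module_lact[OF f]] C0_norm_upper[OF f] C0_norm_nonneg[OF f] in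
       \<open>simp add: corr_simps\<close>)

lemma correspondence_corr: "correspondence E"
proof -
  have "star_hom (C0 X) (adjointables E) (lact E)"
    unfolding star_hom_def complex_linear_def
    using lact_closed H.star_eqI[OF lact_pair]
    by (auto simp: C0_simps H.adjointables_simps corr_simps module_lact algebra_simps fun_eq_iff restrict_def)
  then show ?thesis
    using cstar_algebra_C0 H.hilbert_module_axioms
    by (simp add: correspondence_def correspondence_axioms_def corr_simps(8))
qed

end

subsection \<open>Restriction to open subsets\<close>

text \<open>The sections stay the same; only their domain shrinks, to a W on which all of them land
  in U. Shrinking the domain does not change the index count at a point over W, since a section
  through u passes through it at F u.\<close>

lemma branched_restrict:
  assumes br: "branched X Y F ind" and U: "openin X U" and V: "openin Y V" and UV: "F ` U \<subseteq> V"
  shows "branched (subtopology X U) (subtopology Y V) F ind"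
  unfolding branched_def
proof (intro conjI ballI)
  show "continuous_map (subtopology X U) (subtopology Y V) F"
    using br UV unfolding branched_def
    by (auto simp: continuous_map_in_subtopology intro: continuous_map_from_subtopology)
  show "1 \<le> ind x" if "x \<in> topspace (subtopology X U)" for x
    using br that unfolding branched_def by auto
  fix x assume "x \<in> topspace (subtopology X U)"
  then have x: "x \<in> topspace X" "x \<in> U" by auto
  let ?I = "{1..ind x}"
  obtain U' V' G where nhds: "nhd X x U'" "nhd Y (F x) V'"
    and G': "\<forall>i\<in>?I. \<forall>v\<in>V'. G i v \<in> U' \<and> F (G i v) = v"
    and Gx': "\<forall>i\<in>?I. G i (F x) = x \<and>
        topcontinuous_at (subtopology Y V') (subtopology X U') (G i) (F x)"
    and cover: "U' = (\<Union>i\<in>?I. G i ` V')"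
    and card': "\<forall>u\<in>U'. ind u = card {i\<in>?I. u \<in> G i ` V'}"
    using br x(1) unfolding branched_def by blast
  note G = G'[rule_format] and Gx = Gx'[rule_format, THEN conjunct1]
    and Gcont = Gx'[rule_format, THEN conjunct2] and card = card'[rule_format]
  obtain UO where UO: "openin X UO" "x \<in> UO" "UO \<subseteq> U'" using nhds(1) by (auto simp: nhd_def)
  have I: "finite ?I" "?I \<noteq> {}" using br x(1) by (auto simp: branched_def)
  have "\<exists>T. openin Y T \<and> F x \<in> T \<and> T \<subseteq> V' \<and> (\<forall>v\<in>T. G i v \<in> U)" if i: "i \<in> ?I" for i
    using topcontinuous_at_near[OF Gcont[OF i] nhds(2) U] x(2) Gx[OF i] by simp
  then obtain T where T: "\<And>i. i \<in> ?I \<Longrightarrow> openin Y (T i) \<and> F x \<in> T i \<and> T i \<subseteq> V' \<and> (\<forall>v\<in>T i. G i v \<in> U)"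
    by metis
  define W where "W = (\<Inter>i\<in>?I. T i) \<inter> V"
  have W: "openin Y W" "F x \<in> W" "W \<subseteq> V'" "W \<subseteq> V" and GW: "\<And>i v. i \<in> ?I \<Longrightarrow> v \<in> W \<Longrightarrow> G i v \<in> U"
  proof -
    show "openin Y W" unfolding W_def using T I V by (intro openin_Int openin_INT2) auto
    show "F x \<in> W" using T UV x unfolding W_def by blast
    show "W \<subseteq> V'" "W \<subseteq> V" using T I(2) unfolding W_def by blast+
    show "\<And>i v. i \<in> ?I \<Longrightarrow> v \<in> W \<Longrightarrow> G i v \<in> U" using T unfolding W_def by blast
  qed
  define N where "N = (\<Union>i\<in>?I. G i ` W)"
  \<comment> \<open>This description shows both that N is a neighbourhood of x and that sections
    meeting N over V' already meet it over W.\<close>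
  have N: "N = {u \<in> U'. F u \<in> W}"
    unfolding N_def cover using G W(3) by fastforce
  have NU: "N \<subseteq> U" using GW by (auto simp: N_def)
  have U'X: "U' \<subseteq> topspace X" using nhds(1) by (simp add: nhd_def)
  have NX: "N \<subseteq> topspace X" using N U'X by auto
  have GN: "G i v \<in> N" if "i \<in> ?I" "v \<in> W" for i v using that unfolding N_def by blast
  have contF: "continuous_map X Y F" using br by (simp add: branched_def)
  show "\<exists>N W. nhd (subtopology X U) x N \<and> nhd (subtopology Y V) (F x) W \<and>
      (\<exists>G. (\<forall>i\<in>?I. \<forall>v\<in>W. G i v \<in> N \<and> F (G i v) = v) \<and>
        (\<forall>i\<in>?I. G i (F x) = x \<and>
          topcontinuous_at (subtopology (subtopology Y V) W) (subtopology (subtopology X U) N) (G i) (F x)) \<and>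
        N = (\<Union>i\<in>?I. G i ` W) \<and> (\<forall>u\<in>N. ind u = card {i\<in>?I. u \<in> G i ` W}))"
  proof (rule exI[of _ N], rule exI[of _ W], intro conjI exI[of _ G] ballI)
    have "openin X (U \<inter> (UO \<inter> {u \<in> topspace X. F u \<in> W}))"
      using openin_continuous_map_preimage[OF contF W(1)] U UO(1) by (intro openin_Int)
    then have "openin (subtopology X U) (UO \<inter> {u \<in> topspace X. F u \<in> W} \<inter> U)"
      unfolding openin_subtopology
      by (intro exI[of _ "U \<inter> (UO \<inter> {u \<in> topspace X. F u \<in> W})"]) auto
    then show "nhd (subtopology X U) x N"
      unfolding nhd_def using NU U'X UO x W(2)
      by (intro conjI exI[of _ "UO \<inter> {u \<in> topspace X. F u \<in> W} \<inter> U"]) (auto simp: N)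
    have "openin (subtopology Y V) W" using W(1,4) by (auto simp: openin_subtopology)
    then show "nhd (subtopology Y V) (F x) W"
      unfolding nhd_def using W openin_subset[OF W(1)] by auto
    show "G i v \<in> N" "F (G i v) = v" if "i \<in> ?I" "v \<in> W" for i v
      using GN[OF that] G[OF that(1)] that(2) W(3) by auto
    show "G i (F x) = x" if "i \<in> ?I" for i by (rule Gx[OF that])
    show "topcontinuous_at (subtopology (subtopology Y V) W) (subtopology (subtopology X U) N) (G i) (F x)"
      if i: "i \<in> ?I" for i
      unfolding topcontinuous_at_def
    proof (intro conjI allI impI)
      show "F x \<in> topspace (subtopology (subtopology Y V) W)"
        using W openin_subset[OF W(1)] by auto
      show "G i \<in> topspace (subtopology (subtopology Y V) W) \<rightarrow> topspace (subtopology (subtopology X U) N)"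
        using GN[OF i] NU NX by auto
      fix S assume S: "openin (subtopology (subtopology X U) N) S \<and> G i (F x) \<in> S"
      then obtain S' where S': "openin X S'" "S = S' \<inter> N"
        using NU by (auto simp: subtopology_subtopology openin_subtopology Int_absorb1)
      from topcontinuous_at_near[OF Gcont[OF i] nhds(2) S'(1)]
      obtain T where T: "openin Y T" "F x \<in> T" "\<forall>v\<in>T. G i v \<in> S'"
        using S S'(2) by auto
      show "\<exists>T. openin (subtopology (subtopology Y V) W) T \<and> F x \<in> T \<and> (\<forall>y\<in>T. G i y \<in> S)"
      proof (intro exI[of _ "T \<inter> W"] conjI ballI)
        show "openin (subtopology (subtopology Y V) W) (T \<inter> W)"
          using T(1) W(4) by (auto simp: subtopology_subtopology openin_subtopology Int_absorb1)
        show "F x \<in> T \<inter> W" using T W by auto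
        show "G i y \<in> S" if "y \<in> T \<inter> W" for y
          using that T(3) S'(2) GN[OF i, of y] by auto
      qed
    qed
    show "N = (\<Union>i\<in>?I. G i ` W)" by (rule N_def)
    fix u assume u: "u \<in> N"
    then have "{i\<in>?I. u \<in> G i ` V'} = {i\<in>?I. u \<in> G i ` W}"
      using G W(3) unfolding N by force
    then show "ind u = card {i\<in>?I. u \<in> G i ` W}" using card[of u] u N by simp
  qed
qed

text \<open>The delicate point is continuity of the extension at points off U. There f is small off
  a compact subset of U, which is closed in X by the Hausdorff property, so its complement is the
  required neighbourhood.\<close>

lemma C0_subtopology:
  assumes "Hausdorff_space X" and U: "openin X U"
  shows "f \<in> carrier (C0 (subtopology X U)) \<longleftrightarrow> f \<in> carrier (C0 X) \<and> (\<forall>x. x \<notin> U \<longrightarrow> f x = 0)"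
proof
  have UX: "U \<subseteq> topspace X" by (rule openin_subset[OF U])
  assume f: "f \<in> carrier (C0 (subtopology X U))"
  have out: "f x = 0" if "x \<notin> U" for x using C0_outside[OF f] that by simp
  have small: "\<exists>K. compactin X K \<and> K \<subseteq> U \<and> (\<forall>x. x \<notin> K \<longrightarrow> cmod (f x) < \<epsilon>)" if "0 < \<epsilon>" for \<epsilon>
    using C0_small[OF f that] by (metis compactin_subtopology)
  have "(f \<longlongrightarrow> f x) (atin X x)" if x: "x \<in> topspace X" for x
  proof (cases "x \<in> U")
    case True
    have "(f \<longlongrightarrow> f x) (atin (subtopology X U) x)"
      using C0_continuous[OF f] True x by (simp add: continuous_map_tendsto)
    then show ?thesis
      unfolding tendsto_iff eventually_atin
      using True x by (simp add: openin_open_subtopology[OF U]) blast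
  next
    case False
    show ?thesis
    proof (rule tendstoI)
      fix \<epsilon> :: real assume "0 < \<epsilon>"
      then obtain K where K: "compactin X K" "K \<subseteq> U" "\<forall>x. x \<notin> K \<longrightarrow> cmod (f x) < \<epsilon>"
        using small by blast
      have "openin X (topspace X - K)"
        using compactin_imp_closedin[OF assms(1) K(1)] by (simp add: openin_diff)
      then show "\<forall>\<^sub>F y in atin X x. dist (f y) (f x) < \<epsilon>"
        unfolding eventually_atin using False x K out
        by (intro disjI2 exI[of _ "topspace X - K"]) (auto simp: dist_norm)
    qed
  qed
  moreover have "\<exists>K. compactin X K \<and> (\<forall>x\<in>topspace X - K. cmod (f x) < \<epsilon>)" if "0 < \<epsilon>" for \<epsilon>
    using small[OF that] by blast
  ultimately show "f \<in> carrier (C0 X) \<and> (\<forall>x. x \<notin> U \<longrightarrow> f x = 0)"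
    using out subsetD[OF UX] by (auto simp: C0_carrier continuous_map_tendsto intro!: out)
next
  assume f: "f \<in> carrier (C0 X) \<and> (\<forall>x. x \<notin> U \<longrightarrow> f x = 0)"
  then have fX: "f \<in> carrier (C0 X)" and out: "\<And>x. x \<notin> U \<Longrightarrow> f x = 0" by auto
  have "\<exists>K. compactin (subtopology X U) K \<and> (\<forall>x\<in>topspace (subtopology X U) - K. cmod (f x) < \<epsilon>)"
    if e: "0 < \<epsilon>" for \<epsilon>
  proof -
    obtain K where K: "compactin X K" "\<And>x. x \<notin> K \<Longrightarrow> cmod (f x) < \<epsilon>"
      using C0_small[OF fX e] by blast
    \<comment> \<open>K itself need not lie in U. Its part where |f| is at least \<epsilon> is still
      compact and lies in U because f vanishes off U.\<close>
    have "closedin X {x \<in> topspace X. f x \<in> {z. \<epsilon> \<le> cmod z}}"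
      by (rule closedin_continuous_map_preimage[OF C0_continuous[OF fX]])
        (simp add: closed_Collect_le continuous_on_norm continuous_on_const continuous_on_id)
    from closed_Int_compactin[OF this K(1)]
    have "compactin X ({x \<in> topspace X. f x \<in> {z. \<epsilon> \<le> cmod z}} \<inter> K)" .
    moreover have "{x \<in> topspace X. f x \<in> {z. \<epsilon> \<le> cmod z}} \<inter> K \<subseteq> U" using out e by force
    ultimately show ?thesis
      using K(2) by (intro exI[of _ "{x \<in> topspace X. f x \<in> {z. \<epsilon> \<le> cmod z}} \<inter> K"])
        (auto simp: compactin_subtopology not_le[symmetric])
  qed
  then show "f \<in> carrier (C0 (subtopology X U))"
    unfolding C0_carrier[of f "subtopology X U"]
    using out continuous_map_from_subtopology[OF C0_continuous[OF fX]] C0_outside[OF fX] by auto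
qed

text \<open>Urysohn's lemma for the compact set A and the complement of an open W that contains A
  and has compact K around it; being 0 off W makes the function vanish at infinity.\<close>

lemma C0_cutoff:
  assumes "locally_compact_space Z" "Hausdorff_space Z" "finite A" "A \<subseteq> topspace Z"
  shows "\<exists>\<eta>\<in>carrier (C0 Z). (\<forall>x. cmod (\<eta> x) \<le> 1) \<and> (\<forall>x\<in>A. \<eta> x = 1)"
proof -
  have A: "compactin Z A" using assms(3,4) by (simp add: finite_imp_compactin)
  then obtain W K where WK: "openin Z W" "compactin Z K" "A \<subseteq> W" "W \<subseteq> K"
    using locally_compact_space_compact_closed_compact[of Z] assms(1,2) by blast
  have "completely_regular_space Z"
    using assms(1,2) locally_compact_Hausdorff_imp_regular_space
      locally_compact_regular_imp_completely_regular_space by blast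
  moreover have "closedin Z (topspace Z - W)" "disjnt A (topspace Z - W)"
    using WK by (auto simp: disjnt_iff)
  ultimately obtain f :: "'a \<Rightarrow> real" where f: "continuous_map Z (subtopology euclidean {0..1}) f"
    "f ` (topspace Z - W) \<subseteq> {0}" "f ` A \<subseteq> {1}"
    using Urysohn_completely_regular_compact_closed[OF zero_le_one _ A] by metis
  let ?\<eta> = "\<lambda>x. if x \<in> topspace Z then complex_of_real (f x) else 0"
  have f01: "0 \<le> f x \<and> f x \<le> 1" if "x \<in> topspace Z" for x
    using f(1) that by (auto simp: continuous_map_in_subtopology)
  have "continuous_map Z euclideanreal f" using f(1) by (simp add: continuous_map_in_subtopology)
  then have "continuous_map Z euclidean (\<lambda>x. complex_of_real (f x))"
    by (auto simp: continuous_map_tendsto intro: tendsto_of_real)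
  then have "continuous_map Z euclidean ?\<eta>" by (rule continuous_map_eq) auto
  moreover have "\<exists>K. compactin Z K \<and> (\<forall>x\<in>topspace Z - K. cmod (?\<eta> x) < \<epsilon>)" if "0 < \<epsilon>" for \<epsilon>
  proof -
    have "f x = 0" if "x \<in> topspace Z - K" for x using f(2) WK(4) that by blast
    then show ?thesis using WK(2) that by (intro exI[of _ K]) auto
  qed
  ultimately have "?\<eta> \<in> carrier (C0 Z)" by (simp add: C0_carrier)
  moreover have "cmod (?\<eta> x) \<le> 1" for x using f01 by auto
  moreover have "?\<eta> x = 1" if "x \<in> A" for x using that f(3) assms(4) by auto
  ultimately show ?thesis by (intro bexI[of _ ?\<eta>]) auto
qed

locale branched_restriction = branched_map X Y F ind
  for X :: "'a topology" and Y :: "'b topology" and F :: "'a \<Rightarrow> 'b" and ind :: "'a \<Rightarrow> nat" +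
  fixes U :: "'a set" and V :: "'b set"
  assumes locally_compact: "locally_compact_space X" and Hausdorff_Y: "Hausdorff_space Y"
    and open_U: "openin X U" and open_V: "openin Y V" and F_U: "F ` U \<subseteq> V"
begin

abbreviation (input) "XU \<equiv> subtopology X U"
abbreviation (input) "YV \<equiv> subtopology Y V"

sublocale R: branched_map XU YV F ind
  by unfold_locales
     (simp_all add: Hausdorff Hausdorff_space_subtopology branched_restrict[OF branched open_U open_V F_U])

lemma U_subset: "U \<subseteq> topspace X" "V \<subseteq> topspace Y"
  using open_U open_V openin_subset by auto

lemma C0_U: "f \<in> carrier (C0 XU) \<longleftrightarrow> f \<in> carrier (C0 X) \<and> (\<forall>x. x \<notin> U \<longrightarrow> f x = 0)"
  by (rule C0_subtopology[OF Hausdorff open_U])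

lemma C0_V: "f \<in> carrier (C0 YV) \<longleftrightarrow> f \<in> carrier (C0 Y) \<and> (\<forall>y. y \<notin> V \<longrightarrow> f y = 0)"
  by (rule C0_subtopology[OF Hausdorff_Y open_V])

lemma fibre_U: "fibre XU F y = fibre X F y \<inter> U"
  by (auto simp: fibre_def)

lemma Phi_U:
  assumes "\<And>x. x \<notin> U \<Longrightarrow> f x = 0"
  shows "Phi XU YV F ind f = Phi X Y F ind f"
  unfolding fun_eq_iff R.Phi_eq Phi_eq fibre_U
  using assms by (intro allI infsum_cong_neutral) auto

text \<open>Fibres over such y miss U, because F maps U into V. This is what brings the fibre sums
  of the smaller module into \<open>C0 YV\<close>.\<close>

lemma Phi_outside_V:
  assumes "\<And>x. x \<notin> U \<Longrightarrow> f x = 0" "y \<notin> V"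
  shows "Phi X Y F ind f y = 0"
  using assms by (simp flip: Phi_U add: Phi_def)

lemma module_U: "\<psi> \<in> R.M \<longleftrightarrow> \<psi> \<in> M \<and> (\<forall>x. x \<notin> U \<longrightarrow> \<psi> x = 0)"
proof (cases "\<forall>x. x \<notin> U \<longrightarrow> \<psi> x = 0")
  case True
  let ?h = "\<lambda>x. complex_of_real ((cmod (\<psi> x))\<^sup>2)"
  have eq: "Phi XU YV F ind ?h = Phi X Y F ind ?h" using True by (intro Phi_U) simp
  have out: "\<forall>y. y \<notin> V \<longrightarrow> Phi X Y F ind ?h y = 0" using True by (intro allI impI Phi_outside_V) simp_all
  have s: "R.fibre_summable (\<lambda>x. (cmod (\<psi> x))\<^sup>2) \<longleftrightarrow> fibre_summable (\<lambda>x. (cmod (\<psi> x))\<^sup>2)"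
    unfolding R.fibre_summable_def fibre_summable_def fibre_U
    using True by (intro all_cong1 summable_on_cong_neutral) auto
  show ?thesis
    unfolding R.module_iff module_iff R.dominator_def dominator_def C0_U C0_V eq s
    using True out
    by (auto intro: continuous_map_from_subtopology continuous_map_cmod_square C0_continuous
        simp del: of_real_power)
next
  case False
  then show ?thesis by (simp add: R.module_iff C0_U) blast
qed

lemma module_U_D: "\<psi> \<in> R.M \<Longrightarrow> \<psi> \<in> M" "\<psi> \<in> R.M \<Longrightarrow> x \<notin> U \<Longrightarrow> \<psi> x = 0"
  by (auto simp: module_U)

text \<open>The representing functions are already 0 off their space. The inclusions act as the
  identity, and the algebraic conditions on a morphism become equalities of functions.\<close>

lemma ext_zero_id:
  "f \<in> carrier (C0 XU) \<Longrightarrow> ext_zero U f = f" "\<psi> \<in> R.M \<Longrightarrow> ext_zero U \<psi> = \<psi>"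
  "g \<in> carrier (C0 YV) \<Longrightarrow> ext_zero V g = g"
  by (auto simp: ext_zero_def C0_U C0_V module_U)

lemma ip_U: "\<psi> \<in> R.M \<Longrightarrow> ip R.E \<psi> \<phi> = ip E \<psi> \<phi>"
  by (auto simp: R.corr_simps corr_simps module_U_D intro!: Phi_U)

lemma hnorm_U: "\<psi> \<in> R.M \<Longrightarrow> hnorm R.E \<psi> = hnorm E \<psi>"
  using ip_U[of \<psi> \<psi>] by (simp add: hnorm_def R.corr_simps(5) corr_simps(5) C0_def)

lemma mult_C0_U:
  assumes "\<eta> \<in> carrier (C0 XU)" "g \<in> M"
  shows "(\<lambda>x. \<eta> x * g x) \<in> R.M"
  using assms by (auto simp: module_U C0_U intro: module_lact)

text \<open>A net indexed by the finite subsets of U, so that limits along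
  \<open>finite_subsets_at_top U\<close> eventually make the cutoff equal to 1 at any given finitely
  many points.\<close>

definition cutoff :: "'a set \<Rightarrow> 'a \<Rightarrow> complex"
  where "cutoff A = (SOME \<eta>. \<eta> \<in> carrier (C0 XU) \<and> (\<forall>x. cmod (\<eta> x) \<le> 1) \<and> (\<forall>x\<in>A. \<eta> x = 1))"

lemma cutoff:
  assumes "finite A" "A \<subseteq> U"
  shows "cutoff A \<in> carrier (C0 XU)" "cmod (cutoff A x) \<le> 1" "x \<in> A \<Longrightarrow> cutoff A x = 1"
proof -
  have "\<exists>\<eta>. \<eta> \<in> carrier (C0 XU) \<and> (\<forall>x. cmod (\<eta> x) \<le> 1) \<and> (\<forall>x\<in>A. \<eta> x = 1)"
    using C0_cutoff[of XU A] assms U_subset Hausdorff locally_compact open_U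
    by (auto simp: locally_compact_space_open_subset Hausdorff_space_subtopology)
  from someI_ex[OF this] show "cutoff A \<in> carrier (C0 XU)" "cmod (cutoff A x) \<le> 1"
    "x \<in> A \<Longrightarrow> cutoff A x = 1" unfolding cutoff_def by blast+
qed

text \<open>An element of \<open>E\<close> need not be approximable in norm by elements supported in \<open>U\<close>, but on the
  pairs below a pointwise approximation along cutoff functions suffices to compare norms.\<close>

definition compatible :: "(('a \<Rightarrow> complex) \<Rightarrow> 'a \<Rightarrow> complex) \<Rightarrow> (('a \<Rightarrow> complex) \<Rightarrow> 'a \<Rightarrow> complex) \<Rightarrow> bool"
  where "compatible t r \<longleftrightarrow> t \<in> carrier (adjointables R.E) \<and> r \<in> carrier (adjointables E) \<and>
    (\<forall>\<psi>\<in>R.M. r \<psi> = t \<psi>) \<and>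
    (\<forall>g\<in>M. \<forall>x. ((\<lambda>A. r (\<lambda>u. (cutoff A u - 1) * g u) x) \<longlongrightarrow> 0) (finite_subsets_at_top U))"

lemma cutoff_minus_one:
  assumes "finite A" "A \<subseteq> U" "g \<in> M"
  shows "(\<lambda>u. (cutoff A u - 1) * g u) \<in> M"
  using module_diff[OF module_U_D(1)[OF mult_C0_U[OF cutoff(1)[OF assms(1,2)] assms(3)]] assms(3)]
  by (simp add: left_diff_distrib)

lemma eventually_subsets: "\<forall>\<^sub>F A in finite_subsets_at_top U. finite A \<and> A \<subseteq> U"
  by auto

lemma eventually_superset:
  "finite B \<Longrightarrow> B \<subseteq> U \<Longrightarrow> \<forall>\<^sub>F A in finite_subsets_at_top U. finite A \<and> A \<subseteq> U \<and> B \<subseteq> A"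
  by (auto simp: eventually_finite_subsets_at_top)

text \<open>The bound for the cut-off vectors does not depend on the finite set A, and only finitely
  many points B of a fibre are inspected at a time. Termwise limits thus preserve the bound, and
  \<open>hnorm_leI\<close> reassembles the norm of \<open>r g\<close>.\<close>

lemma compatible_nrm_le:
  assumes "compatible t r"
  shows "nrm (adjointables E) r \<le> nrm (adjointables R.E) t"
proof -
  have t: "t \<in> carrier (adjointables R.E)" and r: "r \<in> carrier (adjointables E)"
    and rt: "\<And>\<psi>. \<psi> \<in> R.M \<Longrightarrow> r \<psi> = t \<psi>"
    and lim: "\<And>g x. g \<in> M \<Longrightarrow>
      ((\<lambda>A. r (\<lambda>u. (cutoff A u - 1) * g u) x) \<longlongrightarrow> 0) (finite_subsets_at_top U)"
    using assms by (auto simp: compatible_def)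
  note t0 = R.H.nrm_op_nonneg[OF t]
  show ?thesis
  proof (rule H.nrm_op_leI[OF _ t0])
    fix g assume "g \<in> carrier E"
    then have g: "g \<in> M" by (simp add: corr_simps)
    have rM: "r g \<in> M" using H.op_closed[OF r] g by (simp add: corr_simps)
    let ?c = "\<lambda>A u. cutoff A u * g u"
    show "hnorm E (r g) \<le> nrm (adjointables R.E) t * hnorm E g"
    proof (rule hnorm_leI[OF rM])
      show "0 \<le> nrm (adjointables R.E) t * hnorm E g" using t0 hnorm_nonneg[OF g] by simp
      fix B y assume B: "finite B" "B \<subseteq> fibre X F y"
      have "((\<lambda>A. r g x + r (\<lambda>u. (cutoff A u - 1) * g u) x) \<longlongrightarrow> r g x + 0) (finite_subsets_at_top U)" for x
        by (intro tendsto_add tendsto_const lim g)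
      note lim' = this
      have ev: "\<forall>\<^sub>F A in finite_subsets_at_top U. r g x + r (\<lambda>u. (cutoff A u - 1) * g u) x = r (?c A) x" for x
        using eventually_subsets
      proof eventually_elim
        case (elim A)
        \<comment> \<open>Additivity of r applied to the splitting of the cut-off vector into g and
          (cutoff - 1) g.\<close>
        have "r (\<lambda>u. g u + (cutoff A u - 1) * g u) = (\<lambda>x. r g x + r (\<lambda>u. (cutoff A u - 1) * g u) x)"
          using H.op_add[OF r, of g "\<lambda>u. (cutoff A u - 1) * g u"] g cutoff_minus_one[of A g] elim
          by (simp add: corr_simps)
        then show ?case by (simp add: algebra_simps)
      qed
      have pt: "((\<lambda>A. r (?c A) x) \<longlongrightarrow> r g x) (finite_subsets_at_top U)" for x
        using Lim_transform_eventually[OF lim' ev, of x] by simp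
      have "((\<lambda>A. \<Sum>x\<in>B. real (ind x) * (cmod (r (?c A) x))\<^sup>2)
          \<longlongrightarrow> (\<Sum>x\<in>B. real (ind x) * (cmod (r g x))\<^sup>2)) (finite_subsets_at_top U)"
        by (intro tendsto_intros pt)
      then show "(\<Sum>x\<in>B. real (ind x) * (cmod (r g x))\<^sup>2) \<le> (nrm (adjointables R.E) t * hnorm E g)\<^sup>2"
      proof (rule tendsto_upperbound)
        show "\<forall>\<^sub>F A in finite_subsets_at_top U. (\<Sum>x\<in>B. real (ind x) * (cmod (r (?c A) x))\<^sup>2)
            \<le> (nrm (adjointables R.E) t * hnorm E g)\<^sup>2"
          using eventually_subsets
        proof eventually_elim
          case (elim A)
          then have c: "?c A \<in> R.M" using g by (intro mult_C0_U cutoff) auto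
          have tc: "t (?c A) \<in> R.M" using R.H.op_closed[OF t] c by (simp add: R.corr_simps)
          have "(\<Sum>x\<in>B. real (ind x) * (cmod (r (?c A) x))\<^sup>2) \<le> (hnorm E (t (?c A)))\<^sup>2"
            \<comment> \<open>On the cut-off vector r agrees with t, so the estimate can move to the
              smaller module, where t is bounded by its own norm.\<close>
            unfolding rt[OF c] by (rule finite_sum_le_hnorm[OF module_U_D(1)[OF tc] B])
          also have "\<dots> \<le> (nrm (adjointables R.E) t * hnorm E g)\<^sup>2"
          proof (rule power_mono[OF _ hnorm_nonneg[OF module_U_D(1)[OF tc]]])
            have "hnorm E (t (?c A)) \<le> nrm (adjointables R.E) t * hnorm E (?c A)"
              using R.H.op_bound[OF t, of "?c A"] c tc by (simp add: R.corr_simps hnorm_U)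
            also have "\<dots> \<le> nrm (adjointables R.E) t * hnorm E g"
              using hnorm_mult_le[OF g module_U_D(1)[OF c], of 1] cutoff(2)[of A] elim t0
              by (intro mult_left_mono) auto
            finally show "hnorm E (t (?c A)) \<le> nrm (adjointables R.E) t * hnorm E g" .
          qed
          finally show ?case .
        qed
      qed simp
    qed
  qed
qed

lemma compatible_add:
  assumes "compatible t r" "compatible t' r'"
  shows "compatible (t \<oplus>\<^bsub>adjointables R.E\<^esub> t') (r \<oplus>\<^bsub>adjointables E\<^esub> r')"
  unfolding compatible_def
proof (intro conjI ballI allI)
  note c = assms[unfolded compatible_def]
  show "t \<oplus>\<^bsub>adjointables R.E\<^esub> t' \<in> carrier (adjointables R.E)" "r \<oplus>\<^bsub>adjointables E\<^esub> r' \<in> carrier (adjointables E)"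
    using c by (auto intro: R.H.op_add_closed H.op_add_closed)
  show "(r \<oplus>\<^bsub>adjointables E\<^esub> r') \<psi> = (t \<oplus>\<^bsub>adjointables R.E\<^esub> t') \<psi>" if "\<psi> \<in> R.M" for \<psi>
    using c that module_U_D(1)[OF that] by (simp add: H.adjointables_simps R.H.adjointables_simps corr_simps R.corr_simps)
  fix g x assume g: "g \<in> M"
  have "((\<lambda>A. r (\<lambda>u. (cutoff A u - 1) * g u) x + r' (\<lambda>u. (cutoff A u - 1) * g u) x) \<longlongrightarrow> 0 + 0)
      (finite_subsets_at_top U)"
    using c g by (intro tendsto_add) auto
  \<comment> \<open>Sums of operators are formed on the module only, so the equality awaits an A for
    which the argument is known to lie in the module.\<close>
  moreover have "\<forall>\<^sub>F A in finite_subsets_at_top U.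
      r (\<lambda>u. (cutoff A u - 1) * g u) x + r' (\<lambda>u. (cutoff A u - 1) * g u) x
      = (r \<oplus>\<^bsub>adjointables E\<^esub> r') (\<lambda>u. (cutoff A u - 1) * g u) x"
    using eventually_subsets
    by eventually_elim (simp add: H.adjointables_simps corr_simps cutoff_minus_one g)
  ultimately show "((\<lambda>A. (r \<oplus>\<^bsub>adjointables E\<^esub> r') (\<lambda>u. (cutoff A u - 1) * g u) x) \<longlongrightarrow> 0)
      (finite_subsets_at_top U)"
    by (simp add: tendsto_cong)
qed

lemma compatible_scale:
  assumes "compatible t r"
  shows "compatible (c \<odot>\<^bsub>adjointables R.E\<^esub> t) (c \<odot>\<^bsub>adjointables E\<^esub> r)"
  unfolding compatible_def
proof (intro conjI ballI allI)
  note a = assms[unfolded compatible_def]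
  show "c \<odot>\<^bsub>adjointables R.E\<^esub> t \<in> carrier (adjointables R.E)" "c \<odot>\<^bsub>adjointables E\<^esub> r \<in> carrier (adjointables E)"
    using a by (auto intro: R.H.op_scale_closed H.op_scale_closed)
  show "(c \<odot>\<^bsub>adjointables E\<^esub> r) \<psi> = (c \<odot>\<^bsub>adjointables R.E\<^esub> t) \<psi>" if "\<psi> \<in> R.M" for \<psi>
    using a that module_U_D(1)[OF that] by (simp add: H.adjointables_simps R.H.adjointables_simps corr_simps R.corr_simps)
  fix g x assume g: "g \<in> M"
  have "((\<lambda>A. c * r (\<lambda>u. (cutoff A u - 1) * g u) x) \<longlongrightarrow> c * 0) (finite_subsets_at_top U)"
    using a g by (intro tendsto_mult tendsto_const) auto
  moreover have "\<forall>\<^sub>F A in finite_subsets_at_top U. c * r (\<lambda>u. (cutoff A u - 1) * g u) x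
      = (c \<odot>\<^bsub>adjointables E\<^esub> r) (\<lambda>u. (cutoff A u - 1) * g u) x"
    using eventually_subsets
    by eventually_elim (simp add: H.adjointables_simps corr_simps cutoff_minus_one g)
  ultimately show "((\<lambda>A. (c \<odot>\<^bsub>adjointables E\<^esub> r) (\<lambda>u. (cutoff A u - 1) * g u) x) \<longlongrightarrow> 0)
      (finite_subsets_at_top U)"
    by (simp add: tendsto_cong)
qed

text \<open>The net is eventually 0, not merely convergent: at x in U as soon as A contains x, and
  off U because a vanishes there.\<close>

lemma compatible_lact:
  assumes a: "a \<in> carrier (C0 XU)"
  shows "compatible (lact R.E a) (lact E a)"
  unfolding compatible_def
proof (intro conjI ballI allI)
  have aX: "a \<in> carrier (C0 X)" and out: "\<And>x. x \<notin> U \<Longrightarrow> a x = 0" using a by (auto simp: C0_U)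
  show "lact R.E a \<in> carrier (adjointables R.E)" by (rule R.lact_closed[OF a])
  show "lact E a \<in> carrier (adjointables E)" by (rule lact_closed[OF aX])
  show "lact E a \<psi> = lact R.E a \<psi>" if "\<psi> \<in> R.M" for \<psi>
    using that by (simp add: corr_simps R.corr_simps module_U_D)
  fix g x assume g: "g \<in> M"
  have "\<forall>\<^sub>F A in finite_subsets_at_top U. lact E a (\<lambda>u. (cutoff A u - 1) * g u) x = 0"
  proof (cases "x \<in> U")
    case True
    then have "\<forall>\<^sub>F A in finite_subsets_at_top U. finite A \<and> A \<subseteq> U \<and> {x} \<subseteq> A"
      by (intro eventually_superset) auto
    then show ?thesis
      by eventually_elim (simp add: corr_simps cutoff_minus_one g cutoff)
  next
    case False
    show ?thesis using eventually_subsets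
      by eventually_elim (simp add: corr_simps cutoff_minus_one g out[OF False])
  qed
  then show "((\<lambda>A. lact E a (\<lambda>u. (cutoff A u - 1) * g u) x) \<longlongrightarrow> 0) (finite_subsets_at_top U)"
    by (rule tendsto_eventually)
qed

text \<open>The value at x involves only the fibre over F x, so dominated convergence along this one
  fibre suffices. A finite part B carries the majorant up to \<epsilon>/2; once A contains B
  \<inter> U, the terms in B vanish, in U by the cutoff and off U because f is 0 there.\<close>

lemma compatible_theta:
  assumes e: "e \<in> R.M" and f: "f \<in> R.M"
  shows "compatible (theta R.E e f) (theta E e f)"
  unfolding compatible_def
proof (intro conjI ballI allI)
  note eM = module_U_D(1)[OF e] and fM = module_U_D(1)[OF f]
  show "theta R.E e f \<in> carrier (adjointables R.E)" using e f by (intro R.H.theta_closed) (simp_all add: R.corr_simps)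
  show "theta E e f \<in> carrier (adjointables E)" using eM fM by (intro H.theta_closed) (simp_all add: corr_simps)
  show "theta E e f \<psi> = theta R.E e f \<psi>" if "\<psi> \<in> R.M" for \<psi>
    using that module_U_D(1)[OF that] ip_U[OF f, of \<psi>] by (simp add: theta_def corr_simps R.corr_simps)
  fix g x assume g: "g \<in> M"
  let ?d = "\<lambda>A u. (cutoff A u - 1) * g u"
  \<comment> \<open>The factor 2 bounds |cutoff - 1|, and |f g| is at most the sum of the two
    squares.\<close>
  let ?h = "\<lambda>u. 2 * ((cmod (f u))\<^sup>2 + (cmod (g u))\<^sup>2)"
  have h: "fibre_summable ?h"
    by (intro fibre_summable_cmult dominator_summable ip_dominator fM g)
  have "((\<lambda>A. Phi X Y F ind (\<lambda>u. cnj (f u) * ?d A u) (F x)) \<longlongrightarrow> 0) (finite_subsets_at_top U)"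
  proof (rule tendstoI)
    fix \<epsilon> :: real assume e: "0 < \<epsilon>"
    have "(\<lambda>x. real (ind x) * ?h x) summable_on fibre X F (F x)" using h by (simp add: fibre_summable_def)
    from infsum_finite_approximation[OF this, of "\<epsilon> / 2"] e
    obtain B where B: "finite B" "B \<subseteq> fibre X F (F x)"
      and Bsum: "\<bar>(\<Sum>x\<in>B. real (ind x) * ?h x) - fibre_sum ?h (F x)\<bar> \<le> \<epsilon> / 2"
      by (auto simp: dist_real_def fibre_sum_def)
    have "\<forall>\<^sub>F A in finite_subsets_at_top U. finite A \<and> A \<subseteq> U \<and> B \<inter> U \<subseteq> A"
      using B(1) by (intro eventually_superset) auto
    then show "\<forall>\<^sub>F A in finite_subsets_at_top U. dist (Phi X Y F ind (\<lambda>u. cnj (f u) * ?d A u) (F x)) 0 < \<epsilon>"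
    proof eventually_elim
      case (elim A)
      have "cmod (cnj (f u) * ?d A u) \<le> ?h u" for u
      proof -
        have "cmod (cutoff A u - 1) \<le> 2"
          using norm_triangle_ineq4[of "cutoff A u" 1] cutoff(2)[of A u] elim by simp
        then have "cmod (cutoff A u - 1) * cmod (cnj (f u) * g u) \<le> 2 * ((cmod (f u))\<^sup>2 + (cmod (g u))\<^sup>2)"
          by (intro mult_mono ip_dominator fM g) auto
        then show ?thesis by (simp add: norm_mult ac_simps)
      qed
      from Phi_residual[OF h this B]
      have "cmod (Phi X Y F ind (\<lambda>u. cnj (f u) * ?d A u) (F x)
          - (\<Sum>u\<in>B. of_nat (ind u) * (cnj (f u) * ?d A u))) \<le> \<epsilon> / 2"
        using Bsum by linarith
      moreover have "(\<Sum>u\<in>B. of_nat (ind u) * (cnj (f u) * ?d A u)) = 0"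
      proof (rule sum.neutral, rule ballI)
        fix u assume "u \<in> B"
        then show "of_nat (ind u) * (cnj (f u) * ?d A u) = 0"
          using elim cutoff(3)[of A u] module_U_D(2)[OF f, of u] by (cases "u \<in> U") auto
      qed
      ultimately show ?case using e by (simp add: dist_norm)
    qed
  qed
  then have "((\<lambda>A. e x * Phi X Y F ind (\<lambda>u. cnj (f u) * ?d A u) (F x)) \<longlongrightarrow> e x * 0) (finite_subsets_at_top U)"
    by (intro tendsto_mult tendsto_const)
  moreover have "\<forall>\<^sub>F A in finite_subsets_at_top U.
      e x * Phi X Y F ind (\<lambda>u. cnj (f u) * ?d A u) (F x) = theta E e f (?d A) x"
    using eventually_subsets by eventually_elim (simp add: theta_def corr_simps cutoff_minus_one g)
  ultimately show "((\<lambda>A. theta E e f (?d A) x) \<longlongrightarrow> 0) (finite_subsets_at_top U)"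
    by (simp add: tendsto_cong)
qed

section \<open>The inclusion as a morphism of correspondences\<close>

sublocale I: hilbert_module_map R.E E "ext_zero U" "ext_zero V"
proof unfold_locales
  note simps = R.corr_simps corr_simps
  show "complex_linear R.E E (ext_zero U)"
    by (auto simp: complex_linear_def simps ext_zero_id module_U_D R.module_add R.module_scale)
  fix e f assume e: "e \<in> carrier R.E"
  then have e': "e \<in> R.M" by (simp add: simps)
  show "ext_zero U (ract R.E e b) = ract E (ext_zero U e) (ext_zero V b)" if "b \<in> carrier (coeff R.E)" for b
    using that ext_zero_id(2)[OF R.module_ract[OF e', of b]] by (simp add: simps ext_zero_id e')
  assume "f \<in> carrier R.E"
  then have f': "f \<in> R.M" by (simp add: simps)
  have "ip R.E e f \<in> carrier (C0 YV)" using R.ip_closed_C0[OF e' f'] by (simp add: simps)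
  then show "ip E (ext_zero U e) (ext_zero U f) = ext_zero V (ip R.E e f)"
    by (simp add: ext_zero_id e' f' ip_U)
qed

lemma span_graph_compatible: "(t, r) \<in> I.span_graph \<Longrightarrow> compatible t r"
proof (induction rule: I.span_graph.induct)
  case zero
  \<comment> \<open>The zero operator is left multiplication by the zero function, so the base case
    is an instance of \<open>compatible_lact\<close>.\<close>
  have "compatible (lact R.E (\<lambda>x. 0)) (lact E (\<lambda>x. 0))" by (intro compatible_lact C0_zero)
  moreover have "lact R.E (\<lambda>x. 0) = zero (adjointables R.E)" "lact E (\<lambda>x. 0) = zero (adjointables E)"
    by (simp_all add: R.corr_simps corr_simps H.adjointables_simps R.H.adjointables_simps)
  ultimately show ?case by simp
next
  case (step t r e f c)
  then show ?case
    by (simp add: compatible_add compatible_scale compatible_theta R.corr_simps(1) ext_zero_id)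
qed

sublocale I: contractive_module_map R.E E "ext_zero U" "ext_zero V"
  by unfold_locales (rule compatible_nrm_le[OF span_graph_compatible])

text \<open>An approximation t of the left multiplication on the smaller module has a partner r, and
  the difference of the two pairs is again compatible, so r approximates on the larger module at
  least as well. Membership in the closed graph yields compactness of \<open>lect E a\<close> and
  the value of the induced homomorphism at once.\<close>

lemma lact_gclosure:
  assumes "a \<in> J_ideal R.E"
  shows "(lact R.E a, lact E a) \<in> I.K.gclosure"
proof (rule I.K.gclosureI_approx)
  have a: "a \<in> carrier (C0 XU)" and c: "lact R.E a \<in> carrier (compacts R.E)"
    using assms by (auto simp: J_ideal_def R.corr_simps(8))
  note comp = compatible_lact[OF a]
  show "lact R.E a \<in> carrier (adjointables R.E)" "lact E a \<in> carrier (adjointables E)"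
    using comp by (auto simp: compatible_def)
  fix \<epsilon> :: real assume "0 < \<epsilon>"
  then obtain t where t: "t \<in> linear_span (adjointables R.E) I.thetas"
    "nrm (adjointables R.E) (lact R.E a \<ominus>\<^bsub>adjointables R.E\<^esub> t) < \<epsilon>"
    using c by (auto simp: compacts_simps closed_span_def)
  then obtain r where r: "(t, r) \<in> I.span_graph" using I.Domain_span_graph by blast
  have "compatible (lact R.E a \<ominus>\<^bsub>adjointables R.E\<^esub> t) (lact E a \<ominus>\<^bsub>adjointables E\<^esub> r)"
    unfolding diff_def by (intro compatible_add compatible_scale comp span_graph_compatible[OF r])
  from compatible_nrm_le[OF this] t(2) r
  show "\<exists>(t, r)\<in>I.span_graph. nrm (adjointables R.E) (lact R.E a \<ominus>\<^bsub>adjointables R.E\<^esub> t) < \<epsilon>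
      \<and> nrm (adjointables E) (lact E a \<ominus>\<^bsub>adjointables E\<^esub> r) < \<epsilon>"
    by force
qed

lemma corr_morphism_inclusion: "corr_morphism R.E E (ext_zero U) (ext_zero U) (ext_zero V)"
  unfolding corr_morphism_def
proof (intro conjI ballI)
  note simps = R.corr_simps corr_simps C0_simps
  show "correspondence R.E" by (rule R.correspondence_corr)
  show "correspondence E" by (rule correspondence_corr)
  show "star_hom (left_alg R.E) (left_alg E) (ext_zero U)"
    unfolding star_hom_def complex_linear_def simps(8) corr_simps(8)
    using C0_U by (auto simp: C0_simps ext_zero_id C0_add C0_scale C0_mult C0_star)
  show "star_hom (coeff R.E) (coeff E) (ext_zero V)"
    unfolding star_hom_def complex_linear_def R.corr_simps(5) corr_simps(5)
    using C0_V by (auto simp: C0_simps ext_zero_id C0_add C0_scale C0_mult C0_star)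
  show "complex_linear R.E E (ext_zero U)" by (rule I.S_linear)
  show "ip E (ext_zero U e) (ext_zero U f) = ext_zero V (ip R.E e f)"
    if "e \<in> carrier R.E" "f \<in> carrier R.E" for e f
    using that by (rule I.ip_S)
  show "ext_zero U (lact R.E a e) = lact E (ext_zero U a) (ext_zero U e)"
    if "a \<in> carrier (left_alg R.E)" "e \<in> carrier R.E" for a e
  proof -
    have "a \<in> carrier (C0 XU)" "e \<in> R.M" using that by (simp_all add: R.corr_simps)
    then show ?thesis
      using ext_zero_id(2)[OF R.module_lact] by (simp add: R.corr_simps corr_simps ext_zero_id module_U_D)
  qed
  have a: "ext_zero U a = a" "a \<in> carrier (C0 X)" if "a \<in> J_ideal R.E" for a
    using that by (auto simp: J_ideal_def R.corr_simps(8) ext_zero_id C0_U)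
  show "ext_zero U ` J_ideal R.E \<subseteq> J_ideal E"
    using a I.gclosure_compact(2)[OF lact_gclosure] by (auto simp: J_ideal_def corr_simps(8))
  show "hat R.E E (ext_zero U) (lact R.E a) = lact E (ext_zero U a)" if "a \<in> J_ideal R.E" for a
    using I.extension_eq[OF lact_gclosure[OF that]] a(1)[OF that] by (simp add: I.hat_eq_extension)
qed

end

theorem proposition11:
  fixes X :: "'a topology" and Y :: "'b topology"
    and F :: "'a \<Rightarrow> 'b" and ind :: "'a \<Rightarrow> nat"
    and U :: "'a set" and V :: "'b set"
  assumes "locally_compact_space X" and "Hausdorff_space X"
    and "locally_compact_space Y" and "Hausdorff_space Y"
    and "separable_calg (C0 X)" and "separable_calg (C0 Y)"
    and "branched X Y F ind"
    and "openin X U" and "openin Y V" and "F ` U \<subseteq> V"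
  shows "branched (subtopology X U) (subtopology Y V) F ind \<and>
    corr_morphism
      (branched_corr (subtopology X U) (subtopology Y V) F ind)
      (branched_corr X Y F ind)
      (ext_zero U) (ext_zero U) (ext_zero V)"
proof -
  interpret branched_restriction X Y F ind U V
    by unfold_locales fact+
  show ?thesis using R.branched corr_morphism_inclusion by blast
qed

end
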